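(* Let $(\mathbf{L},\mathcal{F})$ define a regular optimal control problem. Then there exists a submanifold $\mathcal{W}_1^{\mathcal{F}}$ of $\mathcal{W}_0^{\mathcal{F}}$ and a unique vector field $Z\in\mathfrak{X}(\mathcal{W}_0^{\mathcal{F}})$ tangent to $\mathcal{W}_1^{\mathcal{F}}$ such that $$ [\,i(Z)\Omega_{\mathcal{W}_0^{\mathcal{F}}}]\big|_{\mathcal{W}_1^{\mathcal{F}}}=0,\qquad [\,i(Z)\,dt]\big|_{\mathcal{W}_1^{\mathcal{F}}}=1 . $$ The integral curves $\Gamma$ of $Z$ satisfy locally the necessary conditions of the weak form of Pontryagin's Maximum Principle; that is, writing $\Gamma(t)=(t,q^i(t),u^a(t),p(t),p_i(t))$ in natural coordinates of $C\times_E T^*E$, one has along $\Gamma$ $$ \frac{dq^i}{dt}=\frac{\partial\mathcal{H}}{\partial p_i},\qquad \frac{dp_i}{dt}=-\frac{\partial\mathcal{H}}{\partial q^i},\qquad \mathcal{H}=0,\qquad \frac{\partial\mathcal{H}}{\partial u^a}=0, $$ for $1\le i\le n$, $1\le a\le m$, where $\mathcal{H}=p+p_j\mathcal{F}^j-\mathbb{L}$.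
   Context: Manifolds are real, second countable and $C^\infty$; maps are $C^\infty$; repeated indices are summed. Setting. $\pi\colon E\to\mathbb{R}$ is a fiber bundle with $\dim E=n+1$ and adapted local coordinates $(t,q^i)$, $1\le i\le n$, where $t$ is the global coordinate of $\mathbb{R}$; $dt$ also denotes its pullbacks. $\pi^C\colon C\to E$ is a fiber bundle (the bundle of controls) with coordinates $(t,q^i,u^a)$, $1\le a\le m$; $\bar\pi^C=\pi\circ\pi^C$. $\pi^1\colon J^1\pi\to E$ is the first jet bundle of $\pi$, with coordinates $(t,q^i,v^i)$. The state equations are given by a smooth map $\mathcal{F}\colon C\to J^1\pi$ with $\pi^1\circ\mathcal{F}=\pi^C$, locally $\mathcal{F}(t,q,u)=(t,q^i,\mathcal{F}^i(t,q,u))$. An optimal control problem is given by a pair $(\mathbf{L},\mathcal{F})$ with $\mathbf{L}=\mathbb{L}\,dt$, where $\mathbb{L}\in C^\infty(C)$ is the cost function. Regularity. The problem is regular if the $m\times m$ matrix $\left(\partial^2\mathcal{H}/\partial u^a\partial u^b\right)$ has maximal rank. Spaces and forms. $\mathcal{W}^{\mathcal{F}}=\mathrm{Graph}\,\mathcal{F}\times_E T^*E\cong C\times_E T^*E$, with coordinates $(t,q^i,u^a,p,p_i)$, where $p\,dt+p_i\,dq^i$ is the general covector in $T^*E$. The function $H_{\mathcal{W}^{\mathcal{F}}}\in C^\infty(\mathcal{W}^{\mathcal{F}})$ sends $(c,\alpha)$ to $\alpha\big(T\phi(\partial/\partial t)\big)-\mathbb{L}(c)$, where $\phi$ is any local section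 of $\pi$ with $j^1\phi(\bar\pi^C(c))=\mathcal{F}(c)$; locally $H_{\mathcal{W}^{\mathcal{F}}}=p+p_i\mathcal{F}^i-\mathbb{L}=\mathcal{H}$. The submanifold $\mathcal{W}_0^{\mathcal{F}}=\{H_{\mathcal{W}^{\mathcal{F}}}=0\}\subset\mathcal{W}^{\mathcal{F}}$ has coordinates $(t,q^i,u^a,p_i)$, with $p=\mathbb{L}-p_i\mathcal{F}^i$. $\Omega_{\mathcal{W}_0^{\mathcal{F}}}$ is the pullback to $\mathcal{W}_0^{\mathcal{F}}$ (by inclusion and projection to $T^*E$) of the canonical 2-form $dq^i\wedge dp_i+dt\wedge dp$ of $T^*E$; locally $\Omega_{\mathcal{W}_0^{\mathcal{F}}}=-dp_i\wedge dq^i-d(\mathbb{L}-p_i\mathcal{F}^i)\wedge dt$.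
   Formalization: Uniqueness of Z is asserted only along W_1 (adding a field vanishing on W_1 gives another solution on W_0), and the Pontryagin equations are asserted for integral curves of Z lying in W_1, since off W_1 the condition ∂H/∂u=0 fails. *)

theory Defs
  imports "HOL-Analysis.Analysis"
begin

section \<open>Smooth maps between Euclidean spaces\<close>

(* Intended for open S only: the derivatives are taken at interior points. *)
primrec Ck_on :: "nat \<Rightarrow> 'x::euclidean_space set \<Rightarrow> ('x \<Rightarrow> 'y::euclidean_space) \<Rightarrow> bool" where
  "Ck_on 0 S f \<longleftrightarrow> continuous_on S f"
| "Ck_on (Suc k) S f \<longleftrightarrow>
     (\<forall>x\<in>S. f differentiable (at x)) \<and>
     (\<forall>v. Ck_on k S (\<lambda>x. frechet_derivative f (at x) v))"

definition smooth_on :: "'x::euclidean_space set \<Rightarrow> ('x \<Rightarrow> 'y::euclidean_space) \<Rightarrow> bool" where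
  "smooth_on S f \<longleftrightarrow> (\<forall>k. Ck_on k S f)"

definition partial :: "'x::euclidean_space \<Rightarrow> ('x \<Rightarrow> 'y::euclidean_space) \<Rightarrow> 'x \<Rightarrow> 'y" where
  "partial v f x = frechet_derivative f (at x) v"


section \<open>Smooth manifolds\<close>

text \<open>
  A manifold is given by an atlas: the underlying set is the union of the chart domains, and
  the topology is the one for which the charts are homeomorphisms onto open sets.  The dimension
  is the dimension of the model space \<open>'x\<close>.  Values of a chart outside its domain are irrelevant.
\<close>

type_synonym ('a, 'x) chart = "'a set \<times> ('a \<Rightarrow> 'x)"
type_synonym ('a, 'x) atlas = "('a, 'x) chart set"

abbreviation cdom :: "('a, 'x) chart \<Rightarrow> 'a set" where "cdom c \<equiv> fst c"
abbreviation coord :: "('a, 'x) chart \<Rightarrow> 'a \<Rightarrow> 'x" where "coord c \<equiv> snd c"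
abbreviation param :: "('a, 'x) chart \<Rightarrow> 'x \<Rightarrow> 'a" where "param c \<equiv> inv_into (fst c) (snd c)"

definition is_chart :: "('a, 'x::euclidean_space) chart \<Rightarrow> bool" where
  "is_chart c \<longleftrightarrow> inj_on (coord c) (cdom c) \<and> open (coord c ` cdom c)"

definition smooth_transition ::
    "('a, 'x::euclidean_space) chart \<Rightarrow> ('a, 'x) chart \<Rightarrow> bool" where
  "smooth_transition c d \<longleftrightarrow>
     open (coord c ` (cdom c \<inter> cdom d)) \<and>
     smooth_on (coord c ` (cdom c \<inter> cdom d)) (coord d \<circ> param c)"

definition compatible :: "('a, 'x::euclidean_space) chart \<Rightarrow> ('a, 'x) chart \<Rightarrow> bool" where
  "compatible c d \<longleftrightarrow> smooth_transition c d \<and> smooth_transition d c"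

definition carrier :: "('a, 'x) atlas \<Rightarrow> 'a set" where
  "carrier A = (\<Union>c\<in>A. cdom c)"

definition open_in :: "('a, 'x::euclidean_space) atlas \<Rightarrow> 'a set \<Rightarrow> bool" where
  "open_in A U \<longleftrightarrow> U \<subseteq> carrier A \<and> (\<forall>c\<in>A. open (coord c ` (U \<inter> cdom c)))"

definition manifold :: "('a, 'x::euclidean_space) atlas \<Rightarrow> bool" where
  "manifold A \<longleftrightarrow>
     (\<forall>c\<in>A. is_chart c) \<and> (\<forall>c\<in>A. \<forall>d\<in>A. compatible c d) \<and>
     Hausdorff_space (topology (open_in A)) \<and> second_countable (topology (open_in A))"

(* the maximal atlas of the smooth structure generated by A *)
definition charts :: "('a, 'x::euclidean_space) atlas \<Rightarrow> ('a, 'x) atlas" where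
  "charts A = {d. is_chart d \<and> cdom d \<subseteq> carrier A \<and> (\<forall>c\<in>A. compatible c d)}"

definition euclidean_atlas :: "('x::euclidean_space, 'x) atlas" where
  "euclidean_atlas = {(UNIV, \<lambda>x. x)}"

definition restrict_atlas :: "('a, 'x) atlas \<Rightarrow> 'a set \<Rightarrow> ('a, 'x) atlas" where
  "restrict_atlas A U = {(cdom c \<inter> U, coord c) | c. c \<in> A}"

definition prod_atlas :: "('a, 'x) atlas \<Rightarrow> ('b, 'y) atlas \<Rightarrow> ('a \<times> 'b, 'x \<times> 'y) atlas" where
  "prod_atlas A B =
     {(cdom c \<times> cdom d, \<lambda>(a, b). (coord c a, coord d b)) | c d. c \<in> A \<and> d \<in> B}"

(* The openness condition amounts to continuity. *)
definition smooth_map ::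
    "('a, 'x::euclidean_space) atlas \<Rightarrow> ('b, 'y::euclidean_space) atlas \<Rightarrow> ('a \<Rightarrow> 'b) \<Rightarrow> bool" where
  "smooth_map A B f \<longleftrightarrow>
     f ` carrier A \<subseteq> carrier B \<and>
     (\<forall>c\<in>A. \<forall>d\<in>B. open (coord c ` (cdom c \<inter> f -` cdom d)) \<and>
        smooth_on (coord c ` (cdom c \<inter> f -` cdom d)) (coord d \<circ> f \<circ> param c))"

definition diffeomorphism ::
    "('a, 'x::euclidean_space) atlas \<Rightarrow> ('b, 'y::euclidean_space) atlas \<Rightarrow> ('a \<Rightarrow> 'b) \<Rightarrow> bool" where
  "diffeomorphism A B f \<longleftrightarrow>
     bij_betw f (carrier A) (carrier B) \<and> smooth_map A B f \<and>
     smooth_map B A (inv_into (carrier A) f)"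

(* locally trivial bundle with total space E, base B, projection p and typical fiber F *)
definition fiber_bundle ::
    "('a, 'x::euclidean_space) atlas \<Rightarrow> ('b, 'y::euclidean_space) atlas \<Rightarrow> ('a \<Rightarrow> 'b) \<Rightarrow>
     ('f, 'z::euclidean_space) atlas \<Rightarrow> bool" where
  "fiber_bundle E B p F \<longleftrightarrow>
     manifold E \<and> manifold B \<and> manifold F \<and> smooth_map E B p \<and> p ` carrier E = carrier B \<and>
     (\<forall>b\<in>carrier B. \<exists>U \<Phi>. open_in B U \<and> b \<in> U \<and>
        diffeomorphism (restrict_atlas E (p -` U)) (prod_atlas (restrict_atlas B U) F) \<Phi> \<and>
        (\<forall>a\<in>carrier E. p a \<in> U \<longrightarrow> fst (\<Phi> a) = p a))"


section \<open>Tangent vectors, vector fields, submanifolds\<close>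

text \<open>
  A tangent vector at \<open>p\<close> is a family of coordinate vectors, one for each chart of the maximal
  atlas around \<open>p\<close>, related by the derivatives of the transition maps (and set to zero at all
  other charts).
\<close>

type_synonym ('a, 'x) tangent = "('a, 'x) chart \<Rightarrow> 'x"

definition tangent_space ::
    "('a, 'x::euclidean_space) atlas \<Rightarrow> 'a \<Rightarrow> ('a, 'x) tangent set" where
  "tangent_space A p = {v.
     (\<forall>c\<in>charts A. \<forall>d\<in>charts A. p \<in> cdom c \<longrightarrow> p \<in> cdom d \<longrightarrow>
        v d = frechet_derivative (coord d \<circ> param c) (at (coord c p)) (v c)) \<and>
     (\<forall>c. \<not> (c \<in> charts A \<and> p \<in> cdom c) \<longrightarrow> v c = 0)}"

(* the tangent vector at p with components x in the chart c *)
definition coord_vector ::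
    "('a, 'x::euclidean_space) atlas \<Rightarrow> ('a, 'x) chart \<Rightarrow> 'a \<Rightarrow> 'x \<Rightarrow> ('a, 'x) tangent" where
  "coord_vector A c p x = (\<lambda>d. if d \<in> charts A \<and> p \<in> cdom d
     then frechet_derivative (coord d \<circ> param c) (at (coord c p)) x else 0)"

definition chart_at :: "('a, 'x::euclidean_space) atlas \<Rightarrow> 'a \<Rightarrow> ('a, 'x) chart" where
  "chart_at A p = (SOME c. c \<in> charts A \<and> p \<in> cdom c)"

definition tangent_map ::
    "('a, 'x::euclidean_space) atlas \<Rightarrow> ('b, 'y::euclidean_space) atlas \<Rightarrow> ('a \<Rightarrow> 'b) \<Rightarrow>
     'a \<Rightarrow> ('a, 'x) tangent \<Rightarrow> ('b, 'y) tangent" where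
  "tangent_map A B f p v = (\<lambda>d. if d \<in> charts B \<and> f p \<in> cdom d
     then frechet_derivative (coord d \<circ> f \<circ> param (chart_at A p))
            (at (coord (chart_at A p) p)) (v (chart_at A p))
     else 0)"

definition differential ::
    "('a, 'x::euclidean_space) atlas \<Rightarrow> ('a \<Rightarrow> real) \<Rightarrow> 'a \<Rightarrow> ('a, 'x) tangent \<Rightarrow> real" where
  "differential A f p v =
     frechet_derivative (f \<circ> param (chart_at A p)) (at (coord (chart_at A p) p)) (v (chart_at A p))"

(* the image of d/ds under the tangent map of the curve \<gamma> *)
definition velocity ::
    "('a, 'x::euclidean_space) atlas \<Rightarrow> (real \<Rightarrow> 'a) \<Rightarrow> real \<Rightarrow> ('a, 'x) tangent" where
  "velocity A \<gamma> s = (\<lambda>d. if d \<in> charts A \<and> \<gamma> s \<in> cdom d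
     then vector_derivative (coord d \<circ> \<gamma>) (at s) else 0)"

definition vector_field ::
    "('a, 'x::euclidean_space) atlas \<Rightarrow> ('a \<Rightarrow> ('a, 'x) tangent) \<Rightarrow> bool" where
  "vector_field A Z \<longleftrightarrow>
     (\<forall>p\<in>carrier A. Z p \<in> tangent_space A p) \<and>
     (\<forall>c\<in>charts A. smooth_on (coord c ` cdom c) (\<lambda>x. Z (param c x) c))"

definition integral_curve ::
    "('a, 'x::euclidean_space) atlas \<Rightarrow> ('a \<Rightarrow> ('a, 'x) tangent) \<Rightarrow> real set \<Rightarrow>
     (real \<Rightarrow> 'a) \<Rightarrow> bool" where
  "integral_curve A Z I \<gamma> \<longleftrightarrow>
     open I \<and> is_interval I \<and> smooth_map (restrict_atlas euclidean_atlas I) A \<gamma> \<and>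
     (\<forall>s\<in>I. velocity A \<gamma> s = Z (\<gamma> s))"

definition slice_chart ::
    "('a, 'x::euclidean_space) atlas \<Rightarrow> 'a set \<Rightarrow> ('a, 'x) chart \<Rightarrow> 'x set \<Rightarrow> bool" where
  "slice_chart A N c S \<longleftrightarrow>
     c \<in> charts A \<and> subspace S \<and> coord c ` (cdom c \<inter> N) = coord c ` cdom c \<inter> S"

definition submanifold :: "('a, 'x::euclidean_space) atlas \<Rightarrow> 'a set \<Rightarrow> bool" where
  "submanifold A N \<longleftrightarrow> N \<subseteq> carrier A \<and>
     (\<exists>k. \<forall>p\<in>N. \<exists>c S. p \<in> cdom c \<and> slice_chart A N c S \<and> dim S = k)"

definition tangent_to ::
    "('a, 'x::euclidean_space) atlas \<Rightarrow> 'a set \<Rightarrow> ('a \<Rightarrow> ('a, 'x) tangent) \<Rightarrow> bool" where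
  "tangent_to A N Z \<longleftrightarrow>
     (\<forall>p\<in>N. \<forall>c S. p \<in> cdom c \<and> slice_chart A N c S \<longrightarrow> Z p c \<in> S)"


section \<open>The cotangent bundle and its canonical 2-form\<close>

type_synonym ('a, 'x) covector = "('a, 'x) tangent \<Rightarrow> real"

(* Covectors vanish outside the tangent space, so that distinct functions are distinct covectors. *)
definition cotangent_space ::
    "('a, 'x::euclidean_space) atlas \<Rightarrow> 'a \<Rightarrow> ('a, 'x) covector set" where
  "cotangent_space A p = {\<alpha>.
     (\<forall>v\<in>tangent_space A p. \<forall>w\<in>tangent_space A p. \<forall>r s.
        \<alpha> (\<lambda>c. r *\<^sub>R v c + s *\<^sub>R w c) = r * \<alpha> v + s * \<alpha> w) \<and>
     (\<forall>v. v \<notin> tangent_space A p \<longrightarrow> \<alpha> v = 0)}"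

(* The second component lists the values of \<alpha> on the coordinate vectors of the chart. *)
definition cotangent_chart ::
    "('a, 'x::euclidean_space) atlas \<Rightarrow> ('a, 'x) chart \<Rightarrow> ('a \<times> ('a, 'x) covector, 'x \<times> 'x) chart" where
  "cotangent_chart A c =
     ({(p, \<alpha>). p \<in> cdom c \<and> \<alpha> \<in> cotangent_space A p},
      \<lambda>(p, \<alpha>). (coord c p, \<Sum>b\<in>Basis. \<alpha> (coord_vector A c p b) *\<^sub>R b))"

definition cotangent_bundle ::
    "('a, 'x::euclidean_space) atlas \<Rightarrow> ('a \<times> ('a, 'x) covector, 'x \<times> 'x) atlas" where
  "cotangent_bundle A = cotangent_chart A ` charts A"

(* In coordinates (x^b, p_b) this is the sum over b of dx^b \<and> dp_b; for x = (t, q) it reads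
   dq^i \<and> dp_i + dt \<and> dp.  It does not depend on the chart. *)
definition canonical_form ::
    "('a, 'x::euclidean_space) atlas \<Rightarrow> 'a \<times> ('a, 'x) covector \<Rightarrow>
     ('a \<times> ('a, 'x) covector, 'x \<times> 'x) tangent \<Rightarrow>
     ('a \<times> ('a, 'x) covector, 'x \<times> 'x) tangent \<Rightarrow> real" where
  "canonical_form A z v w =
     (let c = cotangent_chart A (chart_at A (fst z))
      in fst (v c) \<bullet> snd (w c) - snd (v c) \<bullet> fst (w c))"


section \<open>Coordinate spaces\<close>

type_synonym 'n E_coords = "real \<times> (real, 'n) vec"  (* (t, q) *)
type_synonym 'n jet_coords = "real \<times> (real, 'n) vec \<times> (real, 'n) vec"  (* (t, q, v) *)
type_synonym ('n, 'm) C_coords = "real \<times> (real, 'n) vec \<times> (real, 'm) vec"  (* (t, q, u) *)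
type_synonym ('n, 'm) W_coords =
  "real \<times> (real, 'n) vec \<times> (real, 'm) vec \<times> real \<times> (real, 'n) vec"  (* (t, q, u, p, p_i) *)
type_synonym ('n, 'm) W0_coords =
  "real \<times> (real, 'n) vec \<times> (real, 'm) vec \<times> (real, 'n) vec"  (* (t, q, u, p_i) *)


section \<open>The first jet bundle of a bundle over the real line\<close>

definition local_section ::
    "('e, 'x::euclidean_space) atlas \<Rightarrow> ('e \<Rightarrow> real) \<Rightarrow> real \<Rightarrow> (real \<Rightarrow> 'e) \<Rightarrow> bool" where
  "local_section E \<pi> t \<phi> \<longleftrightarrow>
     (\<exists>I. open I \<and> t \<in> I \<and> smooth_map (restrict_atlas euclidean_atlas I) E \<phi> \<and>
          (\<forall>s\<in>I. \<pi> (\<phi> s) = s))"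

(* source point and equivalence class of local sections *)
type_synonym 'e jet = "real \<times> (real \<Rightarrow> 'e) set"

definition jet1 ::
    "('e, 'x::euclidean_space) atlas \<Rightarrow> ('e \<Rightarrow> real) \<Rightarrow> (real \<Rightarrow> 'e) \<Rightarrow> real \<Rightarrow> 'e jet" where
  "jet1 E \<pi> \<phi> t =
     (t, {\<psi>. local_section E \<pi> t \<psi> \<and> \<psi> t = \<phi> t \<and> velocity E \<psi> t = velocity E \<phi> t})"

definition jets :: "('e, 'x::euclidean_space) atlas \<Rightarrow> ('e \<Rightarrow> real) \<Rightarrow> 'e jet set" where
  "jets E \<pi> = {jet1 E \<pi> \<phi> t | \<phi> t. local_section E \<pi> t \<phi>}"

definition jet_rep :: "'e jet \<Rightarrow> real \<Rightarrow> 'e" where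
  "jet_rep j = (SOME \<phi>. \<phi> \<in> snd j)"

definition jet_target :: "'e jet \<Rightarrow> 'e" where
  "jet_target j = jet_rep j (fst j)"

(* coordinates (t, q) with t the coordinate of the base *)
definition adapted_chart ::
    "('e, 'n::finite E_coords) atlas \<Rightarrow> ('e \<Rightarrow> real) \<Rightarrow> ('e, 'n E_coords) chart \<Rightarrow> bool" where
  "adapted_chart E \<pi> c \<longleftrightarrow> c \<in> charts E \<and> (\<forall>e\<in>cdom c. fst (coord c e) = \<pi> e)"

(* coordinates (t, q, v) induced by (t, q) *)
definition jet_chart ::
    "('e, 'n::finite E_coords) atlas \<Rightarrow> ('e \<Rightarrow> real) \<Rightarrow> ('e, 'n E_coords) chart \<Rightarrow>
     ('e jet, 'n jet_coords) chart" where
  "jet_chart E \<pi> c =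
     ({j \<in> jets E \<pi>. jet_target j \<in> cdom c},
      \<lambda>j. (fst j, snd (coord c (jet_target j)), snd (velocity E (jet_rep j) (fst j) c)))"

definition jet_bundle ::
    "('e, 'n::finite E_coords) atlas \<Rightarrow> ('e \<Rightarrow> real) \<Rightarrow> ('e jet, 'n jet_coords) atlas" where
  "jet_bundle E \<pi> = jet_chart E \<pi> ` {c. adapted_chart E \<pi> c}"


section \<open>Optimal control problems\<close>

definition optimal_control_problem ::
    "('e, 'n::finite E_coords) atlas \<Rightarrow> ('fe, real^'n) atlas \<Rightarrow> ('e \<Rightarrow> real) \<Rightarrow>
     ('c, ('n, 'm::finite) C_coords) atlas \<Rightarrow> ('fc, real^'m) atlas \<Rightarrow> ('c \<Rightarrow> 'e) \<Rightarrow>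
     ('c \<Rightarrow> real) \<Rightarrow> ('c \<Rightarrow> 'e jet) \<Rightarrow> bool" where
  "optimal_control_problem E FE \<pi> C FC \<pi>C L F \<longleftrightarrow>
     fiber_bundle E euclidean_atlas \<pi> FE \<and>
     fiber_bundle C E \<pi>C FC \<and>
     smooth_map C euclidean_atlas L \<and>
     smooth_map C (jet_bundle E \<pi>) F \<and>
     (\<forall>c\<in>carrier C. jet_target (F c) = \<pi>C c)"

(* coordinates (t, q) on E and (t, q, u) on C *)
definition bundle_charts ::
    "('e, 'n::finite E_coords) atlas \<Rightarrow> ('e \<Rightarrow> real) \<Rightarrow>
     ('c, ('n, 'm::finite) C_coords) atlas \<Rightarrow> ('c \<Rightarrow> 'e) \<Rightarrow>
     ('e, 'n E_coords) chart \<Rightarrow> ('c, ('n, 'm) C_coords) chart \<Rightarrow> bool" where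
  "bundle_charts E \<pi> C \<pi>C d k \<longleftrightarrow>
     adapted_chart E \<pi> d \<and> k \<in> charts C \<and>
     (\<forall>c\<in>cdom k. \<pi>C c \<in> cdom d \<and>
        (fst (coord k c), fst (snd (coord k c))) = coord d (\<pi>C c))"

(* points of C times T*E *)
type_synonym ('c, 'e, 'x) unified = "'c \<times> 'e \<times> ('e, 'x) covector"

(* fibered product over E of C (identified with the graph of F) and T*E *)
definition W ::
    "('e, 'n::finite E_coords) atlas \<Rightarrow> ('c, ('n, 'm::finite) C_coords) atlas \<Rightarrow> ('c \<Rightarrow> 'e) \<Rightarrow>
     ('c, 'e, 'n E_coords) unified set" where
  "W E C \<pi>C =
     {(c, e, \<alpha>). c \<in> carrier C \<and> e = \<pi>C c \<and> (e, \<alpha>) \<in> carrier (cotangent_bundle E)}"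

(* natural coordinates (t, q, u, p, p_i) *)
definition natural_coord ::
    "('e, 'n::finite E_coords) atlas \<Rightarrow> ('e, 'n E_coords) chart \<Rightarrow>
     ('c, ('n, 'm::finite) C_coords) chart \<Rightarrow> ('c, 'e, 'n E_coords) unified \<Rightarrow>
     ('n, 'm) W_coords" where
  "natural_coord E d k = (\<lambda>(c, e, \<alpha>). case coord k c of (t, q, u) \<Rightarrow>
     (t, q, u, \<alpha> (coord_vector E d e (1, 0)), \<chi> i. \<alpha> (coord_vector E d e (0, axis i 1))))"

definition H_W ::
    "('e, 'n::finite E_coords) atlas \<Rightarrow> ('e \<Rightarrow> real) \<Rightarrow> ('c \<Rightarrow> 'e) \<Rightarrow> ('c \<Rightarrow> real) \<Rightarrow> ('c \<Rightarrow> 'e jet) \<Rightarrow>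
     ('c, 'e, 'n E_coords) unified \<Rightarrow> real" where
  "H_W E \<pi> \<pi>C L F = (\<lambda>(c, e, \<alpha>).
     let t = \<pi> (\<pi>C c); \<phi> = (SOME \<phi>. local_section E \<pi> t \<phi> \<and> jet1 E \<pi> \<phi> t = F c)
     in \<alpha> (velocity E \<phi> t) - L c)"

definition W0_set ::
    "('e, 'n::finite E_coords) atlas \<Rightarrow> ('e \<Rightarrow> real) \<Rightarrow>
     ('c, ('n, 'm::finite) C_coords) atlas \<Rightarrow> ('c \<Rightarrow> 'e) \<Rightarrow> ('c \<Rightarrow> real) \<Rightarrow> ('c \<Rightarrow> 'e jet) \<Rightarrow>
     ('c, 'e, 'n E_coords) unified set" where
  "W0_set E \<pi> C \<pi>C L F = {w \<in> W E C \<pi>C. H_W E \<pi> \<pi>C L F w = 0}"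

(* W0 as a manifold, with coordinates (t, q, u, p_i) *)
definition W0 ::
    "('e, 'n::finite E_coords) atlas \<Rightarrow> ('e \<Rightarrow> real) \<Rightarrow>
     ('c, ('n, 'm::finite) C_coords) atlas \<Rightarrow> ('c \<Rightarrow> 'e) \<Rightarrow> ('c \<Rightarrow> real) \<Rightarrow> ('c \<Rightarrow> 'e jet) \<Rightarrow>
     (('c, 'e, 'n E_coords) unified, ('n, 'm) W0_coords) atlas" where
  "W0 E \<pi> C \<pi>C L F =
     {({w \<in> W0_set E \<pi> C \<pi>C L F. fst w \<in> cdom k},
       \<lambda>w. case natural_coord E d k w of (t, q, u, p, pp) \<Rightarrow> (t, q, u, pp))
      | d k. bundle_charts E \<pi> C \<pi>C d k}"

(* pullback of the canonical 2-form along W0 \<rightarrow> T*E *)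
definition Omega_W0 ::
    "('e, 'n::finite E_coords) atlas \<Rightarrow> ('e \<Rightarrow> real) \<Rightarrow>
     ('c, ('n, 'm::finite) C_coords) atlas \<Rightarrow> ('c \<Rightarrow> 'e) \<Rightarrow> ('c \<Rightarrow> real) \<Rightarrow> ('c \<Rightarrow> 'e jet) \<Rightarrow>
     ('c, 'e, 'n E_coords) unified \<Rightarrow>
     (('c, 'e, 'n E_coords) unified, ('n, 'm) W0_coords) tangent \<Rightarrow>
     (('c, 'e, 'n E_coords) unified, ('n, 'm) W0_coords) tangent \<Rightarrow> real" where
  "Omega_W0 E \<pi> C \<pi>C L F w X Y =
     (let T = tangent_map (W0 E \<pi> C \<pi>C L F) (cotangent_bundle E) snd w
      in canonical_form E (snd w) (T X) (T Y))"

definition dt_W0 ::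
    "('e, 'n::finite E_coords) atlas \<Rightarrow> ('e \<Rightarrow> real) \<Rightarrow>
     ('c, ('n, 'm::finite) C_coords) atlas \<Rightarrow> ('c \<Rightarrow> 'e) \<Rightarrow> ('c \<Rightarrow> real) \<Rightarrow> ('c \<Rightarrow> 'e jet) \<Rightarrow>
     ('c, 'e, 'n E_coords) unified \<Rightarrow>
     (('c, 'e, 'n E_coords) unified, ('n, 'm) W0_coords) tangent \<Rightarrow> real" where
  "dt_W0 E \<pi> C \<pi>C L F w X = differential (W0 E \<pi> C \<pi>C L F) (\<lambda>w. \<pi> (\<pi>C (fst w))) w X"

(* i(X) Omega = 0 and i(X) dt = 1 at the point w *)
definition solves_at ::
    "('e, 'n::finite E_coords) atlas \<Rightarrow> ('e \<Rightarrow> real) \<Rightarrow>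
     ('c, ('n, 'm::finite) C_coords) atlas \<Rightarrow> ('c \<Rightarrow> 'e) \<Rightarrow> ('c \<Rightarrow> real) \<Rightarrow> ('c \<Rightarrow> 'e jet) \<Rightarrow>
     ('c, 'e, 'n E_coords) unified \<Rightarrow>
     (('c, 'e, 'n E_coords) unified, ('n, 'm) W0_coords) tangent \<Rightarrow> bool" where
  "solves_at E \<pi> C \<pi>C L F w X \<longleftrightarrow>
     (\<forall>Y \<in> tangent_space (W0 E \<pi> C \<pi>C L F) w. Omega_W0 E \<pi> C \<pi>C L F w X Y = 0) \<and>
     dt_W0 E \<pi> C \<pi>C L F w X = 1"


section \<open>Local coordinate expressions\<close>

(* The local Hamiltonian p + p_i F^i - L as a function of the natural coordinates; the F^i are the
   v-components of F. *)
definition Ham ::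
    "('e, 'n::finite E_coords) atlas \<Rightarrow> ('e \<Rightarrow> real) \<Rightarrow> ('c \<Rightarrow> real) \<Rightarrow> ('c \<Rightarrow> 'e jet) \<Rightarrow>
     ('e, 'n E_coords) chart \<Rightarrow> ('c, ('n, 'm::finite) C_coords) chart \<Rightarrow>
     ('n, 'm) W_coords \<Rightarrow> real" where
  "Ham E \<pi> L F d k = (\<lambda>(t, q, u, p, pp).
     p + (\<Sum>j\<in>UNIV. pp $ j * snd (snd (coord (jet_chart E \<pi> d) (F (param k (t, q, u))))) $ j)
       - L (param k (t, q, u)))"

definition t_of :: "('n::finite, 'm::finite) W_coords \<Rightarrow> real" where
  "t_of = (\<lambda>(t, q, u, p, pp). t)"

definition q_of :: "('n::finite, 'm::finite) W_coords \<Rightarrow> real^'n" where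
  "q_of = (\<lambda>(t, q, u, p, pp). q)"

definition pi_of :: "('n::finite, 'm::finite) W_coords \<Rightarrow> real^'n" where
  "pi_of = (\<lambda>(t, q, u, p, pp). pp)"

definition partial_q ::
    "'n::finite \<Rightarrow> (('n, 'm::finite) W_coords \<Rightarrow> real) \<Rightarrow>
     ('n, 'm) W_coords \<Rightarrow> real" where
  "partial_q i = partial (0, axis i 1, 0, 0, 0)"

definition partial_u ::
    "'m::finite \<Rightarrow> (('n::finite, 'm) W_coords \<Rightarrow> real) \<Rightarrow>
     ('n, 'm) W_coords \<Rightarrow> real" where
  "partial_u a = partial (0, 0, axis a 1, 0, 0)"

definition partial_pi ::
    "'n::finite \<Rightarrow> (('n, 'm::finite) W_coords \<Rightarrow> real) \<Rightarrow>
     ('n, 'm) W_coords \<Rightarrow> real" where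
  "partial_pi i = partial (0, 0, 0, 0, axis i 1)"

text \<open>
  Under a change of the fiber coordinates \<open>u\<close> the Hessian of the Hamiltonian in \<open>u\<close> transforms as a
  matrix of a bilinear form exactly at the points where its first derivatives in \<open>u\<close> vanish; away
  from those points its rank depends on the coordinates and can be made zero.  Maximal rank is
  therefore required, in all natural coordinates, at the critical points.  This is implied by
  maximal rank at all points in the charts of some family of natural charts covering \<open>C\<close>.
\<close>

definition regular_problem ::
    "('e, 'n::finite E_coords) atlas \<Rightarrow> ('e \<Rightarrow> real) \<Rightarrow>
     ('c, ('n, 'm::finite) C_coords) atlas \<Rightarrow> ('c \<Rightarrow> 'e) \<Rightarrow> ('c \<Rightarrow> real) \<Rightarrow> ('c \<Rightarrow> 'e jet) \<Rightarrow> bool" where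
  "regular_problem E \<pi> C \<pi>C L F \<longleftrightarrow>
     (\<forall>d k. bundle_charts E \<pi> C \<pi>C d k \<longrightarrow>
       (\<forall>w \<in> W E C \<pi>C. fst w \<in> cdom k \<longrightarrow>
         (\<forall>a. partial_u a (Ham E \<pi> L F d k) (natural_coord E d k w) = 0) \<longrightarrow>
         rank ((\<chi> a b. partial_u a (partial_u b (Ham E \<pi> L F d k)) (natural_coord E d k w))
               :: (real^'m^'m)) = CARD('m)))"

end

theory Submission
  imports Defs
begin

text \<open>
  In natural coordinates $(t, q, u, p_i)$ of the restricted unified space, where
  $p = P := L - p_i F^i$, the equations $i(X)\Omega = 0$, $i(X)dt = 1$ fix the components
  $\dot t = 1$, $\dot q^i = F^i$, $\dot p_i = \partial P / \partial q^i$ of $X$, leave $\dot u$ free, and are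
  solvable exactly on the critical set $\partial\mathcal{H}/\partial u^a = 0$. Regularity makes
  $(t, q, \partial\mathcal{H}/\partial u, p_i)$ a chart near a critical point, so that the critical set is a
  submanifold, and it makes the tangency condition a linear system with invertible matrix for $\dot u$.
  A determinant formula for its solution is smooth on a whole natural chart, and bump functions on $C$
  glue the local fields. The coordinate expression of the canonical form in an adapted chart is justified by its
  invariance under all changes of charts.
\<close>

section \<open>Calculus of smooth maps\<close>

text \<open>Two obstacles shape the argument. The field must be smooth on the whole restricted
  space, while the equations speak of it only on the critical set and the Hessian is known to be
  invertible only there. Hence the denominator det^2 + |dH/du|^2 in the formula for the
  u-components: by regularity its two summands never vanish together. Gluing takes place over
  \<open>C\<close>. A natural chart covers everything above the domain of a chart of
  \<open>C\<close>, so cut-off functions of the control alone suffice, and Hausdorffness and second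
  countability are used on \<open>C\<close>, where they are hypotheses. On the critical set the
  local fields agree, because the equations together with tangency determine the value of the field
  without reference to a chart; a combination with weights of sum 1 is therefore the same solution.
  Differentials, tangent maps and the canonical form are defined by means of
  \<open>chart_at\<close>, an arbitrary member of the maximal atlas that need not be adapted. Every
  coordinate formula thus rests on independence of the chart, which for the canonical form comes
  down to the symmetry of second derivatives.\<close>

abbreviation fderiv where "fderiv f x \<equiv> frechet_derivative f (at x)"

lemma frechet_derivativeI:
  "(f has_derivative f') (at x) \<Longrightarrow> fderiv f x = f'"
  by (metis frechet_derivative_at)

lemma Ck_on_cong:
  assumes "open S" "\<And>x. x \<in> S \<Longrightarrow> f x = g x" "Ck_on k S f"
  shows "Ck_on k S g"
  using assms(2,3)
proof (induction k arbitrary: f g)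
  case 0
  then show ?case by (metis Ck_on.simps(1) continuous_on_cong)
next
  case (Suc k)
  have eq: "fderiv f x = fderiv g x" if "x \<in> S" for x
    by (rule frechet_derivative_transform_within_open[where X = S])
      (use that Suc.prems \<open>open S\<close> in auto)
  have "g differentiable (at x)" if "x \<in> S" for x
    using Suc.prems that \<open>open S\<close> unfolding differentiable_def Ck_on.simps
    by (metis has_derivative_transform_within_open)
  moreover have "Ck_on k S (\<lambda>x. fderiv g x v)" for v
    by (rule Suc.IH[where f = "\<lambda>x. fderiv f x v"]) (use eq Suc.prems in auto)
  ultimately show ?case by simp
qed

lemma Ck_on_subset: "Ck_on k S f \<Longrightarrow> T \<subseteq> S \<Longrightarrow> Ck_on k T f"
  by (induction k arbitrary: f) (auto intro: continuous_on_subset)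

lemma Ck_on_SucD: "Ck_on (Suc k) S f \<Longrightarrow> Ck_on k S f"
proof (induction k arbitrary: f)
  case 0
  then show ?case
    by (auto intro!: continuous_at_imp_continuous_on differentiable_imp_continuous_within)
qed simp

lemma Ck_on_local:
  assumes "\<And>x. x \<in> S \<Longrightarrow> \<exists>T. open T \<and> x \<in> T \<and> Ck_on k T f"
  shows "Ck_on k S f"
  using assms
proof (induction k arbitrary: f)
  case 0
  then show ?case
    by (auto intro!: continuous_at_imp_continuous_on simp: continuous_on_eq_continuous_at)
      (metis continuous_on_eq_continuous_at)
next
  case (Suc k)
  then show ?case by simp (metis Suc.IH)
qed

lemma Ck_on_const: "Ck_on k S (\<lambda>x. c)"
  by (induction k arbitrary: c) auto

lemma Ck_on_bounded_linear:
  assumes h: "bounded_linear h" and "open S" "Ck_on k S f"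
  shows "Ck_on k S (\<lambda>x. h (f x))"
  using assms(3)
proof (induction k arbitrary: f)
  case 0
  then show ?case using h by (simp add: bounded_linear.continuous_on)
next
  case (Suc k)
  have der: "((\<lambda>x. h (f x)) has_derivative (\<lambda>v. h (fderiv f x v))) (at x)"
    if "x \<in> S" for x
    using Suc.prems that by (auto intro!: bounded_linear.has_derivative[OF h]
        simp: frechet_derivative_works[symmetric])
  moreover have "Ck_on k S (\<lambda>x. fderiv (\<lambda>x. h (f x)) x v)" for v
    by (rule Ck_on_cong[OF \<open>open S\<close> _ Suc.IH[of "\<lambda>x. fderiv f x v"]])
      (use Suc.prems in \<open>auto simp: frechet_derivativeI[OF der]\<close>)
  ultimately show ?case by (auto simp: differentiable_def)
qed

lemma Ck_on_ident: "open S \<Longrightarrow> Ck_on k S (\<lambda>x. x)"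
  by (cases k) (auto simp: Ck_on_const)

lemma Ck_on_add:
  assumes "open S" "Ck_on k S f" "Ck_on k S g"
  shows "Ck_on k S (\<lambda>x. f x + g x)"
  using assms(2,3)
proof (induction k arbitrary: f g)
  case 0
  then show ?case by (simp add: continuous_on_add)
next
  case (Suc k)
  have der: "((\<lambda>x. f x + g x) has_derivative
      (\<lambda>v. fderiv f x v + fderiv g x v)) (at x)"
    if "x \<in> S" for x
    using Suc.prems that by (auto intro!: has_derivative_add
        simp: frechet_derivative_works[symmetric])
  moreover have "Ck_on k S (\<lambda>x. fderiv (\<lambda>x. f x + g x) x v)" for v
    by (rule Ck_on_cong[OF \<open>open S\<close> _ Suc.IH[of "\<lambda>x. fderiv f x v"
            "\<lambda>x. fderiv g x v"]])
      (use Suc.prems in \<open>auto simp: frechet_derivativeI[OF der]\<close>)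
  ultimately show ?case by (auto simp: differentiable_def)
qed

text \<open>The Leibniz rule gives two bilinear terms, each with one factor differentiated and the
  other weakened from order k + 1 to order k. One induction serves products, scalar multiples and
  inner products alike.\<close>

lemma Ck_on_bilinear:
  assumes p: "bounded_bilinear p" and "open S" "Ck_on k S f" "Ck_on k S g"
  shows "Ck_on k S (\<lambda>x. p (f x) (g x))"
  using assms(3,4)
proof (induction k arbitrary: f g)
  case 0
  then show ?case using p by (simp add: bounded_bilinear.continuous_on)
next
  case (Suc k)
  have der: "((\<lambda>x. p (f x) (g x)) has_derivative
      (\<lambda>v. p (f x) (fderiv g x v) + p (fderiv f x v) (g x))) (at x)"
    if "x \<in> S" for x
    using Suc.prems that by (auto intro!: bounded_bilinear.FDERIV[OF p]
        simp: frechet_derivative_works[symmetric])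
  moreover have "Ck_on k S (\<lambda>x. fderiv (\<lambda>x. p (f x) (g x)) x v)" for v
    by (rule Ck_on_cong[OF \<open>open S\<close> _ Ck_on_add[OF \<open>open S\<close>
            Suc.IH[of f "\<lambda>x. fderiv g x v"]
            Suc.IH[of "\<lambda>x. fderiv f x v" g]]])
      (use Suc.prems Ck_on_SucD in \<open>auto simp: frechet_derivativeI[OF der]\<close>)
  ultimately show ?case by (auto simp: differentiable_def)
qed

lemma Ck_on_sum:
  assumes "open S" "\<And>i. i \<in> I \<Longrightarrow> Ck_on k S (f i)"
  shows "Ck_on k S (\<lambda>x. \<Sum>i\<in>I. f i x)"
  using assms(2)
  by (induction I rule: infinite_finite_induct) (auto intro!: Ck_on_const Ck_on_add[OF assms(1)])

text \<open>\<open>Ck_on\<close> controls derivatives in fixed directions only. This expansion turns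
  a direction that varies with the point into finitely many fixed ones with varying
  coefficients.\<close>

lemma frechet_derivative_sum_Basis:
  assumes "f differentiable (at x)"
  shows "fderiv f x v = (\<Sum>b\<in>Basis. (v \<bullet> b) *\<^sub>R fderiv f x b)"
proof -
  interpret linear "fderiv f x"
    by (rule linear_frechet_derivative[OF assms])
  have "fderiv f x v = fderiv f x (\<Sum>b\<in>Basis. (v \<bullet> b) *\<^sub>R b)"
    by (simp add: euclidean_representation)
  then show ?thesis by (simp add: sum scaleR)
qed

lemma Ck_on_compose:
  assumes "open S" "open T" "f ` S \<subseteq> T" "Ck_on k S f" "Ck_on k T g"
  shows "Ck_on k S (\<lambda>x. g (f x))"
  using assms(4,5)
proof (induction k arbitrary: g)
  case 0
  then show ?case using assms(3) by (auto intro: continuous_on_compose2)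
next
  case (Suc k)
  have der: "((\<lambda>x. g (f x)) has_derivative
      (\<lambda>v. fderiv g (f x) (fderiv f x v))) (at x)"
    if "x \<in> S" for x
    using diff_chain_at[of f "fderiv f x" x g "fderiv g (f x)"]
      Suc.prems that assms(3) by (auto simp: frechet_derivative_works[symmetric] comp_def image_subset_iff)
  \<comment> \<open>The chain rule differentiates \<open>g\<close> in the direction
    \<open>fderiv f x v\<close>, which moves with \<open>x\<close>; the expansion over the basis
    makes the induction hypothesis applicable to each \<open>fderiv g\<close> in a fixed
    direction.\<close>
  have eq: "(\<Sum>b\<in>Basis. (fderiv f x v \<bullet> b) *\<^sub>R fderiv g (f x) b)
      = fderiv (\<lambda>x. g (f x)) x v" if "x \<in> S" for x v
  proof -
    have "g differentiable (at (f x))" using Suc.prems that assms(3) by auto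
    then show ?thesis
      by (simp only: frechet_derivativeI[OF der[OF that]] frechet_derivative_sum_Basis[symmetric])
  qed
  have "Ck_on k S (\<lambda>x. \<Sum>b\<in>Basis. (fderiv f x v \<bullet> b) *\<^sub>R
      fderiv g (f x) b)" for v
    using Suc.prems Ck_on_SucD[OF Suc.prems(1)]
    by (intro Ck_on_sum Ck_on_bilinear[OF bounded_bilinear_scaleR]
        Ck_on_bounded_linear[OF bounded_linear_inner_left] Suc.IH assms(1)) auto
  then have "Ck_on k S (\<lambda>x. fderiv (\<lambda>x. g (f x)) x v)" for v
    by (rule Ck_on_cong[OF assms(1), rotated]) (simp add: eq)
  with der show ?case by (auto simp: differentiable_def)
qed

text \<open>The derivative of 1/f is a product containing 1/f itself, whose lower order of
  differentiability is the induction hypothesis.\<close>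

lemma Ck_on_inverse:
  fixes f :: "'x::euclidean_space \<Rightarrow> real"
  assumes "open S" "\<And>x. x \<in> S \<Longrightarrow> f x \<noteq> 0" "Ck_on k S f"
  shows "Ck_on k S (\<lambda>x. inverse (f x))"
  using assms(3)
proof (induction k)
  case 0
  then show ?case using assms(2) by (auto intro!: continuous_on_inverse)
next
  case (Suc k)
  have der: "((\<lambda>x. inverse (f x)) has_derivative
      (\<lambda>v. - (inverse (f x) * fderiv f x v * inverse (f x)))) (at x)"
    if "x \<in> S" for x
    using Suc.prems that assms(2) by (auto intro!: has_derivative_inverse
        simp: frechet_derivative_works[symmetric])
  have "Ck_on k S (\<lambda>x. - (inverse (f x) * fderiv f x v * inverse (f x)))" for v
    using Suc.prems Suc.IH[OF Ck_on_SucD[OF Suc.prems]]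
    by (intro Ck_on_bounded_linear[OF bounded_linear_minus[OF bounded_linear_ident]]
        Ck_on_bilinear[OF bounded_bilinear_mult] assms(1)) auto
  then have "Ck_on k S (\<lambda>x. fderiv (\<lambda>x. inverse (f x)) x v)" for v
    using Ck_on_cong[OF assms(1), of "\<lambda>x. - (inverse (f x) * fderiv f x v * inverse (f x))"
        "\<lambda>x. fderiv (\<lambda>x. inverse (f x)) x v" k]
    by (simp add: frechet_derivativeI[OF der])
  with der show ?case by (auto simp: differentiable_def)
qed

subsection \<open>Germs of smooth maps\<close>

lemma open_iff_eventually: "open S \<longleftrightarrow> (\<forall>x\<in>S. \<forall>\<^sub>F y in nhds x. y \<in> S)"
  by (subst open_subopen) (simp add: eventually_nhds subset_eq)

text \<open>Smoothness of germs: explicit domains of composites disappear, and every restriction to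
  a smaller neighbourhood becomes an eventual statement in \<open>nhds\<close>.\<close>

definition smooth_at :: "('x::euclidean_space \<Rightarrow> 'y::euclidean_space) \<Rightarrow> 'x \<Rightarrow> bool" where
  "smooth_at f x \<longleftrightarrow> (\<exists>N. open N \<and> x \<in> N \<and> smooth_on N f)"

lemma smooth_on_iff_smooth_at: "open S \<Longrightarrow> smooth_on S f \<longleftrightarrow> (\<forall>x\<in>S. smooth_at f x)"
proof (rule iffI)
  assume "open S" "\<forall>x\<in>S. smooth_at f x"
  then have "Ck_on k S f" for k
    by (intro Ck_on_local) (meson smooth_at_def smooth_on_def)
  then show "smooth_on S f" by (simp add: smooth_on_def)
qed (auto simp: smooth_at_def)

lemma smooth_onD: "smooth_on S f \<Longrightarrow> open S \<Longrightarrow> x \<in> S \<Longrightarrow> smooth_at f x"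
  by (auto simp: smooth_at_def)

lemma smooth_at_cong:
  assumes "smooth_at f x" "\<forall>\<^sub>F y in nhds x. f y = g y"
  shows "smooth_at g x"
proof -
  obtain N where "open N" "x \<in> N" "smooth_on N f" using assms(1) by (auto simp: smooth_at_def)
  moreover obtain M where "open M" "x \<in> M" "\<And>y. y \<in> M \<Longrightarrow> f y = g y"
    using assms(2) by (auto simp: eventually_nhds)
  ultimately have "smooth_on (N \<inter> M) g" "open (N \<inter> M)" "x \<in> N \<inter> M"
    unfolding smooth_on_def
    by (auto intro!: Ck_on_cong[where f = f and g = g and S = "N \<inter> M"] intro: Ck_on_subset)
  then show ?thesis unfolding smooth_at_def by blast
qed

lemma smooth_at_eventually: "smooth_at f x \<Longrightarrow> \<forall>\<^sub>F y in nhds x. smooth_at f y"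
  unfolding eventually_nhds using smooth_onD unfolding smooth_at_def by metis

lemma smooth_at_differentiable: "smooth_at f x \<Longrightarrow> f differentiable (at x)"
  unfolding smooth_at_def smooth_on_def by (metis Ck_on.simps(2))

lemma smooth_at_has_derivative:
  "smooth_at f x \<Longrightarrow> (f has_derivative fderiv f x) (at x)"
  using smooth_at_differentiable frechet_derivative_works by blast

lemma smooth_at_linear: "smooth_at f x \<Longrightarrow> linear (fderiv f x)"
  by (intro linear_frechet_derivative smooth_at_differentiable)

lemma smooth_at_isCont: "smooth_at f x \<Longrightarrow> isCont f x"
  using smooth_at_differentiable differentiable_imp_continuous_within by blast

lemma smooth_at_eventually_image:
  assumes "smooth_at f x" "eventually P (nhds (f x))"
  shows "\<forall>\<^sub>F y in nhds x. P (f y)"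
proof -
  have "(f \<longlongrightarrow> f x) (nhds x)"
    using smooth_at_isCont[OF assms(1)] unfolding isCont_def tendsto_at_iff_tendsto_nhds .
  then show ?thesis using assms(2) unfolding filterlim_iff by blast
qed

lemma smooth_at_const: "smooth_at (\<lambda>x. c) x"
  unfolding smooth_at_def smooth_on_def using Ck_on_const open_UNIV by blast

lemma smooth_at_ident: "smooth_at (\<lambda>x. x) x"
  unfolding smooth_at_def smooth_on_def using Ck_on_ident open_UNIV by blast

text \<open>Transfers a closure rule from open sets to germs by intersecting the two
  neighbourhoods.\<close>

lemma smooth_at_Ck_on2:
  assumes "\<And>k S. open S \<Longrightarrow> Ck_on k S f \<Longrightarrow> Ck_on k S g \<Longrightarrow> Ck_on k S h"
    "smooth_at f x" "smooth_at g x"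
  shows "smooth_at h x"
proof -
  obtain N M where "open N" "x \<in> N" "smooth_on N f" "open M" "x \<in> M" "smooth_on M g"
    using assms(2,3) by (auto simp: smooth_at_def)
  then have "smooth_on (N \<inter> M) h" "open (N \<inter> M)" "x \<in> N \<inter> M"
    unfolding smooth_on_def by (auto intro!: assms(1) intro: Ck_on_subset)
  then show ?thesis unfolding smooth_at_def by blast
qed

lemma smooth_at_bounded_linear:
  "bounded_linear h \<Longrightarrow> smooth_at f x \<Longrightarrow> smooth_at (\<lambda>x. h (f x)) x"
  by (rule smooth_at_Ck_on2[where f = f and g = f]) (auto intro: Ck_on_bounded_linear)

lemma smooth_at_bilinear:
  "bounded_bilinear p \<Longrightarrow> smooth_at f x \<Longrightarrow> smooth_at g x \<Longrightarrow> smooth_at (\<lambda>x. p (f x) (g x)) x"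
  by (rule smooth_at_Ck_on2[where f = f and g = g]) (auto intro: Ck_on_bilinear)

lemma smooth_at_add:
  "smooth_at f x \<Longrightarrow> smooth_at g x \<Longrightarrow> smooth_at (\<lambda>x. f x + g x) x"
  by (rule smooth_at_Ck_on2[where f = f and g = g]) (auto intro: Ck_on_add)

lemmas smooth_at_scaleR = smooth_at_bilinear[OF bounded_bilinear_scaleR]
lemmas smooth_at_mult = smooth_at_bilinear[OF bounded_bilinear_mult[where 'a = real]]
lemmas smooth_at_inner = smooth_at_bilinear[OF bounded_bilinear_inner]
lemmas smooth_at_fst = smooth_at_bounded_linear[OF bounded_linear_fst]
lemmas smooth_at_snd = smooth_at_bounded_linear[OF bounded_linear_snd]
lemmas smooth_at_vec_nth = smooth_at_bounded_linear[OF bounded_linear_vec_nth]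
lemmas smooth_at_minus = smooth_at_bounded_linear[OF bounded_linear_minus[OF bounded_linear_ident]]

lemma smooth_at_diff:
  "smooth_at f x \<Longrightarrow> smooth_at g x \<Longrightarrow> smooth_at (\<lambda>x. f x - g x) x"
  using smooth_at_add[OF _ smooth_at_minus, of f x g] by simp

lemma smooth_at_sum:
  "(\<And>i. i \<in> I \<Longrightarrow> smooth_at (f i) x) \<Longrightarrow> smooth_at (\<lambda>x. \<Sum>i\<in>I. f i x) x"
  by (induction I rule: infinite_finite_induct) (auto intro!: smooth_at_const smooth_at_add)

lemma smooth_at_prod:
  fixes f :: "'i \<Rightarrow> 'x::euclidean_space \<Rightarrow> real"
  shows "(\<And>i. i \<in> I \<Longrightarrow> smooth_at (f i) x) \<Longrightarrow> smooth_at (\<lambda>x. \<Prod>i\<in>I. f i x) x"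
  by (induction I rule: infinite_finite_induct) (auto intro!: smooth_at_const smooth_at_mult)

lemma smooth_at_Pair:
  assumes "smooth_at f x" "smooth_at g x"
  shows "smooth_at (\<lambda>x. (f x, g x)) x"
proof -
  have "bounded_linear (\<lambda>y. (y, 0))" "bounded_linear (\<lambda>y. (0, y))"
    by (auto intro!: bounded_linear_Pair bounded_linear_ident bounded_linear_zero)
  then show ?thesis
    using smooth_at_add[OF smooth_at_bounded_linear smooth_at_bounded_linear, OF _ assms(1) _ assms(2),
        of "\<lambda>y. (y, 0)" "\<lambda>y. (0, y)"] by simp
qed

lemma smooth_at_vec:
  fixes f :: "'x::euclidean_space \<Rightarrow> real ^ 'i"
  assumes "\<And>i. smooth_at (\<lambda>x. f x $ i) x"
  shows "smooth_at f x"
proof -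
  have "f = (\<lambda>x. \<Sum>i\<in>UNIV. f x $ i *\<^sub>R axis i 1)"
    by (auto simp: vec_eq_iff axis_def if_distrib cong: if_cong)
  then show ?thesis
    by (rule ssubst) (intro smooth_at_sum smooth_at_scaleR smooth_at_const assms)
qed

lemma smooth_at_compose:
  assumes "smooth_at g (f x)" "smooth_at f x"
  shows "smooth_at (\<lambda>x. g (f x)) x"
proof -
  obtain N M where *: "open N" "x \<in> N" "smooth_on N f" "open M" "f x \<in> M" "smooth_on M g"
    using assms by (auto simp: smooth_at_def)
  then have "continuous_on N f" by (metis Ck_on.simps(1) smooth_on_def)
  then have "open (N \<inter> f -` M)" using * by (simp add: continuous_on_open_vimage Int_commute)
  moreover have "Ck_on k (N \<inter> f -` M) (\<lambda>x. g (f x))" for k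
  proof (rule Ck_on_compose[where T = M])
    show "Ck_on k (N \<inter> f -` M) f" "Ck_on k M g"
      using * by (auto simp: smooth_on_def intro: Ck_on_subset[where S = N])
  qed (use * calculation in auto)
  ultimately have "smooth_on (N \<inter> f -` M) (\<lambda>x. g (f x))" "open (N \<inter> f -` M)" "x \<in> N \<inter> f -` M"
    using * by (auto simp: smooth_on_def)
  then show ?thesis unfolding smooth_at_def by blast
qed

lemma smooth_at_inverse:
  fixes f :: "'x::euclidean_space \<Rightarrow> real"
  assumes "smooth_at f x" "f x \<noteq> 0"
  shows "smooth_at (\<lambda>x. inverse (f x)) x"
proof -
  have "smooth_on (- {0 :: real}) inverse"
    unfolding smooth_on_def by (auto intro!: Ck_on_inverse Ck_on_ident)
  then have "smooth_at inverse (f x)"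
    using assms(2) by (intro smooth_onD[where S = "- {0}"]) auto
  then show ?thesis by (rule smooth_at_compose[OF _ assms(1)])
qed

lemma smooth_at_divide:
  fixes f :: "'x::euclidean_space \<Rightarrow> real"
  shows "smooth_at f x \<Longrightarrow> smooth_at g x \<Longrightarrow> g x \<noteq> 0 \<Longrightarrow> smooth_at (\<lambda>x. f x / g x) x"
  unfolding divide_inverse by (intro smooth_at_mult smooth_at_inverse)

lemma smooth_at_frechet_dir:
  "smooth_at f x \<Longrightarrow> smooth_at (\<lambda>x. fderiv f x v) x"
  unfolding smooth_at_def smooth_on_def by (metis Ck_on.simps(2))

text \<open>Base point and direction may both move. Transition derivatives of vector fields and
  covectors, and the derivative of dH/du along a field, all have this shape.\<close>

lemma smooth_at_frechet:
  assumes "smooth_at h (a x)" "smooth_at a x" "smooth_at b x"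
  shows "smooth_at (\<lambda>x. fderiv h (a x) (b x)) x"
proof -
  have "\<forall>\<^sub>F y in nhds x. smooth_at h (a y)"
    by (rule smooth_at_eventually_image[OF assms(2) smooth_at_eventually[OF assms(1)]])
  then have "\<forall>\<^sub>F y in nhds x. (\<Sum>i\<in>Basis. (b y \<bullet> i) *\<^sub>R fderiv h (a y) i)
      = fderiv h (a y) (b y)"
    by eventually_elim (simp add: frechet_derivative_sum_Basis[OF smooth_at_differentiable, symmetric])
  moreover have "smooth_at (\<lambda>y. \<Sum>i\<in>Basis. (b y \<bullet> i) *\<^sub>R fderiv h (a y) i) x"
    by (intro smooth_at_sum smooth_at_scaleR smooth_at_inner assms(3) smooth_at_const
        smooth_at_compose[of "\<lambda>z. fderiv h z i" a for i, OF _ assms(2)]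
        smooth_at_frechet_dir[OF assms(1)])
  ultimately show ?thesis by (rule smooth_at_cong[rotated])
qed

section \<open>Determinants and Cramer's rule\<close>

lemma smooth_at_det:
  fixes M :: "'x::euclidean_space \<Rightarrow> real ^ 'm ^ 'm"
  assumes "\<And>i j. smooth_at (\<lambda>x. M x $ i $ j) x"
  shows "smooth_at (\<lambda>x. det (M x)) x"
  unfolding det_def by (intro smooth_at_sum smooth_at_mult smooth_at_prod smooth_at_const assms)

lemmas smooth_at_intros = smooth_at_const smooth_at_ident smooth_at_add smooth_at_diff smooth_at_minus
  smooth_at_scaleR smooth_at_mult smooth_at_inner smooth_at_fst smooth_at_snd smooth_at_vec_nth
  smooth_at_sum smooth_at_Pair

text \<open>The numerators of Cramer's rule. Without the division by the determinant they are
  polynomial in the entries and stay smooth where the matrix is singular.\<close>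

definition cramer_solve :: "real ^ 'm ^ 'm \<Rightarrow> real ^ 'm \<Rightarrow> real ^ 'm" where
  "cramer_solve N r = (\<chi> k. det (\<chi> i j. if j = k then r $ i else N $ i $ j))"

lemma cramer_solve:
  "det N \<noteq> 0 \<Longrightarrow> N *v x = r \<longleftrightarrow> x = (1 / det N) *\<^sub>R cramer_solve N r"
  unfolding cramer_solve_def by (subst cramer) (auto simp: vec_eq_iff)

lemma smooth_at_cramer_solve:
  assumes "\<And>i j. smooth_at (\<lambda>x. N x $ i $ j) x" "smooth_at r x"
  shows "smooth_at (\<lambda>x. cramer_solve (N x) (r x)) x"
proof (rule smooth_at_vec)
  show "smooth_at (\<lambda>x. cramer_solve (N x) (r x) $ k) x" for k
    unfolding cramer_solve_def vec_lambda_beta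
  proof (rule smooth_at_det)
    show "smooth_at (\<lambda>x. (\<chi> i j. if j = k then r x $ i else N x $ i $ j) $ i $ j) x" for i j
      using assms by (cases "j = k") (auto intro: smooth_at_vec_nth)
  qed
qed

text \<open>Meant for local inverses, whose derivative is a smooth function of the inverse itself.\<close>

lemma smooth_on_bootstrap:
  assumes "open V" "open U" "h ` V \<subseteq> U" "\<And>y. y \<in> V \<Longrightarrow> h differentiable (at y)"
    "\<And>y v. y \<in> V \<Longrightarrow> fderiv h y v = G v (h y)" "\<And>v. smooth_on U (G v)"
  shows "smooth_on V h"
  unfolding smooth_on_def
proof
  show "Ck_on k V h" for k
  proof (induction k)
    case 0
    show ?case using assms(4)
      by (auto intro!: continuous_at_imp_continuous_on differentiable_imp_continuous_within)
  next
    case (Suc k)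
    have "Ck_on k V (\<lambda>y. G v (h y))" for v
      using Ck_on_compose[OF assms(1-3) Suc] assms(6) by (auto simp: smooth_on_def)
    then show ?case using assms(4,5) by (auto intro: Ck_on_cong[OF assms(1)])
  qed
qed

subsection \<open>Symmetry of second derivatives\<close>

text \<open>The mean value theorem, applied once along \<open>v\<close> and once along
  \<open>w\<close>, identifies the second difference over a small parallelogram with s^2 times a
  mixed derivative at a nearby point; continuity of that derivative gives the estimate.\<close>

lemma second_difference:
  fixes f :: "'x::euclidean_space \<Rightarrow> real"
  assumes "smooth_at f x" "\<epsilon> > 0"
  shows "\<exists>\<delta>>0. \<forall>s. 0 < s \<and> s < \<delta> \<longrightarrow>
    \<bar>(f (x + s *\<^sub>R v + s *\<^sub>R w) - f (x + s *\<^sub>R v) - f (x + s *\<^sub>R w) + f x)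
      - s\<^sup>2 * fderiv (\<lambda>y. fderiv f y v) x w\<bar> \<le> \<epsilon> * s\<^sup>2"
proof -
  let ?f1 = "\<lambda>y. fderiv f y v"
  let ?f2 = "\<lambda>y. fderiv ?f1 y w"
  have s1: "smooth_at ?f1 y" if "smooth_at f y" for y
    by (rule smooth_at_frechet_dir[OF that])
  have s2: "smooth_at ?f2 x"
    by (intro smooth_at_frechet_dir assms)
  have "\<forall>\<^sub>F y in nhds x. dist (?f2 y) (?f2 x) < \<epsilon>"
    by (rule smooth_at_eventually_image[OF s2]) (use assms(2) in \<open>auto simp: eventually_nhds_metric\<close>)
  with smooth_at_eventually[OF assms(1)]
  have "\<forall>\<^sub>F y in nhds x. smooth_at f y \<and> dist (?f2 y) (?f2 x) < \<epsilon>" by eventually_elim auto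
  then obtain \<rho> where "\<rho> > 0" and \<rho>: "\<And>y. dist y x < \<rho> \<Longrightarrow> smooth_at f y \<and> dist (?f2 y) (?f2 x) < \<epsilon>"
    by (auto simp: eventually_nhds_metric)
  \<comment> \<open>For s < \<delta> the whole parallelogram with sides s v and s w lies within
    distance \<rho> of \<open>x\<close>; the summand 1 keeps the denominator positive when both
    vectors are zero.\<close>
  define \<delta> where "\<delta> = \<rho> / (norm v + norm w + 1)"
  have pos: "norm v + norm w + 1 > 0" by (smt (verit) norm_ge_zero)
  have near: "dist (x + a *\<^sub>R v + b *\<^sub>R w) x < \<rho>" if "0 \<le> a" "a \<le> s" "0 \<le> b" "b \<le> s" "0 < s" "s < \<delta>" for a b s
  proof -
    have "norm (a *\<^sub>R v + b *\<^sub>R w) \<le> a * norm v + b * norm w"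
      using norm_triangle_ineq[of "a *\<^sub>R v" "b *\<^sub>R w"] that by simp
    also have "\<dots> \<le> s * norm v + s * norm w"
      using that by (intro add_mono mult_right_mono) auto
    also have "\<dots> < s * (norm v + norm w + 1)" using that by (simp add: algebra_simps)
    also have "\<dots> < \<delta> * (norm v + norm w + 1)" using that pos by (intro mult_strict_right_mono)
    finally have "norm (a *\<^sub>R v + b *\<^sub>R w) < \<rho>" using pos by (simp add: \<delta>_def)
    then show ?thesis by (simp add: dist_norm add.assoc)
  qed
  have "\<delta> > 0" using \<open>\<rho> > 0\<close> pos by (simp add: \<delta>_def)
  moreover have "\<bar>(f (x + s *\<^sub>R v + s *\<^sub>R w) - f (x + s *\<^sub>R v) - f (x + s *\<^sub>R w) + f x) - s\<^sup>2 * ?f2 x\<bar> \<le> \<epsilon> * s\<^sup>2"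
    if s: "0 < s" "s < \<delta>" for s
  proof -
    let ?\<phi> = "\<lambda>r. f (x + r *\<^sub>R v + s *\<^sub>R w) - f (x + r *\<^sub>R v)"
    have sm: "smooth_at f (x + a *\<^sub>R v + b *\<^sub>R w)" if "0 \<le> a" "a \<le> s" "0 \<le> b" "b \<le> s" for a b
      using near[of a s b] \<rho> s that by blast
    have d1: "((\<lambda>r. f (x + r *\<^sub>R v + b *\<^sub>R w)) has_real_derivative ?f1 (x + r *\<^sub>R v + b *\<^sub>R w)) (at r)"
      if "0 \<le> r" "r \<le> s" "0 \<le> b" "b \<le> s" for r b
    proof -
      have "((\<lambda>r. x + r *\<^sub>R v + b *\<^sub>R w) has_derivative (\<lambda>h. h *\<^sub>R v)) (at r)"
        by (auto intro!: derivative_eq_intros)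
      from diff_chain_at[OF this smooth_at_has_derivative[OF sm[OF that]]]
      moreover have "fderiv f (x + r *\<^sub>R v + b *\<^sub>R w) (h *\<^sub>R v) = ?f1 (x + r *\<^sub>R v + b *\<^sub>R w) * h" for h
        using linear_cmul[OF linear_frechet_derivative[OF smooth_at_differentiable[OF sm[OF that]]]] by simp
      ultimately show ?thesis by (simp add: has_field_derivative_def comp_def)
    qed
    \<comment> \<open>\<open>?\<phi> s - ?\<phi> 0\<close> is the second difference. The term
      \<open>0 *\<^sub>R w\<close> is kept so that the result is already an increment along
      \<open>w\<close>, ready for the second mean value theorem.\<close>
    have "\<exists>z. 0 < z \<and> z < s \<and> ?\<phi> s - ?\<phi> 0 = (s - 0) * (?f1 (x + z *\<^sub>R v + s *\<^sub>R w) - ?f1 (x + z *\<^sub>R v + 0 *\<^sub>R w))"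
    proof (rule MVT2)
      fix r assume "0 \<le> r" "r \<le> s"
      then show "(?\<phi> has_real_derivative ?f1 (x + r *\<^sub>R v + s *\<^sub>R w) - ?f1 (x + r *\<^sub>R v + 0 *\<^sub>R w)) (at r)"
        using s d1[of r 0] by (intro DERIV_diff d1) auto
    qed (use s in auto)
    then obtain z where z: "0 < z" "z < s"
      "?\<phi> s - ?\<phi> 0 = s * (?f1 (x + z *\<^sub>R v + s *\<^sub>R w) - ?f1 (x + z *\<^sub>R v + 0 *\<^sub>R w))" by auto
    have d2: "((\<lambda>b. ?f1 (x + z *\<^sub>R v + b *\<^sub>R w)) has_real_derivative ?f2 (x + z *\<^sub>R v + b *\<^sub>R w)) (at b)"
      if "0 \<le> b" "b \<le> s" for b
    proof -
      have sm': "smooth_at ?f1 (x + z *\<^sub>R v + b *\<^sub>R w)" using s1 sm z that by simp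
      have "((\<lambda>b. x + z *\<^sub>R v + b *\<^sub>R w) has_derivative (\<lambda>h. h *\<^sub>R w)) (at b)"
        by (auto intro!: derivative_eq_intros)
      from diff_chain_at[OF this smooth_at_has_derivative[OF sm']]
      moreover have "fderiv ?f1 (x + z *\<^sub>R v + b *\<^sub>R w) (h *\<^sub>R w) = ?f2 (x + z *\<^sub>R v + b *\<^sub>R w) * h" for h
        using linear_cmul[OF linear_frechet_derivative[OF smooth_at_differentiable[OF sm']]] by simp
      ultimately show ?thesis by (simp add: has_field_derivative_def comp_def)
    qed
    have "\<exists>y. 0 < y \<and> y < s \<and> ?f1 (x + z *\<^sub>R v + s *\<^sub>R w) - ?f1 (x + z *\<^sub>R v + 0 *\<^sub>R w)
        = (s - 0) * ?f2 (x + z *\<^sub>R v + y *\<^sub>R w)"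
      by (rule MVT2) (use s d2 in auto)
    then obtain y where y: "0 < y" "y < s" "?f1 (x + z *\<^sub>R v + s *\<^sub>R w) - ?f1 (x + z *\<^sub>R v + 0 *\<^sub>R w)
        = s * ?f2 (x + z *\<^sub>R v + y *\<^sub>R w)" by auto
    have "\<bar>?f2 (x + z *\<^sub>R v + y *\<^sub>R w) - ?f2 x\<bar> \<le> \<epsilon>"
      using \<rho> near[of z s y] s z y by (auto simp: dist_real_def intro: less_imp_le)
    then have "s\<^sup>2 * \<bar>?f2 (x + z *\<^sub>R v + y *\<^sub>R w) - ?f2 x\<bar> \<le> s\<^sup>2 * \<epsilon>" by (intro mult_left_mono) auto
    moreover have "(f (x + s *\<^sub>R v + s *\<^sub>R w) - f (x + s *\<^sub>R v) - f (x + s *\<^sub>R w) + f x) - s\<^sup>2 * ?f2 x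
        = s\<^sup>2 * (?f2 (x + z *\<^sub>R v + y *\<^sub>R w) - ?f2 x)"
      using z(3) y(3) by (simp add: power2_eq_square algebra_simps)
    ultimately show ?thesis by (simp add: abs_mult mult.commute)
  qed
  ultimately show ?thesis by blast
qed

text \<open>The second difference does not change when \<open>v\<close> and \<open>w\<close> are
  exchanged, so both mixed derivatives approximate the same number up to an arbitrarily small
  multiple of s^2. Vector values are reduced to this real case through inner products with basis
  vectors.\<close>

lemma second_derivative_symmetric:
  fixes f :: "'x::euclidean_space \<Rightarrow> 'y::euclidean_space"
  assumes "smooth_at f x"
  shows "fderiv (\<lambda>y. fderiv f y v) x w
    = fderiv (\<lambda>y. fderiv f y w) x v"
proof -
  have real: "fderiv (\<lambda>y. fderiv g y v) x w
    = fderiv (\<lambda>y. fderiv g y w) x v" (is "?a = ?b")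
    if "smooth_at g x" for g :: "'x \<Rightarrow> real"
  proof -
    have "\<bar>?a - ?b\<bar> \<le> e" if "e > 0" for e
    proof -
      obtain d1 where "d1 > 0" and d1: "\<And>s. 0 < s \<and> s < d1 \<Longrightarrow>
        \<bar>(g (x + s *\<^sub>R v + s *\<^sub>R w) - g (x + s *\<^sub>R v) - g (x + s *\<^sub>R w) + g x) - s\<^sup>2 * ?a\<bar> \<le> e / 2 * s\<^sup>2"
        using second_difference[OF \<open>smooth_at g x\<close>, of "e / 2" v w] \<open>e > 0\<close> by auto
      obtain d2 where "d2 > 0" and d2: "\<And>s. 0 < s \<and> s < d2 \<Longrightarrow>
        \<bar>(g (x + s *\<^sub>R w + s *\<^sub>R v) - g (x + s *\<^sub>R w) - g (x + s *\<^sub>R v) + g x) - s\<^sup>2 * ?b\<bar> \<le> e / 2 * s\<^sup>2"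
        using second_difference[OF \<open>smooth_at g x\<close>, of "e / 2" w v] \<open>e > 0\<close> by auto
      \<comment> \<open>Any positive value below both thresholds would do.\<close>
      define s where "s = min d1 d2 / 2"
      have s: "0 < s" "s < d1" "s < d2" using \<open>d1 > 0\<close> \<open>d2 > 0\<close> by (auto simp: s_def)
      have "x + s *\<^sub>R w + s *\<^sub>R v = x + s *\<^sub>R v + s *\<^sub>R w" by (simp add: algebra_simps)
      then have "\<bar>(g (x + s *\<^sub>R v + s *\<^sub>R w) - g (x + s *\<^sub>R v) - g (x + s *\<^sub>R w) + g x) - s\<^sup>2 * ?b\<bar> \<le> e / 2 * s\<^sup>2"
        using d2[of s] s by (simp add: algebra_simps)
      moreover have "\<bar>u - a\<bar> \<le> e / 2 * t \<Longrightarrow> \<bar>u - b\<bar> \<le> e / 2 * t \<Longrightarrow> \<bar>a - b\<bar> \<le> e * t" for u a b t :: real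
        using abs_triangle_ineq4[of "u - b" "u - a"] by simp
      ultimately have "\<bar>s\<^sup>2 * ?a - s\<^sup>2 * ?b\<bar> \<le> e * s\<^sup>2" using d1[of s] s by blast
      then have "s\<^sup>2 * \<bar>?a - ?b\<bar> \<le> s\<^sup>2 * e"
        by (simp add: abs_mult right_diff_distrib[symmetric] mult.commute)
      then show ?thesis using s by simp
    qed
    then show ?thesis by (metis abs_le_zero_iff eq_iff_diff_eq_0 field_le_epsilon add_0)
  qed
  have comp: "fderiv (\<lambda>y. fderiv (\<lambda>y. f y \<bullet> b) y v) x w
    = fderiv (\<lambda>y. fderiv f y v) x w \<bullet> b" for b v w
  proof -
    have *: "((\<lambda>y. h y \<bullet> b) has_derivative (\<lambda>v. fderiv h y v \<bullet> b)) (at y)"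
      if "smooth_at h y" for y and h :: "'x \<Rightarrow> 'y"
      using smooth_at_has_derivative[OF that] by (rule has_derivative_inner_left)
    have "\<forall>\<^sub>F y in nhds x. fderiv f y v \<bullet> b
        = fderiv (\<lambda>y. f y \<bullet> b) y v"
      using smooth_at_eventually[OF assms] by eventually_elim (simp add: frechet_derivativeI[OF *])
    then obtain S where "open S" "x \<in> S" and S: "\<And>y. y \<in> S \<Longrightarrow> fderiv f y v \<bullet> b
        = fderiv (\<lambda>y. f y \<bullet> b) y v" by (auto simp: eventually_nhds)
    from frechet_derivativeI[OF has_derivative_transform_within_open[OF
            *[OF smooth_at_frechet_dir[OF assms]] this(1,2) S]]
    show ?thesis by simp
  qed
  show ?thesis
    by (rule euclidean_eqI)
      (use real[OF smooth_at_inner[OF assms smooth_at_const]] in \<open>simp add: comp\<close>)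
qed

subsection \<open>Straightening and subspaces\<close>

lemma has_derivative_cong_nhds:
  assumes "(f has_derivative f') (at x)" "\<forall>\<^sub>F y in nhds x. f y = g y"
  shows "(g has_derivative f') (at x)"
proof -
  obtain S where "open S" "x \<in> S" "\<And>y. y \<in> S \<Longrightarrow> f y = g y"
    using assms(2) by (auto simp: eventually_nhds)
  from has_derivative_transform_within_open[OF assms(1) this] show ?thesis .
qed

text \<open>Inner products with vectors orthogonal to S vanish along the curve, so they annihilate
  its derivative; a subspace is its own double orthogonal complement.\<close>

lemma vector_derivative_in_subspace:
  fixes h :: "real \<Rightarrow> 'x::euclidean_space"
  assumes h: "(h has_vector_derivative v) (at s)" and S: "subspace S" and ev: "\<forall>\<^sub>F r in nhds s. h r \<in> S"
  shows "v \<in> S"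
proof -
  have "y \<bullet> v = 0" if y: "y \<in> S\<^sup>\<bottom>" for y
  proof -
    have "((\<lambda>r. y \<bullet> h r) has_derivative (\<lambda>r. y \<bullet> (r *\<^sub>R v))) (at s)"
      using h unfolding has_vector_derivative_def by (rule has_derivative_inner_right)
    moreover have "\<forall>\<^sub>F r in nhds s. y \<bullet> h r = 0"
      using ev by (rule eventually_mono) (use y in \<open>auto simp: orthogonal_comp_def orthogonal_def inner_commute\<close>)
    ultimately have "((\<lambda>r. 0) has_derivative (\<lambda>r. y \<bullet> (r *\<^sub>R v))) (at s)"
      by (rule has_derivative_cong_nhds)
    from has_derivative_unique[OF this has_derivative_const]
    have "(\<lambda>r. y \<bullet> (r *\<^sub>R v)) = (\<lambda>r. 0)" .
    from fun_cong[OF this, of 1] show ?thesis by simp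
  qed
  then have "v \<in> S\<^sup>\<bottom>\<^sup>\<bottom>" by (simp add: orthogonal_comp_def[of "S\<^sup>\<bottom>"] orthogonal_def)
  then show ?thesis by (simp add: orthogonal_comp_self S)
qed

lemma linear_vec_inner:
  fixes h :: "real ^ 'k \<Rightarrow> real"
  assumes "linear h" shows "h q = (\<chi> i. h (axis i 1)) \<bullet> q"
proof -
  have "h q = h (\<Sum>i\<in>UNIV. q $ i *\<^sub>R axis i 1)"
    using basis_expansion[of q] by (simp add: scalar_mult_eq_scaleR)
  also have "\<dots> = (\<Sum>i\<in>UNIV. q $ i * h (axis i 1))"
    by (simp add: linear_sum[OF assms] linear_cmul[OF assms])
  finally show ?thesis by (simp add: inner_vec_def mult.commute)
qed

text \<open>Isolates the control block as a matrix. Both the straightening map and the tangency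
  equation are solved for this block alone.\<close>

lemma linear_block:
  fixes D :: "'a::euclidean_space \<times> 'b::euclidean_space \<times> (real^'m) \<times> 'd::euclidean_space \<Rightarrow> real^'m"
  assumes lin: "linear D"
  shows "D (t, q, u, p) = D (t, q, 0, p) + (\<chi> b a. D (0, 0, axis a 1, 0) $ b) *v u"
proof -
  have "linear (\<lambda>u. D (0, 0, u, 0))"
    by (auto intro!: linearI simp: linear_add[OF lin, symmetric] linear_cmul[OF lin, symmetric])
  then have "linear (\<lambda>u. D (0, 0, u, 0) $ i)" for i
    by (rule linear_compose[OF _ bounded_linear.linear[OF bounded_linear_vec_nth], unfolded comp_def])
  from linear_vec_inner[OF this, where q = u]
  have "D (0, 0, u, 0) $ i = ((\<chi> b a. D (0, 0, axis a 1, 0) $ b) *v u) $ i" for i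
    unfolding matrix_vector_mult_def inner_vec_def by (simp only: vec_lambda_beta inner_real_def)
  then have "D (0, 0, u, 0) = (\<chi> b a. D (0, 0, axis a 1, 0) $ b) *v u" by (simp add: vec_eq_iff)
  then show ?thesis using linear_add[OF lin, of "(t, q, 0, p)" "(0, 0, u, 0)"] by simp
qed

text \<open>Replacing the third block of coordinates by g gives a derivative that is the identity on
  the other blocks, so only the matrix of partial derivatives of g in the third block has to be
  inverted. With g = dH/du the critical set becomes a linear slice.\<close>

lemma straighten:
  fixes g :: "'a::euclidean_space \<times> 'b::euclidean_space \<times> (real^'m) \<times> 'd::euclidean_space \<Rightarrow> real^'m"
  assumes O: "open O'" "y0 \<in> O'" and g: "\<And>y. y \<in> O' \<Longrightarrow> smooth_at g y"
    and det: "det (\<chi> b a. fderiv g y0 (0, 0, axis a 1, 0) $ b) \<noteq> 0"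
  defines "\<Phi> \<equiv> \<lambda>y. (fst y, fst (snd y), g y, snd (snd (snd y)))"
  obtains V \<Psi> where "open V" "y0 \<in> V" "V \<subseteq> O'" "smooth_on V \<Phi>" "open (\<Phi> ` V)" "smooth_on (\<Phi> ` V) \<Psi>"
    "\<And>x. x \<in> V \<Longrightarrow> \<Psi> (\<Phi> x) = x"
proof -
  define D where "D y = fderiv g y" for y
  define N where "N y = (\<chi> b a. D y (0, 0, axis a 1, 0) $ b)" for y
  \<comment> \<open>Invertibility at y0 spreads to an open set, on which the inverse derivative has
    an explicit formula.\<close>
  define U where "U = {y \<in> O'. det (N y) \<noteq> 0}"
  define D\<Phi> where "D\<Phi> y v = (fst v, fst (snd v), D y v, snd (snd (snd v)))" for y v
  have sD: "smooth_at (\<lambda>y. D y v) y" if "y \<in> O'" for y v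
    unfolding D_def by (intro smooth_at_frechet_dir g that)
  have sN: "smooth_at (\<lambda>y. N y $ i $ j) y" if "y \<in> O'" for y i j
    unfolding N_def vec_lambda_beta by (intro smooth_at_vec_nth sD that)
  have lin: "linear (D y)" if "y \<in> O'" for y
    unfolding D_def by (intro smooth_at_linear g that)
  have block: "D y (t, q, u, p) = D y (t, q, 0, p) + N y *v u" if "y \<in> O'" for y t q u p
    unfolding N_def by (rule linear_block[OF lin[OF that]])
  have U: "open U"
    unfolding open_iff_eventually
  proof
    fix y assume y: "y \<in> U"
    then have "y \<in> O'" "det (N y) \<in> - {0}" by (auto simp: U_def)
    then have "\<forall>\<^sub>F z in nhds y. det (N z) \<in> - {0}"
      by (intro smooth_at_eventually_image[of "\<lambda>z. det (N z)"] smooth_at_det sN eventually_nhds_in_open) auto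
    with eventually_nhds_in_open[OF O(1) \<open>y \<in> O'\<close>] show "\<forall>\<^sub>F z in nhds y. z \<in> U"
      by eventually_elim (simp add: U_def)
  qed
  have UO: "U \<subseteq> O'" by (auto simp: U_def)
  have y0: "y0 \<in> U" using O det by (simp add: U_def N_def D_def)
  have der: "(\<Phi> has_derivative D\<Phi> y) (at y)" if "y \<in> O'" for y
    unfolding \<Phi>_def D\<Phi>_def D_def
    by (intro has_derivative_Pair has_derivative_fst has_derivative_snd has_derivative_ident
        smooth_at_has_derivative g that)
  have bl: "bounded_linear (D\<Phi> y)" if "y \<in> O'" for y
    using der[OF that] by (rule has_derivative_bounded_linear)
  define f' where "f' y = Blinfun (D\<Phi> y)" for y
  have f': "blinfun_apply (f' y) = D\<Phi> y" if "y \<in> O'" for y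
    using bl[OF that] by (simp add: f'_def bounded_linear_Blinfun_apply)
  have cont: "continuous_on U f'"
  proof (rule continuous_on_blinfun_componentwise)
    fix i
    have "continuous_on U (\<lambda>y. D\<Phi> y i)"
      unfolding D\<Phi>_def
      by (intro continuous_on_Pair continuous_on_const continuous_at_imp_continuous_on ballI smooth_at_isCont sD)
        (use UO in auto)
    then show "continuous_on U (\<lambda>y. blinfun_apply (f' y) i)"
      by (rule continuous_on_eq) (use f' UO in auto)
  qed
  \<comment> \<open>The preimage of \<open>v\<close> under \<open>D\<Phi> x\<close>: the outer
    blocks are copied and the third is solved for by Cramer's rule. As a function of
    \<open>x\<close> it is visibly smooth on \<open>U\<close>.\<close>
  define G where "G v x = (fst v, fst (snd v),
      (1 / det (N x)) *\<^sub>R cramer_solve (N x) (fst (snd (snd v)) - D x (fst v, fst (snd v), 0, snd (snd (snd v)))),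
      snd (snd (snd v)))" for v x
  have solve: "D\<Phi> x (G v x) = v" if x: "x \<in> U" for v x
  proof -
    obtain t q u p where v: "v = (t, q, u, p)" by (cases v) auto
    let ?u = "(1 / det (N x)) *\<^sub>R cramer_solve (N x) (u - D x (t, q, 0, p))"
    have "N x *v ?u = u - D x (t, q, 0, p)"
      using cramer_solve[of "N x" ?u "u - D x (t, q, 0, p)"] x by (simp add: U_def)
    then have "D x (t, q, ?u, p) = u" using block[of x t q ?u p] x by (simp add: U_def)
    then show ?thesis by (simp add: D\<Phi>_def G_def v)
  qed
  have inj: "inj (D\<Phi> x)" if x: "x \<in> U" for x
  proof -
    have xO: "x \<in> O'" using x UO by blast
    have "v = 0" if "D\<Phi> x v = 0" for v
    proof -
      obtain t q u p where v: "v = (t, q, u, p)" by (cases v) auto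
      from that have *: "t = 0" "q = 0" "p = 0" "D x (0, 0, u, 0) = 0"
        by (auto simp: D\<Phi>_def v zero_prod_def)
      have "D x (0, 0, 0, 0) = 0" using linear_0[OF lin[OF xO]] by (simp add: zero_prod_def)
      then have "N x *v u = 0" using block[OF xO, of 0 0 u 0] * by simp
      then have "u = 0" using cramer_solve[of "N x" u 0] cramer_solve[of "N x" 0 0] x by (simp add: U_def)
      then show ?thesis using * by (simp add: v zero_prod_def)
    qed
    then show ?thesis using bl[OF xO] linear_injective_0 bounded_linear.linear by blast
  qed
  have y0O: "y0 \<in> O'" using O by simp
  obtain K where K: "linear K" "K \<circ> D\<Phi> y0 = id"
    using linear_injective_left_inverse[OF bounded_linear.linear[OF bl[OF y0O]] inj[OF y0]] by blast
  have invf: "Blinfun K o\<^sub>L f' y0 = id_blinfun"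
    using K(1) pointfree_idE[OF K(2)] by (intro blinfun_eqI)
      (simp add: f'[OF y0O] bounded_linear_Blinfun_apply linear_conv_bounded_linear)
  have derf: "(\<Phi> has_derivative blinfun_apply (f' y)) (at y)" if "y \<in> U" for y
    using der[of y] f'[of y] that UO by auto
  obtain U' V' \<Psi> g' where IFT: "open U'" "U' \<subseteq> U" "y0 \<in> U'" "open V'" "\<Phi> y0 \<in> V'" "homeomorphism U' V' \<Phi> \<Psi>"
    and g': "\<And>y. y \<in> V' \<Longrightarrow> (\<Psi> has_derivative g' y) (at y)"
    "\<And>y. y \<in> V' \<Longrightarrow> g' y = inv (blinfun_apply (f' (\<Psi> y)))"
    using inverse_function_theorem[OF U derf cont y0 invf] by metis
  have img: "\<Phi> ` U' = V'" "\<Psi> ` V' \<subseteq> U" and inv: "\<And>x. x \<in> U' \<Longrightarrow> \<Psi> (\<Phi> x) = x"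
    using IFT(2,6) by (auto simp: homeomorphism_def)
  \<comment> \<open>The inverse function theorem yields only a differentiable inverse. Its
    derivative is \<open>G v\<close> evaluated at the inverse, so each order of smoothness produces
    the next.\<close>
  have "smooth_on V' \<Psi>"
  proof (rule smooth_on_bootstrap[OF IFT(4) U img(2)])
    show "\<Psi> differentiable (at y)" if "y \<in> V'" for y
      using g'(1)[OF that] by (auto simp: differentiable_def)
    show "fderiv \<Psi> y v = G v (\<Psi> y)" if y: "y \<in> V'" for y v
    proof -
      have x: "\<Psi> y \<in> U" using img(2) y by blast
      have "fderiv \<Psi> y v = inv (D\<Phi> (\<Psi> y)) v"
        using frechet_derivativeI[OF g'(1)[OF y]] g'(2)[OF y] f'[of "\<Psi> y"] x UO by auto
      also have "\<dots> = G v (\<Psi> y)" by (rule inv_f_eq[OF inj[OF x] solve[OF x]])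
      finally show ?thesis .
    qed
    show "smooth_on U (G v)" for v
      unfolding smooth_on_iff_smooth_at[OF U] G_def
    proof
      fix x assume x: "x \<in> U"
      then have "x \<in> O'" "det (N x) \<noteq> 0" by (auto simp: U_def)
      then show "smooth_at (\<lambda>x. (fst v, fst (snd v), (1 / det (N x)) *\<^sub>R
          cramer_solve (N x) (fst (snd (snd v)) - D x (fst v, fst (snd v), 0, snd (snd (snd v)))),
          snd (snd (snd v)))) x"
        by (intro smooth_at_Pair smooth_at_const smooth_at_scaleR smooth_at_divide smooth_at_det sN
            smooth_at_cramer_solve smooth_at_diff sD)
    qed
  qed
  moreover have "smooth_on U' \<Phi>"
    unfolding smooth_on_iff_smooth_at[OF IFT(1)] \<Phi>_def
  proof
    fix x assume "x \<in> U'"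
    then have "x \<in> O'" using IFT(2) UO by blast
    then show "smooth_at (\<lambda>y. (fst y, fst (snd y), g y, snd (snd (snd y)))) x"
      by (intro smooth_at_Pair smooth_at_fst smooth_at_snd smooth_at_ident g)
  qed
  ultimately show thesis using that[of U' \<Psi>] IFT UO img inv by blast
qed

subsection \<open>Bump functions\<close>

text \<open>The factor t^(-n) makes the family closed under differentiation up to linear
  combinations: the derivative of \<open>flat n\<close> involves only \<open>flat (n + 1)\<close>
  and \<open>flat (n + 2)\<close>. Smoothness of exp(-1/t) then follows by one induction over the
  order for all n at once.\<close>

definition flat :: "nat \<Rightarrow> real \<Rightarrow> real" where
  "flat n t = (if t \<le> 0 then 0 else inverse t ^ n * exp (- inverse t))"

lemma flat_tendsto_0: "(flat n \<longlongrightarrow> 0) (at 0)"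
proof -
  have lim: "((\<lambda>t::real. t ^ n * exp (- t)) \<longlongrightarrow> 0) at_top"
    using tendsto_power_div_exp_0[of n] by (simp add: exp_minus divide_inverse)
  have "((\<lambda>t::real. inverse t ^ n * exp (- inverse t)) \<longlongrightarrow> 0) (at_right 0)"
    by (rule filterlim_compose[OF lim filterlim_inverse_at_top_right])
  then have "(flat n \<longlongrightarrow> 0) (at_right 0)"
    by (rule Lim_transform_eventually) (auto simp: flat_def eventually_at_filter)
  moreover have "(flat n \<longlongrightarrow> 0) (at_left 0)"
    by (rule Lim_transform_eventually[OF tendsto_const]) (auto simp: flat_def eventually_at_filter)
  ultimately show ?thesis by (simp add: filterlim_split_at_real)
qed

lemma flat_deriv: "(flat n has_real_derivative flat (n + 2) t - real n * flat (n + 1) t) (at t)"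
proof -
  consider "t < 0" | "t = 0" | "t > 0" by linarith
  then show ?thesis
  proof cases
    case 1
    have "((\<lambda>t. 0) has_real_derivative 0) (at t)" by simp
    then have "(flat n has_real_derivative 0) (at t)"
      by (rule has_field_derivative_transform_within_open[where S = "{..<0}"])
        (use 1 in \<open>auto simp: flat_def\<close>)
    then show ?thesis using 1 by (simp add: flat_def)
  next
    case 2
    \<comment> \<open>The difference quotient of \<open>flat n\<close> at 0 is
      \<open>flat (n + 1)\<close>, on both sides of 0, and tends to 0.\<close>
    have "((\<lambda>h. (flat n (0 + h) - flat n 0) / h) \<longlongrightarrow> 0) (at 0)"
      by (rule Lim_transform_eventually[OF flat_tendsto_0[of "Suc n"]])
        (auto simp: flat_def eventually_at_filter divide_inverse)
    then show ?thesis using 2 by (simp add: DERIV_def flat_def)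
  next
    case 3
    have inv: "(inverse has_real_derivative - (inverse t ^ Suc (Suc 0))) (at t)"
      by (rule DERIV_inverse) (use 3 in simp)
    have "real n * (- (inverse t ^ Suc (Suc 0)) * inverse t ^ (n - Suc 0)) * exp (- inverse t)
        + exp (- inverse t) * - (- (inverse t ^ Suc (Suc 0))) * inverse t ^ n
        = flat (n + 2) t - real n * flat (n + 1) t"
      using 3 by (cases n) (simp_all add: flat_def algebra_simps)
    then have "((\<lambda>t. inverse t ^ n * exp (- inverse t)) has_real_derivative
        flat (n + 2) t - real n * flat (n + 1) t) (at t)"
      using DERIV_mult[OF DERIV_power[OF inv, of n] DERIV_fun_exp[OF DERIV_minus[OF inv]]] by simp
    then show ?thesis
      by (rule has_field_derivative_transform_within_open[where S = "{0<..}"])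
        (use 3 in \<open>auto simp: flat_def\<close>)
  qed
qed

lemma smooth_at_flat: "smooth_at (flat n) t"
proof -
  have "Ck_on k UNIV (flat n)" for k
  proof (induction k arbitrary: n)
    case 0
    show ?case by (auto intro!: continuous_at_imp_continuous_on DERIV_isCont[OF flat_deriv])
  next
    case (Suc k)
    have der: "(flat n has_derivative (\<lambda>v. v * (flat (n + 2) t - real n * flat (n + 1) t))) (at t)" for t
      using flat_deriv[of n t] by (simp add: has_field_derivative_def mult_commute_abs)
    have "Ck_on k UNIV (\<lambda>t. v * (flat (n + 2) t - real n * flat (n + 1) t))" for v
      using Ck_on_add[OF open_UNIV Suc Ck_on_bilinear[OF bounded_bilinear_mult open_UNIV Ck_on_const Suc],
          of "n + 2" "- real n" "n + 1"]
      by (intro Ck_on_bilinear[OF bounded_bilinear_mult] Ck_on_const) auto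
    then show ?case using der frechet_derivativeI[OF der] by (auto simp: differentiable_def)
  qed
  then show ?thesis unfolding smooth_at_def smooth_on_def by blast
qed

lemma bump_function:
  fixes x :: "'x::euclidean_space"
  assumes "0 < r" "r < R"
  obtains \<psi> :: "'x \<Rightarrow> real" where "\<And>y. smooth_at \<psi> y" "\<And>y. dist y x \<le> r \<Longrightarrow> \<psi> y = 1"
    "\<And>y. dist y x \<ge> R \<Longrightarrow> \<psi> y = 0"
proof
  \<comment> \<open>\<open>?a\<close> vanishes at distance at least \<open>R\<close>,
    \<open>?b\<close> at distance at most \<open>r\<close>; as r < R they are never zero together.
    Squared distances are used because they are smooth at the centre.\<close>
  let ?a = "\<lambda>y. flat 0 (R\<^sup>2 - (y - x) \<bullet> (y - x))" and ?b = "\<lambda>y. flat 0 ((y - x) \<bullet> (y - x) - r\<^sup>2)"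
  let ?\<psi> = "\<lambda>y. ?a y / (?a y + ?b y)"
  have sq: "(y - x) \<bullet> (y - x) = (dist y x)\<^sup>2" for y by (simp add: dist_norm power2_norm_eq_inner)
  have "r\<^sup>2 < R\<^sup>2" using assms by (simp add: power_strict_mono)
  have "?a y + ?b y > 0" for y
  proof (cases "R\<^sup>2 > (y - x) \<bullet> (y - x)")
    case True
    then show ?thesis by (auto simp: flat_def intro: add_pos_nonneg)
  next
    case False
    then show ?thesis using \<open>r\<^sup>2 < R\<^sup>2\<close> by (auto simp: flat_def)
  qed
  then have ne: "?a y + ?b y \<noteq> 0" for y by (metis less_irrefl)
  show "smooth_at ?\<psi> y" for y
    by (intro smooth_at_divide smooth_at_intros ne smooth_at_compose[OF smooth_at_flat])
  show "?\<psi> y = 1" if "dist y x \<le> r" for y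
  proof -
    have "(dist y x)\<^sup>2 \<le> r\<^sup>2" using that by (simp add: power_mono)
    then have "?b y = 0" by (simp add: flat_def sq)
    then show ?thesis using ne[of y] by simp
  qed
  show "?\<psi> y = 0" if "dist y x \<ge> R" for y
  proof -
    have "(dist y x)\<^sup>2 \<ge> R\<^sup>2" using that assms by (simp add: power_mono)
    then show ?thesis by (simp add: flat_def sq)
  qed
qed

section \<open>Atlases, germs and tangent vectors\<close>

lemma param_coord: "is_chart c \<Longrightarrow> p \<in> cdom c \<Longrightarrow> param c (coord c p) = p"
  by (simp add: is_chart_def inv_into_f_f)

lemma coord_param: "x \<in> coord c ` S \<Longrightarrow> S \<subseteq> cdom c \<Longrightarrow> coord c (param c x) = x"
  by (metis f_inv_into_f image_mono subsetD)

lemma param_in: "x \<in> coord c ` S \<Longrightarrow> S \<subseteq> cdom c \<Longrightarrow> param c x \<in> cdom c"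
  by (metis image_mono inv_into_into subsetD)

lemma param_in_subset:
  "is_chart c \<Longrightarrow> x \<in> coord c ` S \<Longrightarrow> S \<subseteq> cdom c \<Longrightarrow> param c x \<in> S"
  by (auto simp: param_coord subset_iff)

lemma eventually_param:
  assumes "is_chart c" "open (coord c ` S)" "S \<subseteq> cdom c" "p \<in> S"
  shows "\<forall>\<^sub>F x in nhds (coord c p). x \<in> coord c ` S \<and> param c x \<in> S"
  using assms param_in_subset[OF assms(1) _ assms(3)] eventually_nhds_in_open[of "coord c ` S" "coord c p"]
  by (auto elim!: eventually_mono)

lemma eventually_nhds_chart:
  assumes "is_chart c" "p \<in> cdom c"
  shows "\<forall>\<^sub>F x in nhds (coord c p). x \<in> coord c ` cdom c \<and> param c x \<in> cdom c \<and> coord c (param c x) = x"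
proof -
  have "\<forall>\<^sub>F x in nhds (coord c p). x \<in> coord c ` cdom c"
    using assms by (intro eventually_nhds_in_open) (auto simp: is_chart_def)
  then show ?thesis by eventually_elim (auto simp: param_coord[OF assms(1)])
qed

lemma smooth_transitionI:
  assumes "\<And>p. p \<in> cdom c \<Longrightarrow> p \<in> cdom d \<Longrightarrow>
      \<forall>\<^sub>F x in nhds (coord c p). x \<in> coord c ` (cdom c \<inter> cdom d)"
    "\<And>p. p \<in> cdom c \<Longrightarrow> p \<in> cdom d \<Longrightarrow> smooth_at (coord d \<circ> param c) (coord c p)"
  shows "smooth_transition c d"
  unfolding smooth_transition_def
proof
  show *: "open (coord c ` (cdom c \<inter> cdom d))"
    unfolding open_iff_eventually using assms(1) by auto
  show "smooth_on (coord c ` (cdom c \<inter> cdom d)) (coord d \<circ> param c)"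
    unfolding smooth_on_iff_smooth_at[OF *] using assms(2) by auto
qed

lemma smooth_transitionD:
  assumes "smooth_transition c d" "is_chart c" "p \<in> cdom c" "p \<in> cdom d"
  shows "smooth_at (coord d \<circ> param c) (coord c p)"
    "\<forall>\<^sub>F x in nhds (coord c p). x \<in> coord c ` (cdom c \<inter> cdom d) \<and> param c x \<in> cdom c \<and>
      param c x \<in> cdom d"
  using assms eventually_param[of c "cdom c \<inter> cdom d" p]
  by (auto simp: smooth_transition_def intro!: smooth_onD elim!: eventually_mono)

text \<open>Members of the maximal atlas are compared only with the generating atlas. Near a common
  point the transition between two of them factors through a generating chart, here
  \<open>a\<close>.\<close>

lemma smooth_transition_trans:
  assumes ch: "is_chart c" "is_chart a" "is_chart d"
    and tr: "smooth_transition c a" "smooth_transition a d"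
    and p: "p \<in> cdom c" "p \<in> cdom a" "p \<in> cdom d"
  shows "\<forall>\<^sub>F x in nhds (coord c p). x \<in> coord c ` (cdom c \<inter> cdom d)"
    "smooth_at (coord d \<circ> param c) (coord c p)"
proof -
  note ca = smooth_transitionD[OF tr(1) ch(1) p(1,2)] and ad = smooth_transitionD[OF tr(2) ch(2) p(2,3)]
  have cp: "(coord a \<circ> param c) (coord c p) = coord a p" by (simp add: param_coord[OF ch(1)] p)
  have "\<forall>\<^sub>F x in nhds (coord c p). param a ((coord a \<circ> param c) x) \<in> cdom d"
    by (rule smooth_at_eventually_image[OF ca(1)], unfold cp, rule eventually_mono[OF ad(2)]) simp
  with ca(2) have ev: "\<forall>\<^sub>F x in nhds (coord c p). x \<in> coord c ` (cdom c \<inter> cdom d) \<and>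
      (coord d \<circ> param a) ((coord a \<circ> param c) x) = (coord d \<circ> param c) x"
    by eventually_elim (auto simp: param_coord ch)
  then show "\<forall>\<^sub>F x in nhds (coord c p). x \<in> coord c ` (cdom c \<inter> cdom d)"
    by (rule eventually_mono) auto
  have "smooth_at (\<lambda>x. (coord d \<circ> param a) ((coord a \<circ> param c) x)) (coord c p)"
    by (rule smooth_at_compose[of "coord d \<circ> param a", OF _ ca(1)], unfold cp, rule ad(1))
  then show "smooth_at (coord d \<circ> param c) (coord c p)"
    by (rule smooth_at_cong) (use ev in \<open>auto elim: eventually_mono\<close>)
qed

section \<open>Germs of functions and curves on an atlas\<close>

definition mnhds :: "('a, 'x::euclidean_space) atlas \<Rightarrow> 'a \<Rightarrow> 'a filter" where
  "mnhds A p = filtermap (param (chart_at A p)) (nhds (coord (chart_at A p) p))"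

text \<open>Off the carrier \<open>chart_at\<close> is an arbitrary value; the first two conjuncts
  make the predicate false there.\<close>

definition msmooth :: "('a, 'x::euclidean_space) atlas \<Rightarrow> ('a \<Rightarrow> 'y::euclidean_space) \<Rightarrow> 'a \<Rightarrow> bool" where
  "msmooth A f p \<longleftrightarrow>
     chart_at A p \<in> charts A \<and> p \<in> cdom (chart_at A p) \<and>
     smooth_at (\<lambda>x. f (param (chart_at A p) x)) (coord (chart_at A p) p)"

text \<open>Just what a velocity requires. Remaining in the chart domain near \<open>s\<close> is
  part of it, since a chart has meaningless values elsewhere.\<close>

definition curve_at :: "('a, 'x::euclidean_space) atlas \<Rightarrow> (real \<Rightarrow> 'a) \<Rightarrow> real \<Rightarrow> bool" where
  "curve_at A \<gamma> s \<longleftrightarrow> (\<exists>c\<in>charts A. \<gamma> s \<in> cdom c \<and> (\<forall>\<^sub>F r in nhds s. \<gamma> r \<in> cdom c) \<and>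
     (\<lambda>r. coord c (\<gamma> r)) differentiable (at s))"

lemma chart_at: "c \<in> charts A \<Longrightarrow> p \<in> cdom c \<Longrightarrow> chart_at A p \<in> charts A \<and> p \<in> cdom (chart_at A p)"
  unfolding chart_at_def by (rule someI) auto

locale smooth_atlas =
  fixes A :: "('a, 'x::euclidean_space) atlas"
  assumes is_chart: "c \<in> A \<Longrightarrow> is_chart c"
    and compatible: "c \<in> A \<Longrightarrow> d \<in> A \<Longrightarrow> compatible c d"
begin

lemma in_charts: "c \<in> A \<Longrightarrow> c \<in> charts A"
  using is_chart compatible by (auto simp: charts_def carrier_def)

lemma carrier_chart: "p \<in> carrier A \<Longrightarrow> \<exists>c\<in>A. p \<in> cdom c"
  by (auto simp: carrier_def)

lemma charts_is_chart: "c \<in> charts A \<Longrightarrow> is_chart c"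
  by (simp add: charts_def)

lemma param_chart: "c \<in> charts A \<Longrightarrow> p \<in> cdom c \<Longrightarrow> param c (coord c p) = p"
  by (rule param_coord[OF charts_is_chart])

lemma charts_carrier: "c \<in> charts A \<Longrightarrow> p \<in> cdom c \<Longrightarrow> p \<in> carrier A"
  by (auto simp: charts_def)

lemma charts_transition:
  assumes c: "c \<in> charts A" and d: "d \<in> charts A"
  shows "smooth_transition c d"
proof (rule smooth_transitionI)
  fix p assume p: "p \<in> cdom c" "p \<in> cdom d"
  obtain a where a: "a \<in> A" "p \<in> cdom a" using carrier_chart charts_carrier c p by blast
  have "smooth_transition c a" "smooth_transition a d" "is_chart a"
    using a c d is_chart by (auto simp: charts_def compatible_def)
  from smooth_transition_trans[OF charts_is_chart[OF c] this(3) charts_is_chart[OF d] this(1,2) p(1) a(2) p(2)]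
  show "\<forall>\<^sub>F x in nhds (coord c p). x \<in> coord c ` (cdom c \<inter> cdom d)"
    "smooth_at (coord d \<circ> param c) (coord c p)" .
qed

lemma transition_smooth_at:
  assumes "c \<in> charts A" "d \<in> charts A" "p \<in> cdom c" "p \<in> cdom d"
  shows "smooth_at (coord d \<circ> param c) (coord c p)"
  using smooth_transitionD(1)[OF charts_transition charts_is_chart] assms by blast

text \<open>Transition maps are continuous, so the neighbourhood filter can be read in any chart.
  Eventual statements along it then take the place of open subsets of the manifold.\<close>

lemma eventually_mnhds_change:
  assumes cd: "c \<in> charts A" "d \<in> charts A" and p: "p \<in> cdom c" "p \<in> cdom d"
    and P: "\<forall>\<^sub>F x in nhds (coord d p). P (param d x)"
  shows "\<forall>\<^sub>F x in nhds (coord c p). P (param c x)"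
proof -
  note t = smooth_transitionD[OF charts_transition[OF cd] charts_is_chart[OF cd(1)] p]
  have "(coord d \<circ> param c) (coord c p) = coord d p"
    by (simp add: param_chart[OF cd(1)] p)
  with P have "\<forall>\<^sub>F x in nhds (coord c p). P (param d ((coord d \<circ> param c) x))"
    by (intro smooth_at_eventually_image[OF t(1)]) simp
  with t(2) show ?thesis
    by eventually_elim (simp add: param_chart[OF cd(2)])
qed

lemma eventually_mnhds:
  assumes "c \<in> charts A" "p \<in> cdom c"
  shows "eventually P (mnhds A p) \<longleftrightarrow> (\<forall>\<^sub>F x in nhds (coord c p). P (param c x))"
proof -
  have "chart_at A p \<in> charts A" "p \<in> cdom (chart_at A p)" using chart_at[OF assms] by auto
  then show ?thesis unfolding mnhds_def eventually_filtermap
    using eventually_mnhds_change assms by blast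
qed

lemma eventually_in_chart:
  assumes "c \<in> charts A" "p \<in> cdom c" shows "\<forall>\<^sub>F q in mnhds A p. q \<in> cdom c"
  using eventually_nhds_chart[OF charts_is_chart[OF assms(1)] assms(2)]
  unfolding eventually_mnhds[OF assms] by (auto elim: eventually_mono)

lemma eventually_mnhds_self:
  assumes "c \<in> charts A" "p \<in> cdom c" "eventually P (mnhds A p)" shows "P p"
  using eventually_nhds_x_imp_x[OF assms(3)[unfolded eventually_mnhds[OF assms(1,2)]]]
  by (simp add: param_chart[OF assms(1)] assms)

lemma eventually_open_in:
  assumes "open_in A U" "p \<in> U" shows "\<forall>\<^sub>F q in mnhds A p. q \<in> U"
proof -
  obtain c where c: "c \<in> A" "p \<in> cdom c" using assms by (auto simp: open_in_def carrier_def)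
  have "\<forall>\<^sub>F x in nhds (coord c p). param c x \<in> U \<inter> cdom c"
    using eventually_param[of c "U \<inter> cdom c" p] assms c is_chart
    by (auto simp: open_in_def elim!: eventually_mono)
  then show ?thesis unfolding eventually_mnhds[OF in_charts[OF c(1)] c(2)]
    by (rule eventually_mono) auto
qed

lemma open_image_chart:
  assumes "\<And>p. p \<in> U \<Longrightarrow> \<forall>\<^sub>F q in mnhds A p. q \<in> U" "c \<in> charts A"
  shows "open (coord c ` (U \<inter> cdom c))"
  unfolding open_iff_eventually
proof safe
  fix p assume p: "p \<in> U" "p \<in> cdom c"
  have "\<forall>\<^sub>F x in nhds (coord c p). param c x \<in> U"
    using assms(1)[OF p(1)] by (simp add: eventually_mnhds[OF assms(2) p(2)])
  with eventually_nhds_chart[OF charts_is_chart[OF assms(2)] p(2)]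
  show "\<forall>\<^sub>F x in nhds (coord c p). x \<in> coord c ` (U \<inter> cdom c)"
    by eventually_elim (metis IntI image_eqI)
qed

lemma open_inI:
  assumes "U \<subseteq> carrier A" "\<And>p. p \<in> U \<Longrightarrow> \<forall>\<^sub>F q in mnhds A p. q \<in> U"
  shows "open_in A U"
  using assms open_image_chart[OF assms(2) in_charts] by (auto simp: open_in_def)

lemma open_in_iff: "open_in A U \<longleftrightarrow> U \<subseteq> carrier A \<and> (\<forall>p\<in>U. \<forall>\<^sub>F q in mnhds A p. q \<in> U)"
proof
  assume "open_in A U"
  then show "U \<subseteq> carrier A \<and> (\<forall>p\<in>U. \<forall>\<^sub>F q in mnhds A p. q \<in> U)"
    using eventually_open_in by (simp add: open_in_def)
qed (simp add: open_inI)

lemma istopology_open_in: "istopology (open_in A)"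
  unfolding istopology_def open_in_iff
proof (intro conjI allI impI ballI)
  fix S T p
  assume "S \<subseteq> carrier A \<and> (\<forall>p\<in>S. \<forall>\<^sub>F q in mnhds A p. q \<in> S)"
    "T \<subseteq> carrier A \<and> (\<forall>p\<in>T. \<forall>\<^sub>F q in mnhds A p. q \<in> T)" "p \<in> S \<inter> T"
  then show "\<forall>\<^sub>F q in mnhds A p. q \<in> S \<inter> T" by (simp add: eventually_conj_iff)
next
  fix K p
  assume K: "\<forall>U\<in>K. U \<subseteq> carrier A \<and> (\<forall>p\<in>U. \<forall>\<^sub>F q in mnhds A p. q \<in> U)" "p \<in> \<Union> K"
  then obtain U where U: "U \<in> K" "p \<in> U" by blast
  then have "\<forall>\<^sub>F q in mnhds A p. q \<in> U" using K by blast
  then show "\<forall>\<^sub>F q in mnhds A p. q \<in> \<Union> K" by (rule eventually_mono) (use U in blast)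
qed blast+

lemma openin_iff: "openin (topology (open_in A)) = open_in A"
  by (simp add: topology_inverse' istopology_open_in)

lemma open_in_carrier: "open_in A (carrier A)"
proof (rule open_inI)
  fix p assume "p \<in> carrier A"
  then obtain c where "c \<in> A" "p \<in> cdom c" using carrier_chart by blast
  then show "\<forall>\<^sub>F q in mnhds A p. q \<in> carrier A"
    by (intro eventually_mono[OF eventually_in_chart[OF in_charts] charts_carrier[OF in_charts]])
qed simp

lemma topspace_open_in: "topspace (topology (open_in A)) = carrier A"
  using open_in_carrier unfolding topspace_def openin_iff by (auto simp: open_in_def)

lemma msmooth_chart:
  assumes "c \<in> charts A" "p \<in> cdom c"
  shows "msmooth A f p \<longleftrightarrow> smooth_at (\<lambda>x. f (param c x)) (coord c p)"
proof -
  have *: "smooth_at (\<lambda>x. f (param d x)) (coord d p)"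
    if cd: "c \<in> charts A" "d \<in> charts A" "p \<in> cdom c" "p \<in> cdom d"
      and f: "smooth_at (\<lambda>x. f (param c x)) (coord c p)" for c d
  proof -
    have "smooth_at (\<lambda>x. f (param c ((coord c \<circ> param d) x))) (coord d p)"
      by (rule smooth_at_compose[of "\<lambda>x. f (param c x)", OF _ transition_smooth_at])
        (use cd f in \<open>auto simp: param_coord charts_is_chart\<close>)
    then show ?thesis
    proof (rule smooth_at_cong)
      show "\<forall>\<^sub>F x in nhds (coord d p). f (param c ((coord c \<circ> param d) x)) = f (param d x)"
        using eventually_in_chart[OF cd(1,3)] unfolding eventually_mnhds[OF cd(2,4)]
        by eventually_elim (simp add: param_chart[OF cd(1)])
    qed
  qed
  show ?thesis using chart_at[OF assms] *[of c "chart_at A p"] *[of "chart_at A p" c] assms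
    by (auto simp: msmooth_def)
qed

lemma msmooth_coord:
  assumes "c \<in> charts A" "p \<in> cdom c" shows "msmooth A (coord c) p"
  unfolding msmooth_chart[OF assms]
  by (rule smooth_at_cong[OF smooth_at_ident])
    (use eventually_nhds_chart[OF charts_is_chart[OF assms(1)] assms(2)] in \<open>auto elim!: eventually_mono\<close>)

lemma msmooth_compose:
  assumes "msmooth A f p" "smooth_at g (f p)" shows "msmooth A (\<lambda>q. g (f q)) p"
proof -
  have c: "chart_at A p \<in> charts A" "p \<in> cdom (chart_at A p)" using assms(1) by (auto simp: msmooth_def)
  have "smooth_at g (f (param (chart_at A p) (coord (chart_at A p) p)))"
    using assms(2) by (simp add: param_chart c)
  from smooth_at_compose[OF this assms(1)[unfolded msmooth_chart[OF c]]]
  show ?thesis unfolding msmooth_chart[OF c] .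
qed

lemma msmooth_cong:
  assumes "msmooth A f p" "\<forall>\<^sub>F q in mnhds A p. f q = g q" shows "msmooth A g p"
  using assms by (auto simp: msmooth_def mnhds_def eventually_filtermap elim: smooth_at_cong)

lemma msmooth_const: "p \<in> carrier A \<Longrightarrow> msmooth A (\<lambda>q. c) p"
  by (auto dest!: carrier_chart in_charts simp: msmooth_chart smooth_at_const)

lemma msmooth_sum:
  assumes "p \<in> carrier A" "\<And>i. i \<in> I \<Longrightarrow> msmooth A (f i) p"
  shows "msmooth A (\<lambda>q. \<Sum>i\<in>I. f i q) p"
proof -
  obtain c where "c \<in> charts A" "p \<in> cdom c" using assms carrier_chart in_charts by blast
  then show ?thesis using assms(2) by (simp add: msmooth_chart smooth_at_sum)
qed

lemma msmooth_prod:
  fixes f :: "'i \<Rightarrow> 'a \<Rightarrow> real"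
  assumes "p \<in> carrier A" "\<And>i. i \<in> I \<Longrightarrow> msmooth A (f i) p"
  shows "msmooth A (\<lambda>q. \<Prod>i\<in>I. f i q) p"
proof -
  obtain c where "c \<in> charts A" "p \<in> cdom c" using assms carrier_chart in_charts by blast
  then show ?thesis using assms(2) by (simp add: msmooth_chart smooth_at_prod)
qed

lemma msmooth_diff: "msmooth A f p \<Longrightarrow> msmooth A g p \<Longrightarrow> msmooth A (\<lambda>q. f q - g q) p"
  by (auto simp: msmooth_def intro: smooth_at_diff)

lemma msmooth_scaleR: "msmooth A f p \<Longrightarrow> msmooth A g p \<Longrightarrow> msmooth A (\<lambda>q. f q *\<^sub>R g q) p"
  by (auto simp: msmooth_def intro: smooth_at_scaleR)

text \<open>A local diffeomorphism of the model space may be applied after a chart without leaving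
  the maximal atlas. This turns straightened coordinates into charts that can serve as slice
  charts.\<close>

lemma charts_transform:
  assumes c: "c \<in> charts A" and V: "open V" "V \<subseteq> coord c ` cdom c"
    and \<Phi>: "smooth_on V \<Phi>" "open (\<Phi> ` V)"
    and \<Psi>: "smooth_on (\<Phi> ` V) \<Psi>" "\<And>x. x \<in> V \<Longrightarrow> \<Psi> (\<Phi> x) = x"
  shows "({p \<in> cdom c. coord c p \<in> V}, \<lambda>p. \<Phi> (coord c p)) \<in> charts A" (is "?d \<in> _")
proof -
  have img: "coord ?d ` cdom ?d = \<Phi> ` V" using V(2) by (auto simp: image_iff subset_iff)
  have d: "is_chart ?d"
    using img \<Phi>(2) \<Psi>(2) charts_is_chart[OF c] unfolding is_chart_def
    by (auto simp: inj_on_def) metis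
  have par: "param ?d y = param c (\<Psi> y)" if y: "y \<in> \<Phi> ` V" for y
  proof -
    obtain x where x: "x \<in> V" "y = \<Phi> x" using y by blast
    then obtain p where "p \<in> cdom c" "x = coord c p" using V(2) by blast
    with x show ?thesis using param_coord[OF d, of p] \<Psi>(2) param_chart[OF c] by auto
  qed
  have "compatible a ?d" if a: "a \<in> A" for a
    unfolding compatible_def
  proof
    note t = charts_transition[OF in_charts[OF a] c] and ac = charts_is_chart[OF in_charts[OF a]]
    show "smooth_transition a ?d"
    proof (rule smooth_transitionI)
      fix p assume p: "p \<in> cdom a" "p \<in> cdom ?d"
      then have pc: "p \<in> cdom c" "coord c p \<in> V" by auto
      note s = smooth_transitionD[OF t ac p(1) pc(1)]
      have "\<forall>\<^sub>F x in nhds (coord a p). (coord c \<circ> param a) x \<in> V"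
        by (rule smooth_at_eventually_image[OF s(1)])
          (use V pc in \<open>auto simp: param_coord[OF ac p(1)] intro: eventually_nhds_in_open\<close>)
      with s(2) show "\<forall>\<^sub>F x in nhds (coord a p). x \<in> coord a ` (cdom a \<inter> cdom ?d)"
        by eventually_elim (auto simp: image_iff param_coord[OF ac])
      have "smooth_at (\<lambda>x. \<Phi> ((coord c \<circ> param a) x)) (coord a p)"
        by (rule smooth_at_compose[of \<Phi>, OF _ s(1)])
          (use smooth_onD[OF \<Phi>(1) V(1) pc(2)] in \<open>simp add: param_coord[OF ac p(1)]\<close>)
      then show "smooth_at (coord ?d \<circ> param a) (coord a p)" by (simp add: comp_def)
    qed
    note t = charts_transition[OF c in_charts[OF a]] and cc = charts_is_chart[OF c]
    show "smooth_transition ?d a"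
    proof (rule smooth_transitionI)
      fix p assume p: "p \<in> cdom ?d" "p \<in> cdom a"
      then have pc: "p \<in> cdom c" "coord c p \<in> V" by auto
      note s = smooth_transitionD[OF t cc pc(1) p(2)]
      have y: "coord ?d p \<in> \<Phi> ` V" using pc by auto
      have \<Psi>s: "smooth_at \<Psi> (coord ?d p)" by (rule smooth_onD[OF \<Psi>(1) \<Phi>(2) y])
      have \<Psi>p: "\<Psi> (coord ?d p) = coord c p" using pc \<Psi>(2) by simp
      have ev: "\<forall>\<^sub>F y in nhds (coord ?d p). param c (\<Psi> y) \<in> cdom a"
        by (rule smooth_at_eventually_image[OF \<Psi>s], unfold \<Psi>p, rule eventually_mono[OF s(2)]) simp
      have evV: "\<forall>\<^sub>F y in nhds (coord ?d p). y \<in> \<Phi> ` V" by (rule eventually_nhds_in_open[OF \<Phi>(2) y])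
      from ev evV show "\<forall>\<^sub>F y in nhds (coord ?d p). y \<in> coord ?d ` (cdom ?d \<inter> cdom a)"
      proof eventually_elim
        case (elim y)
        have y: "y \<in> coord ?d ` cdom ?d" using elim(2) unfolding img .
        have "param ?d y \<in> cdom a" using elim(1) unfolding par[OF elim(2)] .
        then show ?case
          by (intro rev_image_eqI[OF IntI[OF inv_into_into[OF y]]] f_inv_into_f[OF y, symmetric])
      qed
      have "smooth_at (\<lambda>y. (coord a \<circ> param c) (\<Psi> y)) (coord ?d p)"
        by (rule smooth_at_compose[of "coord a \<circ> param c", OF _ \<Psi>s]) (use s(1) in \<open>simp only: \<Psi>p\<close>)
      then show "smooth_at (coord a \<circ> param ?d) (coord ?d p)"
        by (rule smooth_at_cong) (use evV par in \<open>auto elim!: eventually_mono\<close>)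
    qed
  qed
  then show ?thesis using d c by (auto simp: charts_def)
qed

subsection \<open>Tangent vectors\<close>

text \<open>One chain rule behind several facts: with f a coordinate map it gives the compatibility
  of components of tangent vectors, with general f the chart independence of differentials, tangent
  maps and derivatives along curves.\<close>

lemma deriv_chart_change:
  assumes c: "c \<in> charts A" "p \<in> cdom c" and d: "d \<in> charts A" "p \<in> cdom d" and f: "msmooth A f p"
  shows "fderiv (\<lambda>x. f (param c x)) (coord c p) v =
    fderiv (\<lambda>x. f (param d x)) (coord d p)
      (fderiv (coord d \<circ> param c) (coord c p) v)"
proof -
  have e: "(coord d \<circ> param c) (coord c p) = coord d p"
    by (simp add: param_chart[OF c(1)] c)
  have "((\<lambda>x. f (param d x)) \<circ> (coord d \<circ> param c) has_derivative
    fderiv (\<lambda>x. f (param d x)) (coord d p) \<circ>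
      fderiv (coord d \<circ> param c) (coord c p)) (at (coord c p))"
    by (rule diff_chain_at[OF smooth_at_has_derivative[OF transition_smooth_at[OF c(1) d(1) c(2) d(2)]]],
        unfold e, rule smooth_at_has_derivative[OF f[unfolded msmooth_chart[OF d]]])
  moreover have "\<forall>\<^sub>F x in nhds (coord c p). ((\<lambda>x. f (param d x)) \<circ> (coord d \<circ> param c)) x = f (param c x)"
    using eventually_in_chart[OF d] unfolding eventually_mnhds[OF c]
    by eventually_elim (simp add: param_chart[OF d(1)])
  then obtain S where "open S" "coord c p \<in> S"
    "\<And>x. x \<in> S \<Longrightarrow> ((\<lambda>x. f (param d x)) \<circ> (coord d \<circ> param c)) x = f (param c x)"
    by (auto simp: eventually_nhds)
  ultimately have "((\<lambda>x. f (param c x)) has_derivative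
    fderiv (\<lambda>x. f (param d x)) (coord d p) \<circ>
      fderiv (coord d \<circ> param c) (coord c p)) (at (coord c p))"
    by (rule has_derivative_transform_within_open)
  then show ?thesis by (simp add: frechet_derivativeI)
qed

lemma deriv_transition_self:
  assumes c: "c \<in> charts A" "p \<in> cdom c"
  shows "fderiv (coord c \<circ> param c) (coord c p) v = v"
proof -
  have "open (coord c ` cdom c)" using charts_is_chart[OF c(1)] by (simp add: is_chart_def)
  have "((\<lambda>x. x) has_derivative (\<lambda>x. x)) (at (coord c p))" by (rule has_derivative_ident)
  then have "((coord c \<circ> param c) has_derivative (\<lambda>x. x)) (at (coord c p))"
    by (rule has_derivative_transform_within_open[OF _ \<open>open _\<close>])
      (use c in \<open>auto simp: param_chart\<close>)
  then show ?thesis by (simp add: frechet_derivativeI)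
qed

lemma tangent_change:
  assumes "v \<in> tangent_space A p" "c \<in> charts A" "p \<in> cdom c" "d \<in> charts A" "p \<in> cdom d"
  shows "v d = fderiv (coord d \<circ> param c) (coord c p) (v c)"
  using assms(1)[unfolded tangent_space_def mem_Collect_eq, THEN conjunct1, rule_format, OF assms(2,4,3,5)] .

lemma tangent_outside:
  assumes "v \<in> tangent_space A p" "\<not> (c \<in> charts A \<and> p \<in> cdom c)" shows "v c = 0"
  using assms(1)[unfolded tangent_space_def mem_Collect_eq, THEN conjunct2] assms(2) by blast

lemma coord_vector_tangent:
  assumes c: "c \<in> charts A" "p \<in> cdom c"
  shows "coord_vector A c p x \<in> tangent_space A p"
  unfolding tangent_space_def mem_Collect_eq
proof (intro conjI ballI allI impI)
  fix d e assume "d \<in> charts A" "e \<in> charts A" "p \<in> cdom d" "p \<in> cdom e"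
  then show "coord_vector A c p x e =
      fderiv (coord e \<circ> param d) (coord d p) (coord_vector A c p x d)"
    using deriv_chart_change[OF c _ _ msmooth_coord, of d e x] by (simp add: coord_vector_def comp_def)
qed (auto simp: coord_vector_def)

lemma coord_vector_self: "c \<in> charts A \<Longrightarrow> p \<in> cdom c \<Longrightarrow> coord_vector A c p x c = x"
  by (simp add: coord_vector_def deriv_transition_self)

lemma tangent_eqI:
  assumes "v \<in> tangent_space A p" "w \<in> tangent_space A p" "c \<in> charts A" "p \<in> cdom c" "v c = w c"
  shows "v = w"
proof
  fix d show "v d = w d"
  proof (cases "d \<in> charts A \<and> p \<in> cdom d")
    case True
    then show ?thesis
      using tangent_change[OF assms(1,3,4), of d] tangent_change[OF assms(2,3,4), of d] assms(5) by simp
  next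
    case False
    then show ?thesis using tangent_outside[OF assms(1), of d] tangent_outside[OF assms(2), of d] by simp
  qed
qed

lemma tangent_coord:
  assumes "v \<in> tangent_space A p" "c \<in> charts A" "p \<in> cdom c"
  shows "coord_vector A c p (v c) = v"
  by (rule tangent_eqI[OF coord_vector_tangent assms(1) assms(2,3)])
    (use assms in \<open>auto simp: coord_vector_self\<close>)

lemma tangent_sum:
  assumes "\<And>i. i \<in> I \<Longrightarrow> v i \<in> tangent_space A p"
  shows "(\<lambda>c. \<Sum>i\<in>I. r i *\<^sub>R v i c) \<in> tangent_space A p"
proof -
  have *: "(\<Sum>i\<in>I. r i *\<^sub>R v i d) = fderiv (coord d \<circ> param c) (coord c p) (\<Sum>i\<in>I. r i *\<^sub>R v i c)"
    if "c \<in> charts A" "p \<in> cdom c" "d \<in> charts A" "p \<in> cdom d" for c d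
  proof -
    interpret linear "fderiv (coord d \<circ> param c) (coord c p)"
      by (intro smooth_at_linear transition_smooth_at that)
    show ?thesis using tangent_change[OF assms that] by (simp add: sum scaleR)
  qed
  show ?thesis
    unfolding tangent_space_def mem_Collect_eq
  proof (intro conjI ballI allI impI)
    fix c assume "\<not> (c \<in> charts A \<and> p \<in> cdom c)"
    then have "v i c = 0" if "i \<in> I" for i by (rule tangent_outside[OF assms[OF that]])
    then show "(\<Sum>i\<in>I. r i *\<^sub>R v i c) = 0" by (intro sum.neutral) simp
  qed (rule *)
qed

lemma differential_chart:
  assumes "c \<in> charts A" "p \<in> cdom c" "msmooth A f p" "v \<in> tangent_space A p"
  shows "differential A f p v = fderiv (\<lambda>x. f (param c x)) (coord c p) (v c)"
  using chart_at[OF assms(1,2)] assms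
    deriv_chart_change[of "chart_at A p" p c f "v (chart_at A p)"]
    tangent_change[OF assms(4), of "chart_at A p" c]
  by (simp add: differential_def comp_def)

lemma tangent_map_chart:
  assumes "c \<in> charts A" "p \<in> cdom c" "d \<in> charts B" "f p \<in> cdom d"
    "msmooth A (\<lambda>q. coord d (f q)) p" "v \<in> tangent_space A p"
  shows "tangent_map A B f p v d =
    fderiv (\<lambda>x. coord d (f (param c x))) (coord c p) (v c)"
  using chart_at[OF assms(1,2)] assms
    deriv_chart_change[of "chart_at A p" p c "\<lambda>q. coord d (f q)" "v (chart_at A p)"]
    tangent_change[OF assms(6), of "chart_at A p" c]
  by (simp add: tangent_map_def comp_def)

text \<open>The derivative is computed in the chart that \<open>curve_at\<close> provides and
  carried to \<open>d\<close> by the chain rule. Taking f to be a coordinate map shows that the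
  velocity has the components expected in every chart.\<close>

lemma curve_at_compose:
  assumes \<gamma>: "curve_at A \<gamma> s" and d: "d \<in> charts A" "\<gamma> s \<in> cdom d" and f: "msmooth A f (\<gamma> s)"
  shows "((\<lambda>r. f (\<gamma> r)) has_vector_derivative
    fderiv (\<lambda>x. f (param d x)) (coord d (\<gamma> s)) (velocity A \<gamma> s d)) (at s)"
proof -
  obtain c where c: "c \<in> charts A" "\<gamma> s \<in> cdom c" and ev: "\<forall>\<^sub>F r in nhds s. \<gamma> r \<in> cdom c"
    and diff: "(\<lambda>r. coord c (\<gamma> r)) differentiable (at s)" using \<gamma> by (auto simp: curve_at_def)
  obtain S where S: "open S" "s \<in> S" "\<And>r. r \<in> S \<Longrightarrow> \<gamma> r \<in> cdom c" using ev by (auto simp: eventually_nhds)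
  let ?v = "vector_derivative (\<lambda>r. coord c (\<gamma> r)) (at s)"
  have v: "((\<lambda>r. coord c (\<gamma> r)) has_derivative (\<lambda>h. h *\<^sub>R ?v)) (at s)"
    using diff by (simp add: vector_derivative_works has_vector_derivative_def)
  have *: "((\<lambda>r. g (\<gamma> r)) has_vector_derivative
    fderiv (\<lambda>x. g (param c x)) (coord c (\<gamma> s)) ?v) (at s)"
    if g: "msmooth A g (\<gamma> s)" for g :: "'a \<Rightarrow> 'z::euclidean_space"
  proof -
    have sm: "smooth_at (\<lambda>x. g (param c x)) (coord c (\<gamma> s))"
      using g unfolding msmooth_chart[OF c] .
    interpret linear "fderiv (\<lambda>x. g (param c x)) (coord c (\<gamma> s))"
      by (intro smooth_at_linear sm)
    have "((\<lambda>r. g (\<gamma> r)) has_derivative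
      (fderiv (\<lambda>x. g (param c x)) (coord c (\<gamma> s)) \<circ> (\<lambda>h. h *\<^sub>R ?v))) (at s)"
      by (rule has_derivative_transform_within_open[OF diff_chain_at[OF v smooth_at_has_derivative[OF sm]] S(1,2)])
        (simp add: param_chart[OF c(1)] S(3))
    then show ?thesis by (simp add: has_vector_derivative_def comp_def scaleR)
  qed
  have "velocity A \<gamma> s d = fderiv (coord d \<circ> param c) (coord c (\<gamma> s)) ?v"
    using vector_derivative_at[OF *[OF msmooth_coord[OF d]]] d by (simp add: velocity_def comp_def)
  then show ?thesis using *[OF f] deriv_chart_change[OF c d f] by simp
qed

lemma velocity_coord:
  assumes "curve_at A \<gamma> s" "d \<in> charts A" "\<gamma> s \<in> cdom d"
  shows "((\<lambda>r. coord d (\<gamma> r)) has_vector_derivative velocity A \<gamma> s d) (at s)"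
  using curve_at_compose[OF assms msmooth_coord[OF assms(2,3)]] deriv_transition_self[OF assms(2,3)]
  by (simp add: comp_def)

lemma velocity_tangent:
  assumes "curve_at A \<gamma> s" shows "velocity A \<gamma> s \<in> tangent_space A (\<gamma> s)"
  unfolding tangent_space_def
proof safe
  fix c d assume "c \<in> charts A" "d \<in> charts A" "\<gamma> s \<in> cdom c" "\<gamma> s \<in> cdom d"
  with vector_derivative_at[OF curve_at_compose[OF assms, of c "coord d"]] msmooth_coord[of d]
  show "velocity A \<gamma> s d = fderiv (coord d \<circ> param c) (coord c (\<gamma> s)) (velocity A \<gamma> s c)"
    by (simp add: velocity_def comp_def)
qed (auto simp: velocity_def split: if_splits)

lemma smooth_map_msmooth:
  assumes f: "smooth_map A B f" and p: "p \<in> carrier A" and d: "d \<in> B" "f p \<in> cdom d"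
  shows "msmooth A (\<lambda>q. coord d (f q)) p" "\<forall>\<^sub>F q in mnhds A p. f q \<in> cdom d"
proof -
  obtain c where c: "c \<in> A" "p \<in> cdom c" using carrier_chart p by blast
  have o: "open (coord c ` (cdom c \<inter> f -` cdom d))"
    and s: "smooth_on (coord c ` (cdom c \<inter> f -` cdom d)) (coord d \<circ> f \<circ> param c)"
    using f c d by (auto simp: smooth_map_def)
  show "msmooth A (\<lambda>q. coord d (f q)) p"
    unfolding msmooth_chart[OF in_charts[OF c(1)] c(2)]
    using smooth_onD[OF s o, of "coord c p"] c d by (auto simp: comp_def)
  show "\<forall>\<^sub>F q in mnhds A p. f q \<in> cdom d"
    using eventually_param[OF is_chart[OF c(1)] o, of p] c d
    unfolding eventually_mnhds[OF in_charts[OF c(1)] c(2)] by (auto elim: eventually_mono)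
qed

lemma smooth_map_curve_at:
  assumes "smooth_map (restrict_atlas euclidean_atlas I) A \<gamma>" "open I" "s \<in> I"
  shows "curve_at A \<gamma> s"
proof -
  let ?i = "(I, \<lambda>x. x) :: (real, real) chart"
  have I: "restrict_atlas euclidean_atlas I = {?i}"
    by (auto simp: restrict_atlas_def euclidean_atlas_def)
  have car: "carrier {?i} = I" by (auto simp: carrier_def)
  have "\<gamma> s \<in> carrier A" using assms unfolding smooth_map_def I car by auto
  then obtain c where c: "c \<in> A" "\<gamma> s \<in> cdom c" using carrier_chart by blast
  have *: "open (I \<inter> \<gamma> -` cdom c)" "smooth_on (I \<inter> \<gamma> -` cdom c) (coord c \<circ> \<gamma> \<circ> param ?i)"
    using assms(1) c unfolding smooth_map_def I by auto
  have "smooth_at (coord c \<circ> \<gamma> \<circ> param ?i) s"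
    by (rule smooth_onD[OF *(2,1)]) (use assms c in auto)
  then have "smooth_at (\<lambda>r. coord c (\<gamma> r)) s"
  proof (rule smooth_at_cong)
    show "\<forall>\<^sub>F r in nhds s. (coord c \<circ> \<gamma> \<circ> param ?i) r = coord c (\<gamma> r)"
      using eventually_nhds_in_open[OF assms(2,3)]
      by eventually_elim (metis comp_apply f_inv_into_f fst_conv image_ident snd_conv)
  qed
  moreover have "\<forall>\<^sub>F r in nhds s. \<gamma> r \<in> cdom c"
    using eventually_nhds_in_open[OF *(1), of s] assms c by (auto elim!: eventually_mono)
  ultimately show ?thesis
    unfolding curve_at_def
    by (intro bexI[of _ c] conjI smooth_at_differentiable c(2) in_charts[OF c(1)])
qed

text \<open>One chart around each point is enough: components in another chart are the derivative of
  the transition map applied to the given ones, smooth in base point and direction.\<close>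

lemma vector_fieldI:
  assumes "\<And>p. p \<in> carrier A \<Longrightarrow> Z p \<in> tangent_space A p"
    "\<And>p. p \<in> carrier A \<Longrightarrow> \<exists>c\<in>charts A. p \<in> cdom c \<and> msmooth A (\<lambda>q. Z q c) p"
  shows "vector_field A Z"
  unfolding vector_field_def
proof safe
  fix d assume d: "d \<in> charts A"
  have "open (coord d ` cdom d)" using charts_is_chart[OF d] by (simp add: is_chart_def)
  then show "smooth_on (coord d ` cdom d) (\<lambda>x. Z (param d x) d)"
    unfolding smooth_on_iff_smooth_at[OF \<open>open _\<close>]
  proof safe
    fix p assume p: "p \<in> cdom d"
    obtain c where c: "c \<in> charts A" "p \<in> cdom c" and Z: "msmooth A (\<lambda>q. Z q c) p"
      using assms(2) charts_carrier[OF d p] by blast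
    have "smooth_at (\<lambda>x. fderiv (coord d \<circ> param c) (coord c (param d x)) (Z (param d x) c)) (coord d p)"
    proof (rule smooth_at_frechet)
      show "smooth_at (coord d \<circ> param c) (coord c (param d (coord d p)))"
        using transition_smooth_at[OF c(1) d c(2) p] by (simp add: param_chart[OF d] p)
      show "smooth_at (\<lambda>x. coord c (param d x)) (coord d p)"
        using msmooth_coord[OF c] unfolding msmooth_chart[OF d p] .
      show "smooth_at (\<lambda>x. Z (param d x) c) (coord d p)"
        using Z unfolding msmooth_chart[OF d p] .
    qed
    then show "smooth_at (\<lambda>x. Z (param d x) d) (coord d p)"
    proof (rule smooth_at_cong)
      have "\<forall>\<^sub>F q in mnhds A p. fderiv (coord d \<circ> param c) (coord c q) (Z q c) = Z q d"
        using eventually_in_chart[OF c] eventually_in_chart[OF d p]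
        by eventually_elim (simp add: tangent_change[OF assms(1) c(1) _ d] charts_carrier[OF d])
      then show "\<forall>\<^sub>F x in nhds (coord d p). fderiv (coord d \<circ> param c) (coord c (param d x))
          (Z (param d x) c) = Z (param d x) d"
        unfolding eventually_mnhds[OF d p] .
    qed
  qed
qed (use assms in auto)

lemma vector_field_msmooth:
  assumes "vector_field A Z" "c \<in> charts A" "p \<in> cdom c"
  shows "msmooth A (\<lambda>q. Z q c) p"
  unfolding msmooth_chart[OF assms(2,3)]
  using assms charts_is_chart[OF assms(2)]
  by (auto simp: vector_field_def is_chart_def intro!: smooth_onD[where S = "coord c ` cdom c"])

lemma coord_vector_lincomb:
  assumes "c \<in> charts A" "p \<in> cdom c"
  shows "coord_vector A c p (r *\<^sub>R x + s *\<^sub>R y) =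
    (\<lambda>d. r *\<^sub>R coord_vector A c p x d + s *\<^sub>R coord_vector A c p y d)"
proof
  fix d
  show "coord_vector A c p (r *\<^sub>R x + s *\<^sub>R y) d = r *\<^sub>R coord_vector A c p x d + s *\<^sub>R coord_vector A c p y d"
  proof (cases "d \<in> charts A \<and> p \<in> cdom d")
    case True
    then have "linear (fderiv (coord d \<circ> param c) (coord c p))"
      by (intro smooth_at_linear transition_smooth_at assms) auto
    then show ?thesis using True by (simp add: coord_vector_def linear_add linear_cmul)
  qed (auto simp: coord_vector_def)
qed

lemma tangent_lincomb:
  assumes "v \<in> tangent_space A p" "w \<in> tangent_space A p"
  shows "(\<lambda>c. r *\<^sub>R v c + s *\<^sub>R w c) \<in> tangent_space A p"
  using tangent_sum[of UNIV "\<lambda>i. if i then v else w" p "\<lambda>i. if i then r else s"] assms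
  by (simp add: UNIV_bool add.commute)

lemma curve_at_eventually:
  assumes \<gamma>: "curve_at A \<gamma> s" and d: "d \<in> charts A" "\<gamma> s \<in> cdom d"
  shows "\<forall>\<^sub>F r in nhds s. \<gamma> r \<in> cdom d"
proof -
  obtain c where c: "c \<in> charts A" "\<gamma> s \<in> cdom c" and ev: "\<forall>\<^sub>F r in nhds s. \<gamma> r \<in> cdom c"
    and diff: "(\<lambda>r. coord c (\<gamma> r)) differentiable (at s)" using \<gamma> by (auto simp: curve_at_def)
  have "((\<lambda>r. coord c (\<gamma> r)) \<longlongrightarrow> coord c (\<gamma> s)) (nhds s)"
    using differentiable_imp_continuous_within[OF diff] tendsto_at_iff_tendsto_nhds[of "\<lambda>r. coord c (\<gamma> r)" s]
    by (simp add: continuous_within)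
  then have "\<forall>\<^sub>F r in nhds s. param c (coord c (\<gamma> r)) \<in> cdom d"
    using eventually_in_chart[OF d] unfolding eventually_mnhds[OF c] filterlim_iff by blast
  with ev show ?thesis
    by eventually_elim (simp add: param_chart[OF c(1)])
qed

text \<open>Composition with a transition map of the target. The eventual condition is needed
  because \<open>param c\<close> undoes \<open>coord c\<close> only on the domain of
  \<open>c\<close>.\<close>

lemma msmooth_target_change:
  assumes B: "smooth_atlas B" and c: "c \<in> charts B" "f p \<in> cdom c" and d: "d \<in> charts B" "f p \<in> cdom d"
    and f: "msmooth A (\<lambda>q. coord c (f q)) p" and ev: "\<forall>\<^sub>F q in mnhds A p. f q \<in> cdom c"
  shows "msmooth A (\<lambda>q. coord d (f q)) p" "\<forall>\<^sub>F q in mnhds A p. f q \<in> cdom d"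
proof -
  interpret B: smooth_atlas B by (rule B)
  have a: "chart_at A p \<in> charts A" "p \<in> cdom (chart_at A p)" using f by (auto simp: msmooth_def)
  have "msmooth A (\<lambda>q. (coord d \<circ> param c) (coord c (f q))) p"
    by (rule msmooth_compose[OF f]) (rule B.transition_smooth_at[OF c(1) d(1) c(2) d(2)])
  then show "msmooth A (\<lambda>q. coord d (f q)) p"
    by (rule msmooth_cong) (use ev in eventually_elim, simp add: B.param_chart[OF c(1)])
  let ?g = "\<lambda>x. coord c (f (param (chart_at A p) x))" and ?x = "coord (chart_at A p) p"
  have g: "smooth_at ?g ?x" using f unfolding msmooth_chart[OF a] .
  have gx: "?g ?x = coord c (f p)" by (simp add: param_chart[OF a(1)] a)
  have "\<forall>\<^sub>F x in nhds ?x. param c (?g x) \<in> cdom d"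
    by (rule smooth_at_eventually_image[OF g], unfold gx)
      (use B.eventually_in_chart[OF d] in \<open>simp only: B.eventually_mnhds[OF c]\<close>)
  with ev show "\<forall>\<^sub>F q in mnhds A p. f q \<in> cdom d"
    unfolding eventually_mnhds[OF a]
    by eventually_elim (simp add: B.param_chart[OF c(1)])
qed

lemma tangent_map_tangent:
  assumes B: "smooth_atlas B" and f: "\<And>d. d \<in> charts B \<Longrightarrow> f p \<in> cdom d \<Longrightarrow> msmooth A (\<lambda>q. coord d (f q)) p"
    and ev: "\<And>d. d \<in> charts B \<Longrightarrow> f p \<in> cdom d \<Longrightarrow> \<forall>\<^sub>F q in mnhds A p. f q \<in> cdom d"
    and p: "p \<in> carrier A" and v: "v \<in> tangent_space A p"
  shows "tangent_map A B f p v \<in> tangent_space B (f p)"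
proof -
  interpret B: smooth_atlas B by (rule B)
  obtain a where a: "a \<in> charts A" "p \<in> cdom a" using p carrier_chart in_charts by blast
  show ?thesis
    unfolding tangent_space_def mem_Collect_eq
  proof (intro conjI ballI allI impI)
    fix c d assume cd: "c \<in> charts B" "d \<in> charts B" "f p \<in> cdom c" "f p \<in> cdom d"
    let ?g = "\<lambda>x. coord c (f (param a x))"
    have g: "smooth_at ?g (coord a p)" using f[OF cd(1,3)] unfolding msmooth_chart[OF a] .
    have gp: "?g (coord a p) = coord c (f p)" by (simp add: param_chart[OF a(1)] a)
    have "((coord d \<circ> param c) \<circ> ?g has_derivative fderiv (coord d \<circ> param c) (coord c (f p))
        \<circ> fderiv ?g (coord a p)) (at (coord a p))"
      by (rule diff_chain_at[OF smooth_at_has_derivative[OF g]], unfold gp,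
          rule smooth_at_has_derivative[OF B.transition_smooth_at[OF cd]])
    moreover have "\<forall>\<^sub>F x in nhds (coord a p). ((coord d \<circ> param c) \<circ> ?g) x = coord d (f (param a x))"
      using ev[OF cd(1,3)] unfolding eventually_mnhds[OF a]
      by eventually_elim (simp add: B.param_chart[OF cd(1)])
    ultimately have "((\<lambda>x. coord d (f (param a x))) has_derivative fderiv (coord d \<circ> param c) (coord c (f p))
        \<circ> fderiv ?g (coord a p)) (at (coord a p))"
      by (rule has_derivative_cong_nhds)
    then show "tangent_map A B f p v d =
        fderiv (coord d \<circ> param c) (coord c (f p)) (tangent_map A B f p v c)"
      using tangent_map_chart[OF a cd(1,3) f[OF cd(1,3)] v] tangent_map_chart[OF a cd(2,4) f[OF cd(2,4)] v]
      by (simp add: frechet_derivativeI)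
  qed (auto simp: tangent_map_def)
qed

text \<open>\<open>tangent_to\<close> quantifies over all slice charts; this reduces it to one. In
  \<open>c\<close> the straight line through p with direction \<open>v c\<close> stays in S, so near
  p it runs inside N. Seen in \<open>d\<close> it is a curve in S' with velocity
  \<open>v d\<close>.\<close>

lemma slice_tangent:
  assumes c: "slice_chart A N c S" "p \<in> cdom c" and d: "slice_chart A N d S'" "p \<in> cdom d"
    and p: "p \<in> N" and v: "v \<in> tangent_space A p" "v c \<in> S"
  shows "v d \<in> S'"
proof -
  have ch: "c \<in> charts A" "d \<in> charts A" and S: "subspace S" "subspace S'"
    and cS: "coord c ` (cdom c \<inter> N) = coord c ` cdom c \<inter> S"
    and dS: "coord d ` (cdom d \<inter> N) = coord d ` cdom d \<inter> S'"
    using c d by (auto simp: slice_chart_def)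
  note cc = charts_is_chart[OF ch(1)]
  let ?x = "coord c p" and ?l = "\<lambda>r::real. coord c p + r *\<^sub>R v c"
  have x: "?x \<in> S" using cS c(2) p by blast
  have l0: "?l 0 = ?x" by simp
  have l: "(?l has_derivative (\<lambda>r. r *\<^sub>R v c)) (at 0)" by (auto intro!: derivative_eq_intros)
  have sl: "smooth_at ?l 0" by (intro smooth_at_intros)
  have der: "((coord d \<circ> param c) has_derivative fderiv (coord d \<circ> param c) ?x) (at (?l 0))"
    unfolding l0 by (rule smooth_at_has_derivative[OF transition_smooth_at[OF ch c(2) d(2)]])
  interpret T: linear "fderiv (coord d \<circ> param c) ?x"
    by (intro smooth_at_linear transition_smooth_at ch c(2) d(2))
  have "fderiv (coord d \<circ> param c) ?x \<circ> (\<lambda>r. r *\<^sub>R v c) = (\<lambda>r. r *\<^sub>R v d)"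
    using tangent_change[OF v(1) ch(1) c(2) ch(2) d(2)] by (simp add: fun_eq_iff T.scaleR)
  with diff_chain_at[OF l der]
  have "((coord d \<circ> param c) \<circ> ?l has_vector_derivative v d) (at 0)"
    by (simp only: has_vector_derivative_def)
  moreover have "\<forall>\<^sub>F r in nhds 0. ((coord d \<circ> param c) \<circ> ?l) r \<in> S'"
  proof -
    have "\<forall>\<^sub>F r in nhds 0. ?l r \<in> coord c ` (cdom c \<inter> cdom d) \<and> param c (?l r) \<in> cdom c \<and> param c (?l r) \<in> cdom d"
      by (rule smooth_at_eventually_image[OF sl], unfold l0,
          rule smooth_transitionD(2)[OF charts_transition[OF ch] cc c(2) d(2)])
    then show ?thesis
    proof eventually_elim
      case (elim r)
      have "?l r \<in> S" using x v(2) S(1) by (intro subspace_add subspace_scale)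
      then have "?l r \<in> coord c ` (cdom c \<inter> N)" unfolding cS using elim by blast
      then have "param c (?l r) \<in> N" using param_coord[OF cc] by auto
      then have "coord d (param c (?l r)) \<in> coord d ` (cdom d \<inter> N)" using elim by blast
      then show ?case unfolding dS by simp
    qed
  qed
  ultimately show ?thesis using vector_derivative_in_subspace[OF _ S(2)] by blast
qed

lemma zero_tangent: "(\<lambda>c. 0) \<in> tangent_space A p"
  using tangent_sum[of "{}" "\<lambda>_ _. 0" p "\<lambda>_. 0"] by simp

lemma tangent_scale: "v \<in> tangent_space A p \<Longrightarrow> (\<lambda>c. r *\<^sub>R v c) \<in> tangent_space A p"
  using tangent_lincomb[of v p v r 0] by simp

end

subsection \<open>Bump functions and countable covers\<close>

lemma manifold_smooth_atlas: "manifold A \<Longrightarrow> smooth_atlas A"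
  by (auto simp: manifold_def smooth_atlas_def)

text \<open>Compact sets are closed in a Hausdorff space. This is what makes the extension of a bump
  function by zero smooth at the boundary of a chart domain.\<close>

lemma closed_chart_image:
  assumes A: "manifold A" and c: "c \<in> charts A" and K: "compact K" "K \<subseteq> coord c ` cdom c"
  shows "open_in A (carrier A - param c ` K)"
proof -
  interpret smooth_atlas A by (rule manifold_smooth_atlas[OF A])
  let ?X = "topology (open_in A)"
  have "continuous_map (top_of_set (coord c ` cdom c)) ?X (param c)"
    unfolding continuous_map_def
  proof (intro conjI allI impI)
    show "param c \<in> topspace (top_of_set (coord c ` cdom c)) \<rightarrow> topspace ?X"
      using charts_carrier[OF c] param_chart[OF c] by (auto simp: topspace_open_in)
    fix U assume "openin ?X U"
    then have "open (coord c ` (U \<inter> cdom c))"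
      by (intro open_image_chart c eventually_open_in) (simp_all add: openin_iff)
    moreover have "{x \<in> topspace (top_of_set (coord c ` cdom c)). param c x \<in> U} = coord c ` (U \<inter> cdom c)"
      by (auto simp: param_chart[OF c])
    ultimately show "openin (top_of_set (coord c ` cdom c)) {x \<in> topspace (top_of_set (coord c ` cdom c)). param c x \<in> U}"
      by (auto intro!: open_openin_trans charts_is_chart[OF c, unfolded is_chart_def, THEN conjunct2])
  qed
  then have "compactin ?X (param c ` K)"
    using K by (intro image_compactin) (auto simp: compactin_subtopology)
  then have "closedin ?X (param c ` K)"
    using A by (intro compactin_imp_closedin) (auto simp: manifold_def)
  then show ?thesis by (simp add: closedin_def topspace_open_in openin_iff)
qed

lemma manifold_bump:
  assumes A: "manifold A" and c: "c \<in> charts A" and p: "p \<in> cdom c"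
  obtains \<psi> :: "'a \<Rightarrow> real" and V where "open_in A V" "p \<in> V" "\<And>q. q \<in> V \<Longrightarrow> \<psi> q = 1"
    "\<And>q. q \<in> carrier A \<Longrightarrow> msmooth A \<psi> q"
    "\<And>q. q \<in> carrier A \<Longrightarrow> q \<notin> cdom c \<Longrightarrow> \<forall>\<^sub>F r in mnhds A q. \<psi> r = 0"
proof -
  interpret smooth_atlas A by (rule manifold_smooth_atlas[OF A])
  note cc = charts_is_chart[OF c]
  have "open (coord c ` cdom c)" using cc by (simp add: is_chart_def)
  then obtain R where R: "R > 0" "cball (coord c p) R \<subseteq> coord c ` cdom c"
    using p open_contains_cball by (metis image_eqI)
  obtain b where b: "\<And>y. smooth_at b y" "\<And>y. dist y (coord c p) \<le> R / 2 \<Longrightarrow> b y = (1::real)"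
    "\<And>y. dist y (coord c p) \<ge> R \<Longrightarrow> b y = 0"
    using bump_function[of "R / 2" R "coord c p"] R(1) by auto
  define \<psi> where "\<psi> q = (if q \<in> cdom c then b (coord c q) else 0)" for q
  define V where "V = {q \<in> cdom c. dist (coord c q) (coord c p) < R / 2}"
  have out: "\<forall>\<^sub>F r in mnhds A q. \<psi> r = 0" if q: "q \<in> carrier A" "q \<notin> cdom c" for q
  proof -
    \<comment> \<open>The function is supported in the image of the closed ball, whose complement is
      an open neighbourhood of \<open>q\<close>.\<close>
    have "q \<in> carrier A - param c ` cball (coord c p) R"
      using q R(2) param_in[of _ c "cdom c"] by auto
    with closed_chart_image[OF A c _ R(2)] have "\<forall>\<^sub>F r in mnhds A q. r \<in> carrier A - param c ` cball (coord c p) R"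
      by (intro eventually_open_in) auto
    then show ?thesis
    proof eventually_elim
      case (elim r)
      have "dist (coord c r) (coord c p) \<ge> R" if "r \<in> cdom c"
      proof (rule ccontr)
        assume "\<not> ?thesis"
        then have "coord c r \<in> cball (coord c p) R" by (simp add: dist_commute)
        then have "param c (coord c r) \<in> param c ` cball (coord c p) R" by blast
        then show False using elim that by (simp add: param_coord[OF cc])
      qed
      then show ?case by (simp add: \<psi>_def b)
    qed
  qed
  show thesis
  proof
    show "open_in A V"
    proof (rule open_inI)
      show "V \<subseteq> carrier A" using charts_carrier[OF c] by (auto simp: V_def)
      fix q assume "q \<in> V"
      then have q: "q \<in> cdom c" "coord c q \<in> ball (coord c p) (R / 2)"
        by (auto simp: V_def dist_commute)
      have "\<forall>\<^sub>F x in nhds (coord c q). x \<in> ball (coord c p) (R / 2)"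
        by (rule eventually_nhds_in_open[OF open_ball q(2)])
      with eventually_nhds_chart[OF cc q(1)] show "\<forall>\<^sub>F r in mnhds A q. r \<in> V"
        unfolding eventually_mnhds[OF c q(1)]
        by eventually_elim (auto simp: V_def dist_commute)
    qed
    show "p \<in> V" using p R by (simp add: V_def)
    show "\<psi> q = 1" if "q \<in> V" for q using that by (auto simp: \<psi>_def V_def b)
    show "msmooth A \<psi> q" if "q \<in> carrier A" for q
    proof (cases "q \<in> cdom c")
      case True
      have "msmooth A (\<lambda>q. b (coord c q)) q" by (rule msmooth_compose[OF msmooth_coord[OF c True] b(1)])
      then show ?thesis
        by (rule msmooth_cong)
          (use eventually_in_chart[OF c True] in \<open>auto simp: \<psi>_def elim!: eventually_mono\<close>)
    next
      case False
      show ?thesis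
        by (rule msmooth_cong[OF msmooth_const[OF that, of 0]])
          (use out[OF that False] in \<open>auto elim: eventually_mono\<close>)
    qed
  qed (rule out)
qed

text \<open>The Lindeloef property: countably many basic sets fit into some member of the family and
  already cover its union; one index is chosen for each of them.\<close>

lemma manifold_countable_subcover:
  assumes A: "manifold A" and V: "\<And>i. i \<in> I \<Longrightarrow> open_in A (V i)"
  obtains J where "countable J" "J \<subseteq> I" "(\<Union>i\<in>I. V i) = (\<Union>i\<in>J. V i)"
proof -
  interpret smooth_atlas A by (rule manifold_smooth_atlas[OF A])
  obtain B where B: "countable B" "\<And>U x. open_in A U \<Longrightarrow> x \<in> U \<Longrightarrow> \<exists>W\<in>B. x \<in> W \<and> W \<subseteq> U"
    using A unfolding manifold_def second_countable_def openin_iff by auto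
  define B' where "B' = {W \<in> B. \<exists>i\<in>I. W \<subseteq> V i}"
  define g where "g W = (SOME i. i \<in> I \<and> W \<subseteq> V i)" for W
  have g: "g W \<in> I \<and> W \<subseteq> V (g W)" if "W \<in> B'" for W
  proof -
    have "\<exists>i. i \<in> I \<and> W \<subseteq> V i" using that by (auto simp: B'_def)
    then show ?thesis unfolding g_def by (rule someI_ex)
  qed
  show thesis
  proof
    show "countable (g ` B')" using B(1) by (auto simp: B'_def)
    show "g ` B' \<subseteq> I" using g by blast
    have "x \<in> (\<Union>i\<in>g ` B'. V i)" if i: "i \<in> I" "x \<in> V i" for i x
    proof -
      obtain W where W: "W \<in> B" "x \<in> W" "W \<subseteq> V i" using B(2)[OF V[OF i(1)] i(2)] by blast
      then have "W \<in> B'" using i by (auto simp: B'_def)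
      then show ?thesis using g W(2) by blast
    qed
    then show "(\<Union>i\<in>I. V i) = (\<Union>i\<in>g ` B'. V i)" using g by blast
  qed
qed

section \<open>The cotangent bundle\<close>

context smooth_atlas
begin

definition cot_components :: "('a, 'x) chart \<Rightarrow> 'a \<Rightarrow> ('a, 'x) covector \<Rightarrow> 'x" where
  "cot_components c p \<alpha> = (\<Sum>b\<in>Basis. \<alpha> (coord_vector A c p b) *\<^sub>R b)"

text \<open>The value 0 off the tangent space is the normalization built into
  \<open>cotangent_space\<close>; without it covectors with equal components would differ as
  functions.\<close>

definition cot_of :: "('a, 'x) chart \<Rightarrow> 'a \<Rightarrow> 'x \<Rightarrow> ('a, 'x) covector" where
  "cot_of c p \<xi> = (\<lambda>v. if v \<in> tangent_space A p then \<xi> \<bullet> v c else 0)"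

lemma cot_components:
  assumes \<alpha>: "\<alpha> \<in> cotangent_space A p" and c: "c \<in> charts A" "p \<in> cdom c"
  shows "\<alpha> (coord_vector A c p x) = cot_components c p \<alpha> \<bullet> x"
proof -
  let ?h = "\<lambda>x. \<alpha> (coord_vector A c p x)"
  have lin: "?h (r *\<^sub>R x + s *\<^sub>R y) = r * ?h x + s * ?h y" for r s x y
    using \<alpha> coord_vector_tangent[OF c] unfolding coord_vector_lincomb[OF c] cotangent_space_def by blast
  have "linear ?h"
  proof (rule linearI)
    show "?h (x + y) = ?h x + ?h y" for x y using lin[of 1 x 1 y] by simp
    show "?h (r *\<^sub>R x) = r *\<^sub>R ?h x" for r x using lin[of r x 0 x] by simp
  qed
  then interpret linear ?h .
  have "?h (\<Sum>b\<in>Basis. (x \<bullet> b) *\<^sub>R b) = cot_components c p \<alpha> \<bullet> x"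
    unfolding sum scaleR cot_components_def inner_sum_left inner_scaleR_left
    by (intro sum.cong) (simp_all add: inner_commute mult.commute)
  then show ?thesis by (simp add: euclidean_representation)
qed

lemma cot_apply:
  assumes "\<alpha> \<in> cotangent_space A p" "c \<in> charts A" "p \<in> cdom c" "v \<in> tangent_space A p"
  shows "\<alpha> v = cot_components c p \<alpha> \<bullet> v c"
  using cot_components[OF assms(1-3), of "v c"] tangent_coord[OF assms(4,2,3)] by simp

lemma cot_components_unique:
  assumes \<alpha>: "\<alpha> \<in> cotangent_space A p" and c: "c \<in> charts A" "p \<in> cdom c"
    and \<xi>: "\<And>x. \<alpha> (coord_vector A c p x) = \<xi> \<bullet> x"
  shows "cot_components c p \<alpha> = \<xi>"
  by (rule euclidean_eqI) (use cot_components[OF \<alpha> c] \<xi> in metis)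

lemma cot_of_in: "c \<in> charts A \<Longrightarrow> p \<in> cdom c \<Longrightarrow> cot_of c p \<xi> \<in> cotangent_space A p"
  by (simp add: cotangent_space_def cot_of_def tangent_lincomb inner_add_right)

lemma cot_components_cot_of:
  assumes "c \<in> charts A" "p \<in> cdom c" shows "cot_components c p (cot_of c p \<xi>) = \<xi>"
  by (rule cot_components_unique[OF cot_of_in])
    (use assms in \<open>simp_all add: cot_of_def coord_vector_tangent coord_vector_self\<close>)

lemma cot_of_cot_components:
  assumes "\<alpha> \<in> cotangent_space A p" "c \<in> charts A" "p \<in> cdom c"
  shows "cot_of c p (cot_components c p \<alpha>) = \<alpha>"
proof
  fix v show "cot_of c p (cot_components c p \<alpha>) v = \<alpha> v"
    using cot_apply[OF assms, of v] assms(1) by (simp add: cot_of_def cotangent_space_def)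
qed

lemma cotangent_chart_simps:
  "z \<in> cdom (cotangent_chart A c) \<longleftrightarrow> fst z \<in> cdom c \<and> snd z \<in> cotangent_space A (fst z)"
  "coord (cotangent_chart A c) z = (coord c (fst z), cot_components c (fst z) (snd z))"
  by (simp_all add: cotangent_chart_def cot_components_def case_prod_unfold)

lemma cotangent_chart_image:
  assumes c: "c \<in> charts A" shows "coord (cotangent_chart A c) ` cdom (cotangent_chart A c) = coord c ` cdom c \<times> UNIV"
proof safe
  fix p x \<xi> assume p: "p \<in> cdom c"
  have "coord (cotangent_chart A c) (p, cot_of c p \<xi>) = (coord c p, \<xi>)"
    by (simp add: cotangent_chart_simps cot_components_cot_of[OF c p])
  moreover have "(p, cot_of c p \<xi>) \<in> cdom (cotangent_chart A c)"
    by (simp add: cotangent_chart_simps p cot_of_in[OF c p])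
  ultimately show "(coord c p, \<xi>) \<in> coord (cotangent_chart A c) ` cdom (cotangent_chart A c)"
    by (metis image_eqI)
qed (auto simp: cotangent_chart_simps)

lemma cotangent_chart_is_chart:
  assumes c: "c \<in> charts A" shows "is_chart (cotangent_chart A c)"
  unfolding is_chart_def cotangent_chart_image[OF c]
proof
  show "inj_on (coord (cotangent_chart A c)) (cdom (cotangent_chart A c))"
  proof (rule inj_onI)
    fix z z' assume z: "z \<in> cdom (cotangent_chart A c)" "z' \<in> cdom (cotangent_chart A c)"
      "coord (cotangent_chart A c) z = coord (cotangent_chart A c) z'"
    have "fst z = fst z'"
      using z charts_is_chart[OF c] by (auto simp: cotangent_chart_simps is_chart_def dest: inj_onD)
    moreover have "snd z = snd z'"
      using z cot_of_cot_components[OF _ c, of "snd z" "fst z"] cot_of_cot_components[OF _ c, of "snd z'" "fst z"]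
        calculation by (simp add: cotangent_chart_simps)
    ultimately show "z = z'" by (rule prod_eqI)
  qed
  show "open (coord c ` cdom c \<times> (UNIV :: 'x set))"
    using charts_is_chart[OF c] by (simp add: is_chart_def open_Times)
qed

lemma param_cotangent_chart:
  assumes c: "c \<in> charts A" "x \<in> coord c ` cdom c"
  shows "param (cotangent_chart A c) (x, \<xi>) = (param c x, cot_of c (param c x) \<xi>)"
proof -
  have p: "param c x \<in> cdom c" "coord c (param c x) = x"
    by (rule param_in[OF c(2) subset_refl], rule coord_param[OF c(2) subset_refl])
  have "(param c x, cot_of c (param c x) \<xi>) \<in> cdom (cotangent_chart A c)"
    by (simp add: cotangent_chart_simps p cot_of_in[OF c(1) p(1)])
  from param_coord[OF cotangent_chart_is_chart[OF c(1)] this]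
  show ?thesis by (simp add: cotangent_chart_simps p cot_components_cot_of[OF c(1) p(1)])
qed

text \<open>Both sides evaluate the covector on the same tangent vector, read once in
  \<open>c\<close> and once in \<open>d\<close>.\<close>

lemma cot_components_change:
  assumes c: "c \<in> charts A" "p \<in> cdom c" and d: "d \<in> charts A" "p \<in> cdom d"
    and \<alpha>: "\<alpha> \<in> cotangent_space A p"
  shows "cot_components c p \<alpha> \<bullet> x =
    cot_components d p \<alpha> \<bullet> fderiv (coord d \<circ> param c) (coord c p) x"
  using cot_apply[OF \<alpha> c coord_vector_tangent[OF c]] cot_apply[OF \<alpha> d coord_vector_tangent[OF c], of x]
  by (simp add: coord_vector_self[OF c]) (simp add: coord_vector_def d)

lemma cotangent_transition:
  assumes c: "c \<in> charts A" and d: "d \<in> charts A"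
  shows "smooth_transition (cotangent_chart A c) (cotangent_chart A d)" (is "smooth_transition ?c ?d")
proof (rule smooth_transitionI)
  fix z assume z: "z \<in> cdom ?c" "z \<in> cdom ?d"
  let ?p = "fst z"
  have p: "?p \<in> cdom c" "?p \<in> cdom d" and \<alpha>: "snd z \<in> cotangent_space A ?p"
    using z by (auto simp: cotangent_chart_simps)
  have cz: "coord ?c z = (coord c ?p, cot_components c ?p (snd z))" by (simp add: cotangent_chart_simps)
  have "\<forall>\<^sub>F x in nhds (coord c ?p). x \<in> coord c ` cdom c \<and> param c x \<in> cdom c \<and> param c x \<in> cdom d"
    using smooth_transitionD(2)[OF charts_transition[OF c d] charts_is_chart[OF c] p]
    by (auto elim!: eventually_mono)
  from smooth_at_eventually_image[OF smooth_at_fst[OF smooth_at_ident], of _ "coord ?c z"] this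
  have ev: "\<forall>\<^sub>F y in nhds (coord ?c z). fst y \<in> coord c ` cdom c \<and> param c (fst y) \<in> cdom c \<and> param c (fst y) \<in> cdom d"
    by (simp add: cz)
  then show "\<forall>\<^sub>F y in nhds (coord ?c z). y \<in> coord ?c ` (cdom ?c \<inter> cdom ?d)"
  proof eventually_elim
    case (elim y)
    have y: "y \<in> coord ?c ` cdom ?c" unfolding cotangent_chart_image[OF c] using elim by (simp add: mem_Times_iff)
    have "param ?c y \<in> cdom ?d"
      using param_cotangent_chart[OF c, of "fst y" "snd y"] elim
      by (simp add: cotangent_chart_simps cot_of_in[OF c])
    then show ?case
      by (intro rev_image_eqI[OF IntI[OF inv_into_into[OF y]]] f_inv_into_f[OF y, symmetric])
  qed
  let ?\<tau> = "coord d \<circ> param c" and ?\<sigma> = "coord c \<circ> param d"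
  \<comment> \<open>Covector components are paired with the derivative of the inverse transition
    \<open>?\<sigma>\<close>, taken at the new base point.\<close>
  let ?T = "\<lambda>y. (?\<tau> (fst y), \<Sum>b\<in>Basis. (snd y \<bullet> fderiv ?\<sigma> (?\<tau> (fst y)) b) *\<^sub>R b)"
  have \<tau>: "smooth_at ?\<tau> (fst (coord ?c z))"
    using transition_smooth_at[OF c d p] by (simp add: cz)
  have \<tau>': "smooth_at (\<lambda>y. ?\<tau> (fst y)) (coord ?c z)"
    by (rule smooth_at_compose[of ?\<tau>, OF \<tau> smooth_at_fst[OF smooth_at_ident]])
  have \<sigma>: "smooth_at ?\<sigma> (?\<tau> (fst (coord ?c z)))"
    using transition_smooth_at[OF d c p(2,1)] by (simp add: cz param_chart[OF c] p)
  have "smooth_at ?T (coord ?c z)"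
    by (intro smooth_at_Pair \<tau>' smooth_at_sum smooth_at_scaleR smooth_at_inner smooth_at_snd
        smooth_at_ident smooth_at_const smooth_at_frechet[of ?\<sigma>] \<sigma>)
  then show "smooth_at (coord ?d \<circ> param ?c) (coord ?c z)"
  proof (rule smooth_at_cong)
    from ev show "\<forall>\<^sub>F y in nhds (coord ?c z). ?T y = (coord ?d \<circ> param ?c) y"
    proof eventually_elim
      case (elim y)
      let ?q = "param c (fst y)"
      have "cot_components d ?q (cot_of c ?q (snd y)) \<bullet> b = snd y \<bullet> fderiv ?\<sigma> (?\<tau> (fst y)) b" for b
        using cot_components_change[OF d _ c _ cot_of_in[OF c], of ?q "snd y" b] elim
        by (simp add: cot_components_cot_of[OF c])
      then have "cot_components d ?q (cot_of c ?q (snd y)) = (\<Sum>b\<in>Basis. (snd y \<bullet> fderiv ?\<sigma> (?\<tau> (fst y)) b) *\<^sub>R b)"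
        using euclidean_representation[of "cot_components d ?q (cot_of c ?q (snd y))"] by simp
      then show ?case
        using param_cotangent_chart[OF c, of "fst y" "snd y"] elim
        by (simp add: cotangent_chart_simps)
    qed
  qed
qed

lemma cotangent_atlas: "smooth_atlas (cotangent_bundle A)"
  by unfold_locales (auto simp: cotangent_bundle_def compatible_def
      intro: cotangent_chart_is_chart cotangent_transition)

lemma cotangent_chart_in: "c \<in> charts A \<Longrightarrow> cotangent_chart A c \<in> charts (cotangent_bundle A)"
  by (rule smooth_atlas.in_charts[OF cotangent_atlas]) (simp add: cotangent_bundle_def)

lemma carrier_cotangent_bundle:
  "z \<in> carrier (cotangent_bundle A) \<longleftrightarrow> fst z \<in> carrier A \<and> snd z \<in> cotangent_space A (fst z)"
proof
  assume "z \<in> carrier (cotangent_bundle A)"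
  then obtain c where "c \<in> charts A" "z \<in> cdom (cotangent_chart A c)"
    unfolding carrier_def cotangent_bundle_def by blast
  then show "fst z \<in> carrier A \<and> snd z \<in> cotangent_space A (fst z)"
    using charts_carrier by (auto simp: cotangent_chart_simps)
next
  assume z: "fst z \<in> carrier A \<and> snd z \<in> cotangent_space A (fst z)"
  then obtain c where c: "c \<in> A" "fst z \<in> cdom c" using carrier_chart by blast
  then have "z \<in> cdom (cotangent_chart A c)" using z by (simp add: cotangent_chart_simps)
  then show "z \<in> carrier (cotangent_bundle A)"
    using in_charts[OF c(1)] unfolding carrier_def cotangent_bundle_def by blast
qed

text \<open>The relation $\xi = (D\tau)^T \eta$ between the momenta in two charts is differentiated; the
  terms with second derivatives of $\tau$ cancel by symmetry.\<close>

lemma canonical_form_change: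
  assumes c: "c \<in> charts A" "fst z \<in> cdom c" and d: "d \<in> charts A" "fst z \<in> cdom d"
    and z: "snd z \<in> cotangent_space A (fst z)"
    and v: "v \<in> tangent_space (cotangent_bundle A) z" and w: "w \<in> tangent_space (cotangent_bundle A) z"
  defines "cc \<equiv> cotangent_chart A c" and "dd \<equiv> cotangent_chart A d"
  shows "fst (v cc) \<bullet> snd (w cc) - snd (v cc) \<bullet> fst (w cc) =
    fst (v dd) \<bullet> snd (w dd) - snd (v dd) \<bullet> fst (w dd)"
proof -
  interpret T: smooth_atlas "cotangent_bundle A" by (rule cotangent_atlas)
  let ?p = "fst z" and ?\<tau> = "coord d \<circ> param c" and ?T = "coord dd \<circ> param cc"
  let ?X = "coord cc z"
  let ?D2 = "\<lambda>u. fderiv (\<lambda>x. fderiv ?\<tau> x u) (fst ?X)"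
  have ch: "cc \<in> charts (cotangent_bundle A)" "dd \<in> charts (cotangent_bundle A)"
    using cotangent_chart_in c d by (auto simp: cc_def dd_def)
  have zin: "z \<in> cdom cc" "z \<in> cdom dd" using c d z by (auto simp: cc_def dd_def cotangent_chart_simps)
  have X: "fst ?X = coord c ?p" by (simp add: cc_def cotangent_chart_simps)
  have \<tau>: "smooth_at ?\<tau> (fst ?X)" unfolding X by (rule transition_smooth_at[OF c(1) d(1) c(2) d(2)])
  have T: "smooth_at ?T ?X" by (rule T.transition_smooth_at[OF ch zin])
  have TX: "?T ?X = coord dd z" by (simp add: T.param_chart[OF ch(1)] zin)
  have par: "coord cc (param cc Y) = Y" "param cc Y \<in> cdom cc" "param cc Y \<in> cdom dd"
    if "Y \<in> coord cc ` (cdom cc \<inter> cdom dd)" for Y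
    using that T.param_chart[OF ch(1)] by auto
  have ev: "\<forall>\<^sub>F Y in nhds ?X. Y \<in> coord cc ` (cdom cc \<inter> cdom dd)"
    using smooth_transitionD(2)[OF T.charts_transition[OF ch] T.charts_is_chart[OF ch(1)] zin]
    by (rule eventually_mono) simp
  have ev1: "\<forall>\<^sub>F Y in nhds ?X. ?\<tau> (fst Y) = fst (?T Y)"
    using ev
  proof eventually_elim
    case (elim Y)
    have "coord c (fst (param cc Y)) = fst Y" "fst (param cc Y) \<in> cdom c"
      using arg_cong[OF par(1)[OF elim], of fst] par(2)[OF elim] by (simp_all add: cc_def cotangent_chart_simps)
    then have "param c (fst Y) = fst (param cc Y)" using param_chart[OF c(1)] by metis
    then show ?case by (simp add: dd_def cotangent_chart_simps)
  qed
  \<comment> \<open>An identity on a whole neighbourhood, not only at \<open>?X\<close>, so that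
    both sides may be differentiated there.\<close>
  have ev2: "\<forall>\<^sub>F Y in nhds ?X. snd (?T Y) \<bullet> fderiv ?\<tau> (fst Y) u = snd Y \<bullet> u" for u
    using ev
  proof eventually_elim
    case (elim Y)
    let ?z = "param cc Y"
    have "coord c (fst ?z) = fst Y" "cot_components c (fst ?z) (snd ?z) = snd Y"
      using arg_cong[OF par(1)[OF elim], of fst] arg_cong[OF par(1)[OF elim], of snd]
      by (simp_all add: cc_def cotangent_chart_simps)
    moreover have "fst ?z \<in> cdom c" "fst ?z \<in> cdom d" "snd ?z \<in> cotangent_space A (fst ?z)"
      using par(2,3)[OF elim] by (simp_all add: cc_def dd_def cotangent_chart_simps)
    ultimately have *: "fst Y = coord c (fst ?z)" "snd Y = cot_components c (fst ?z) (snd ?z)" "fst ?z \<in> cdom c"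
      "fst ?z \<in> cdom d" "snd ?z \<in> cotangent_space A (fst ?z)" by simp_all
    show ?case
      using cot_components_change[OF c(1) *(3) d(1) *(4,5), of u]
      by (simp add: *(1,2) dd_def cotangent_chart_simps)
  qed
  have DT: "(?T has_derivative fderiv ?T ?X) (at ?X)"
    by (rule smooth_at_has_derivative[OF T])
  have fst_eq: "fst (fderiv ?T ?X Y) = fderiv ?\<tau> (fst ?X) (fst Y)" for Y
  proof -
    have "((\<lambda>Y. ?\<tau> (fst Y)) has_derivative (\<lambda>Y. fderiv ?\<tau> (fst ?X) (fst Y))) (at ?X)"
      using diff_chain_at[OF has_derivative_fst[OF has_derivative_ident] smooth_at_has_derivative[OF \<tau>]]
      by (simp add: comp_def)
    from has_derivative_cong_nhds[OF this ev1] has_derivative_fst[OF DT]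
    have "(\<lambda>Y. fderiv ?\<tau> (fst ?X) (fst Y)) = (\<lambda>Y. fst (fderiv ?T ?X Y))"
      by (rule has_derivative_unique)
    then show ?thesis by metis
  qed
  have snd_eq: "snd Y \<bullet> u = snd (fderiv ?T ?X Y) \<bullet> fderiv ?\<tau> (fst ?X) u
      + snd (?T ?X) \<bullet> ?D2 u (fst Y)" for Y u
  proof -
    have "((\<lambda>Y. fderiv ?\<tau> (fst Y) u) has_derivative (\<lambda>Y. ?D2 u (fst Y))) (at ?X)"
      using diff_chain_at[OF has_derivative_fst[OF has_derivative_ident]
          smooth_at_has_derivative[OF smooth_at_frechet_dir[OF \<tau>]], of u]
      by (simp add: comp_def)
    from has_derivative_inner[OF has_derivative_snd[OF DT] this]
    have "((\<lambda>Y. snd Y \<bullet> u) has_derivative (\<lambda>Y. snd (?T ?X) \<bullet> ?D2 u (fst Y) +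
        snd (fderiv ?T ?X Y) \<bullet> fderiv ?\<tau> (fst ?X) u)) (at ?X)"
      by (rule has_derivative_cong_nhds) (rule ev2)
    moreover have "((\<lambda>Y. snd Y \<bullet> u) has_derivative (\<lambda>Y. snd Y \<bullet> u)) (at ?X)"
      by (intro has_derivative_inner_left has_derivative_snd has_derivative_ident)
    ultimately have "(\<lambda>Y. snd (?T ?X) \<bullet> ?D2 u (fst Y) +
        snd (fderiv ?T ?X Y) \<bullet> fderiv ?\<tau> (fst ?X) u) = (\<lambda>Y. snd Y \<bullet> u)"
      by (rule has_derivative_unique)
    from fun_cong[OF this, of Y] show ?thesis by (simp only: add.commute)
  qed
  have sym: "?D2 u u' = ?D2 u' u" for u u'
    by (rule second_derivative_symmetric[OF \<tau>])
  have vd: "v dd = fderiv ?T ?X (v cc)" and wd: "w dd = fderiv ?T ?X (w cc)"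
    using T.tangent_change[OF v ch(1) zin(1) ch(2) zin(2)] T.tangent_change[OF w ch(1) zin(1) ch(2) zin(2)] by auto
  have "fst (v cc) \<bullet> snd (w cc) = snd (w dd) \<bullet> fst (v dd) + snd (?T ?X) \<bullet> ?D2 (fst (v cc)) (fst (w cc))"
    using snd_eq[of "w cc" "fst (v cc)"] unfolding vd wd fst_eq by (simp only: inner_commute)
  moreover have "snd (v cc) \<bullet> fst (w cc) = snd (v dd) \<bullet> fst (w dd) + snd (?T ?X) \<bullet> ?D2 (fst (w cc)) (fst (v cc))"
    using snd_eq[of "v cc" "fst (w cc)"] unfolding vd wd fst_eq .
  ultimately show ?thesis using sym[of "fst (v cc)" "fst (w cc)"] by (simp add: inner_commute)
qed

lemma canonical_form_chart:
  assumes "c \<in> charts A" "fst z \<in> cdom c" "snd z \<in> cotangent_space A (fst z)"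
    "v \<in> tangent_space (cotangent_bundle A) z" "w \<in> tangent_space (cotangent_bundle A) z"
  shows "canonical_form A z v w = fst (v (cotangent_chart A c)) \<bullet> snd (w (cotangent_chart A c))
    - snd (v (cotangent_chart A c)) \<bullet> fst (w (cotangent_chart A c))"
  unfolding canonical_form_def Let_def
  using chart_at[OF assms(1,2)] assms by (intro canonical_form_change) auto


end

section \<open>Natural coordinates on the restricted unified space\<close>

locale control_problem =
  fixes E :: "('e, 'n::finite E_coords) atlas" and FE :: "('fe, real^'n) atlas"
    and \<pi> :: "'e \<Rightarrow> real" and C :: "('c, ('n, 'm::finite) C_coords) atlas"
    and FC :: "('fc, real^'m) atlas" and \<pi>C :: "'c \<Rightarrow> 'e" and L :: "'c \<Rightarrow> real" and F :: "'c \<Rightarrow> 'e jet"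
  assumes problem: "optimal_control_problem E FE \<pi> C FC \<pi>C L F"
begin

abbreviation bc where "bc \<equiv> bundle_charts E \<pi> C \<pi>C"
abbreviation M where "M \<equiv> W0 E \<pi> C \<pi>C L F"
abbreviation HW where "HW \<equiv> H_W E \<pi> \<pi>C L F"
abbreviation solves where "solves \<equiv> solves_at E \<pi> C \<pi>C L F"
abbreviation Omega where "Omega \<equiv> Omega_W0 E \<pi> C \<pi>C L F"

lemma manifold_E: "manifold E" and manifold_C: "manifold C"
  using problem by (auto simp: optimal_control_problem_def fiber_bundle_def)

sublocale E: smooth_atlas E by (rule manifold_smooth_atlas[OF manifold_E])
sublocale C: smooth_atlas C by (rule manifold_smooth_atlas[OF manifold_C])

definition base :: "('n, 'm) W0_coords \<Rightarrow> ('n, 'm) C_coords" where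
  "base y = (fst y, fst (snd y), fst (snd (snd y)))"

definition mom :: "('n, 'm) W0_coords \<Rightarrow> real^'n" where
  "mom y = snd (snd (snd y))"

text \<open>The functions F^i of the state equations, pulled back to the coordinates of the
  restricted space.\<close>

definition vel where
  "vel d k y = snd (snd (coord (jet_chart E \<pi> d) (F (param k (base y)))))"

text \<open>The coordinate $p$ on the hypersurface $\mathcal{H} = 0$.\<close>

definition p_coord where
  "p_coord d k y = L (param k (base y)) - mom y \<bullet> vel d k y"

lemma bundle_chartsD:
  assumes "bc d k"
  shows "d \<in> charts E" "k \<in> charts C" "adapted_chart E \<pi> d" "is_chart d" "is_chart k"
    "c \<in> cdom k \<Longrightarrow> \<pi>C c \<in> cdom d"
    "c \<in> cdom k \<Longrightarrow> coord d (\<pi>C c) = (fst (coord k c), fst (snd (coord k c)))"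
    "c \<in> cdom k \<Longrightarrow> fst (coord k c) = \<pi> (\<pi>C c)"
    "c \<in> cdom k \<Longrightarrow> c \<in> carrier C"
proof -
  show d: "d \<in> charts E" "k \<in> charts C" "adapted_chart E \<pi> d"
    using assms by (auto simp: bundle_charts_def adapted_chart_def)
  show "is_chart d" "is_chart k" using E.charts_is_chart[OF d(1)] C.charts_is_chart[OF d(2)] .
  assume c: "c \<in> cdom k"
  show "\<pi>C c \<in> cdom d" "coord d (\<pi>C c) = (fst (coord k c), fst (snd (coord k c)))"
    using assms c by (simp_all add: bundle_charts_def)
  moreover have "fst (coord d (\<pi>C c)) = \<pi> (\<pi>C c)"
    using d(3) calculation(1) by (simp add: adapted_chart_def)
  ultimately show "fst (coord k c) = \<pi> (\<pi>C c)" by simp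
  show "c \<in> carrier C" by (rule C.charts_carrier[OF d(2) c])
qed

lemma local_section_curve:
  assumes "local_section E \<pi> t \<phi>"
  shows "curve_at E \<phi> t" "\<forall>\<^sub>F r in nhds t. \<pi> (\<phi> r) = r" "\<pi> (\<phi> t) = t"
proof -
  obtain I where I: "open I" "t \<in> I" "smooth_map (restrict_atlas euclidean_atlas I) E \<phi>" "\<And>s. s \<in> I \<Longrightarrow> \<pi> (\<phi> s) = s"
    using assms by (auto simp: local_section_def)
  show "curve_at E \<phi> t" by (rule E.smooth_map_curve_at[OF I(3,1,2)])
  show "\<forall>\<^sub>F r in nhds t. \<pi> (\<phi> r) = r"
    using eventually_nhds_in_open[OF I(1,2)] by (rule eventually_mono) (rule I(4))
  show "\<pi> (\<phi> t) = t" using I by simp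
qed

text \<open>In an adapted chart the first coordinate of a section near t is the parameter
  itself.\<close>

lemma velocity_adapted:
  assumes \<phi>: "local_section E \<pi> t \<phi>" and d: "adapted_chart E \<pi> d" "\<phi> t \<in> cdom d"
  shows "fst (velocity E \<phi> t d) = 1"
proof -
  note c = local_section_curve[OF \<phi>]
  have dd: "d \<in> charts E" "\<And>e. e \<in> cdom d \<Longrightarrow> fst (coord d e) = \<pi> e" using d by (auto simp: adapted_chart_def)
  have "((\<lambda>r. fst (coord d (\<phi> r))) has_derivative (\<lambda>h. fst (h *\<^sub>R velocity E \<phi> t d))) (at t)"
    using has_derivative_fst[OF E.velocity_coord[OF c(1) dd(1) d(2), unfolded has_vector_derivative_def]] .
  moreover have "\<forall>\<^sub>F r in nhds t. fst (coord d (\<phi> r)) = r"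
    using E.curve_at_eventually[OF c(1) dd(1) d(2)] c(2) by eventually_elim (simp add: dd)
  ultimately have "((\<lambda>r. r) has_derivative (\<lambda>h. fst (h *\<^sub>R velocity E \<phi> t d))) (at t)"
    by (rule has_derivative_cong_nhds)
  from has_derivative_unique[OF has_derivative_ident this]
  have "(\<lambda>x. x) = (\<lambda>h. fst (h *\<^sub>R velocity E \<phi> t d))" .
  from fun_cong[OF this, of 1] show ?thesis by simp
qed

text \<open>\<open>jet_rep\<close> and the choice inside \<open>H_W\<close> may select different
  sections. Both represent the jet \<open>F c\<close>, and a jet records the velocity, so every
  choice gives the same value of the Hamiltonian.\<close>

lemma F_jet:
  assumes c: "c \<in> carrier C"
  defines "t \<equiv> \<pi> (\<pi>C c)"
  shows "F c \<in> jets E \<pi>" "fst (F c) = t" "local_section E \<pi> t (jet_rep (F c))" "jet_rep (F c) t = \<pi>C c"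
    "\<exists>\<phi>. local_section E \<pi> t \<phi> \<and> jet1 E \<pi> \<phi> t = F c"
    "\<And>\<phi>. local_section E \<pi> t \<phi> \<Longrightarrow> jet1 E \<pi> \<phi> t = F c \<Longrightarrow>
      velocity E \<phi> t = velocity E (jet_rep (F c)) t"
proof -
  have "F c \<in> carrier (jet_bundle E \<pi>)"
    using problem c unfolding optimal_control_problem_def smooth_map_def by blast
  then show j: "F c \<in> jets E \<pi>" by (auto simp: carrier_def jet_bundle_def jet_chart_def)
  then obtain \<psi> s where \<psi>: "F c = jet1 E \<pi> \<psi> s" "local_section E \<pi> s \<psi>" by (auto simp: jets_def)
  have "\<psi> \<in> snd (F c)" using \<psi> by (simp add: jet1_def)
  then have "jet_rep (F c) \<in> snd (F c)" unfolding jet_rep_def by (rule someI[of "\<lambda>\<phi>. \<phi> \<in> snd (F c)"])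
  then have rep: "local_section E \<pi> s (jet_rep (F c))" "jet_rep (F c) s = \<psi> s"
    "velocity E (jet_rep (F c)) s = velocity E \<psi> s"
    unfolding \<psi>(1) by (auto simp: jet1_def)
  have fs: "fst (F c) = s" by (simp add: \<psi>(1) jet1_def)
  have "jet_rep (F c) s = \<pi>C c"
    using problem c unfolding fs[symmetric] optimal_control_problem_def jet_target_def by blast
  moreover from this have s: "s = t" using local_section_curve(3)[OF rep(1)] by (simp add: t_def)
  ultimately show "fst (F c) = t" "local_section E \<pi> t (jet_rep (F c))" "jet_rep (F c) t = \<pi>C c"
    using fs rep by simp_all
  show "\<exists>\<phi>. local_section E \<pi> t \<phi> \<and> jet1 E \<pi> \<phi> t = F c" using \<psi> s by metis
  fix \<phi> assume \<phi>: "local_section E \<pi> t \<phi>" "jet1 E \<pi> \<phi> t = F c"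
  then have "\<phi> \<in> snd (jet1 E \<pi> \<psi> s)" unfolding \<psi>(1)[symmetric] \<phi>(2)[symmetric] by (simp add: jet1_def)
  then have "velocity E \<phi> s = velocity E \<psi> s" by (simp add: jet1_def)
  then show "velocity E \<phi> t = velocity E (jet_rep (F c)) t" using rep(3) s by simp
qed

lemma F_velocity:
  assumes b: "bc d k" and c: "c \<in> cdom k"
  shows "velocity E (jet_rep (F c)) (\<pi> (\<pi>C c)) d = (1, snd (snd (coord (jet_chart E \<pi> d) (F c))))"
    "velocity E (jet_rep (F c)) (\<pi> (\<pi>C c)) \<in> tangent_space E (\<pi>C c)"
proof -
  note j = F_jet[OF bundle_chartsD(9)[OF b c]]
  have "fst (velocity E (jet_rep (F c)) (\<pi> (\<pi>C c)) d) = 1"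
    by (rule velocity_adapted[OF j(3) bundle_chartsD(3)[OF b]]) (simp add: j(4) bundle_chartsD(6)[OF b c])
  then show "velocity E (jet_rep (F c)) (\<pi> (\<pi>C c)) d = (1, snd (snd (coord (jet_chart E \<pi> d) (F c))))"
    by (simp add: prod_eq_iff jet_chart_def j(2))
  show "velocity E (jet_rep (F c)) (\<pi> (\<pi>C c)) \<in> tangent_space E (\<pi>C c)"
    using E.velocity_tangent[OF local_section_curve(1)[OF j(3)]] by (simp add: j(4))
qed

lemma W_D:
  assumes "w \<in> W E C \<pi>C"
  shows "fst (snd w) = \<pi>C (fst w)" "snd (snd w) \<in> cotangent_space E (\<pi>C (fst w))" "fst w \<in> carrier C"
  using assms by (auto simp: W_def E.carrier_cotangent_bundle)

lemma W_I:
  assumes "bc d k" "c \<in> cdom k" "\<alpha> \<in> cotangent_space E (\<pi>C c)"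
  shows "(c, \<pi>C c, \<alpha>) \<in> W E C \<pi>C"
  using assms bundle_chartsD[OF assms(1)] E.charts_carrier by (auto simp: W_def E.carrier_cotangent_bundle)

lemma H_W_eq:
  assumes b: "bc d k" and w: "w \<in> W E C \<pi>C" and c: "fst w \<in> cdom k"
  shows "HW w = E.cot_components d (\<pi>C (fst w)) (snd (snd w)) \<bullet>
    (1, snd (snd (coord (jet_chart E \<pi> d) (F (fst w))))) - L (fst w)"
proof -
  obtain c e \<alpha> where we: "w = (c, e, \<alpha>)" by (cases w) auto
  let ?t = "\<pi> (\<pi>C c)"
  let ?\<phi> = "SOME \<phi>. local_section E \<pi> ?t \<phi> \<and> jet1 E \<pi> \<phi> ?t = F c"
  have cC: "c \<in> carrier C" and ck: "c \<in> cdom k" using W_D(3)[OF w] c we by auto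
  have "local_section E \<pi> ?t ?\<phi> \<and> jet1 E \<pi> ?\<phi> ?t = F c" by (rule someI_ex[OF F_jet(5)[OF cC]])
  then have v: "velocity E ?\<phi> ?t = velocity E (jet_rep (F c)) ?t" by (intro F_jet(6)[OF cC]) auto
  have \<alpha>: "\<alpha> \<in> cotangent_space E (\<pi>C c)" using W_D(2)[OF w] we by simp
  have "HW w = \<alpha> (velocity E (jet_rep (F c)) ?t) - L c"
    by (simp add: H_W_def we Let_def v)
  then show ?thesis
    using E.cot_apply[OF \<alpha> bundle_chartsD(1)[OF b] bundle_chartsD(6)[OF b ck] F_velocity(2)[OF b ck]] F_velocity(1)[OF b ck]
    by (simp add: we)
qed

lemma natural_coord_eq:
  assumes b: "bc d k" and w: "w \<in> W E C \<pi>C" and c: "fst w \<in> cdom k"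
  defines "x \<equiv> coord k (fst w)" and "\<xi> \<equiv> E.cot_components d (\<pi>C (fst w)) (snd (snd w))"
  shows "natural_coord E d k w = (fst x, fst (snd x), snd (snd x), fst \<xi>, snd \<xi>)"
proof -
  obtain c e \<alpha> where we: "w = (c, e, \<alpha>)" by (cases w) auto
  have e: "e = \<pi>C c" "\<alpha> \<in> cotangent_space E (\<pi>C c)" using W_D[OF w] we by auto
  note comp = E.cot_components[OF e(2) bundle_chartsD(1)[OF b] bundle_chartsD(6)[OF b]]
  have "\<alpha> (coord_vector E d e (1, 0)) = fst \<xi>" using comp c by (simp add: \<xi>_def we e inner_prod_def)
  moreover have "(\<chi> i. \<alpha> (coord_vector E d e (0, axis i 1))) = snd \<xi>"
    using comp c by (simp add: \<xi>_def we e inner_prod_def vec_eq_iff inner_axis)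
  ultimately show ?thesis by (simp add: natural_coord_def we x_def case_prod_unfold)
qed

section \<open>Natural charts and their explicit inverses\<close>

definition wchart where
  "wchart d k = ({w \<in> W0_set E \<pi> C \<pi>C L F. fst w \<in> cdom k},
     \<lambda>w. case natural_coord E d k w of (t, q, u, p, pp) \<Rightarrow> (t, q, u, pp))"

text \<open>The covector is rebuilt from the momenta p_i by inserting the one value of p for which H
  = 0. This makes it a two-sided inverse of the natural chart.\<close>

definition wparam where
  "wparam d k y = (let c = param k (base y) in (c, \<pi>C c, E.cot_of d (\<pi>C c) (p_coord d k y, mom y)))"

text \<open>The image of a chart of \<open>C\<close> times the whole space of momenta.\<close>

definition wdom :: "('c, ('n, 'm) C_coords) chart \<Rightarrow> ('n, 'm) W0_coords set" where
  "wdom k = {y. base y \<in> coord k ` cdom k}"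

lemma M_eq: "M = {wchart d k | d k. bc d k}"
  by (simp add: W0_def wchart_def)

lemma wchart_D:
  assumes "w \<in> cdom (wchart d k)"
  shows "w \<in> W E C \<pi>C" "fst w \<in> cdom k" "HW w = 0" "fst (snd w) = \<pi>C (fst w)"
    "snd (snd w) \<in> cotangent_space E (\<pi>C (fst w))"
proof -
  show w: "w \<in> W E C \<pi>C" "fst w \<in> cdom k" "HW w = 0"
    using assms by (auto simp: wchart_def W0_set_def)
  show "fst (snd w) = \<pi>C (fst w)" "snd (snd w) \<in> cotangent_space E (\<pi>C (fst w))"
    using W_D[OF w(1)] by auto
qed

lemma wchart_I: "w \<in> W E C \<pi>C \<Longrightarrow> fst w \<in> cdom k \<Longrightarrow> HW w = 0 \<Longrightarrow> w \<in> cdom (wchart d k)"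
  by (simp add: wchart_def W0_set_def)

lemma wchart_coord:
  assumes b: "bc d k" and w: "w \<in> W E C \<pi>C" "fst w \<in> cdom k"
  shows "base (coord (wchart d k) w) = coord k (fst w)"
    "mom (coord (wchart d k) w) = snd (E.cot_components d (\<pi>C (fst w)) (snd (snd w)))"
  using natural_coord_eq[OF assms] by (simp_all add: wchart_def base_def mom_def case_prod_unfold)

lemma base_mom_eqI: "base y = base y' \<Longrightarrow> mom y = mom y' \<Longrightarrow> y = y'"
  by (simp add: base_def mom_def prod_eq_iff)

lemma p_coord_eq:
  assumes b: "bc d k" and w: "w \<in> cdom (wchart d k)"
  shows "fst (E.cot_components d (\<pi>C (fst w)) (snd (snd w))) = p_coord d k (coord (wchart d k) w)"
  using H_W_eq[OF b wchart_D(1,2)[OF w]] wchart_D(3)[OF w]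
  by (simp add: p_coord_def vel_def wchart_coord[OF b wchart_D(1,2)[OF w]] param_coord[OF bundle_chartsD(5)[OF b] wchart_D(2)[OF w]]
      inner_prod_def)

lemma wparam_coord:
  assumes b: "bc d k" and w: "w \<in> cdom (wchart d k)"
  shows "coord (wchart d k) w \<in> wdom k" "wparam d k (coord (wchart d k) w) = w"
proof -
  note D = wchart_D[OF w]
  show "coord (wchart d k) w \<in> wdom k" using D by (simp add: wdom_def wchart_coord[OF b D(1,2)])
  have c: "param k (base (coord (wchart d k) w)) = fst w"
    by (simp add: wchart_coord[OF b D(1,2)] param_coord[OF bundle_chartsD(5)[OF b] D(2)])
  have "E.cot_components d (\<pi>C (fst w)) (snd (snd w)) = (p_coord d k (coord (wchart d k) w), mom (coord (wchart d k) w))"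
    by (simp add: prod_eq_iff p_coord_eq[OF b w] wchart_coord[OF b D(1,2)])
  then have "E.cot_of d (\<pi>C (fst w)) (p_coord d k (coord (wchart d k) w), mom (coord (wchart d k) w)) = snd (snd w)"
    using E.cot_of_cot_components[OF D(5) bundle_chartsD(1)[OF b] bundle_chartsD(6)[OF b D(2)]] by simp
  then show "wparam d k (coord (wchart d k) w) = w"
    by (simp add: wparam_def c Let_def prod_eq_iff D(4))
qed

lemma coord_wparam:
  assumes b: "bc d k" and y: "y \<in> wdom k"
  shows "wparam d k y \<in> cdom (wchart d k)" "coord (wchart d k) (wparam d k y) = y"
proof -
  let ?c = "param k (base y)" and ?w = "wparam d k y"
  have c: "?c \<in> cdom k" "coord k ?c = base y"
    using y coord_param[of "base y" k "cdom k"] param_in[of "base y" k "cdom k"] by (auto simp: wdom_def)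
  note d = bundle_chartsD(1)[OF b] bundle_chartsD(6)[OF b c(1)]
  have W: "?w \<in> W E C \<pi>C" unfolding wparam_def Let_def
    by (rule W_I[OF b c(1) E.cot_of_in[OF d]])
  have fw: "fst ?w = ?c" by (simp add: wparam_def Let_def)
  have comp: "E.cot_components d (\<pi>C (fst ?w)) (snd (snd ?w)) = (p_coord d k y, mom y)"
    by (simp add: wparam_def Let_def E.cot_components_cot_of[OF d])
  have "HW ?w = 0"
    using H_W_eq[OF b W] c unfolding comp by (simp add: fw p_coord_def vel_def inner_prod_def)
  then show "?w \<in> cdom (wchart d k)" using W c by (intro wchart_I) (simp_all add: fw)
  have "?w \<in> W E C \<pi>C" "fst ?w \<in> cdom k" using W c by (simp_all add: fw)
  from wchart_coord[OF b this] show "coord (wchart d k) ?w = y"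
    by (intro base_mom_eqI) (use comp in \<open>simp_all add: fw c\<close>)
qed

lemma wchart_image:
  assumes b: "bc d k" shows "coord (wchart d k) ` cdom (wchart d k) = wdom k"
proof (intro equalityI subsetI)
  fix y assume "y \<in> wdom k"
  then show "y \<in> coord (wchart d k) ` cdom (wchart d k)"
    using coord_wparam[OF b] by (intro rev_image_eqI[of "wparam d k y"]) simp_all
qed (use wparam_coord(1)[OF b] in blast)

lemma smooth_at_base: "smooth_at base y"
  unfolding base_def by (intro smooth_at_intros)

lemma smooth_at_mom: "smooth_at mom y"
  unfolding mom_def by (intro smooth_at_intros)

lemma open_wdom: "bc d k \<Longrightarrow> open (wdom k)"
  unfolding open_iff_eventually
proof
  fix y assume b: "bc d k" and y: "y \<in> wdom k"
  have "open (coord k ` cdom k)" using bundle_chartsD(5)[OF b] by (simp add: is_chart_def)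
  then have "\<forall>\<^sub>F x in nhds (base y). x \<in> coord k ` cdom k"
    using y by (intro eventually_nhds_in_open) (auto simp: wdom_def)
  from smooth_at_eventually_image[OF smooth_at_base this] show "\<forall>\<^sub>F y in nhds y. y \<in> wdom k"
    by (simp add: wdom_def)
qed

lemma wchart_is_chart: assumes b: "bc d k" shows "is_chart (wchart d k)"
  unfolding is_chart_def wchart_image[OF b]
  using open_wdom[OF b] inj_on_inverseI[of "cdom (wchart d k)" "wparam d k" "coord (wchart d k)"] wparam_coord(2)[OF b] by blast

lemma param_wchart: "bc d k \<Longrightarrow> y \<in> wdom k \<Longrightarrow> param (wchart d k) y = wparam d k y"
  using param_coord[OF wchart_is_chart coord_wparam(1)] coord_wparam(2) by metis

lemma msmooth_L: "c \<in> carrier C \<Longrightarrow> msmooth C L c"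
  using C.smooth_map_msmooth(1)[of euclidean_atlas L c "(UNIV, \<lambda>x. x)"] problem
  by (simp add: optimal_control_problem_def euclidean_atlas_def)

lemma msmooth_F:
  assumes b: "bc d k" and c: "c \<in> cdom k"
  shows "msmooth C (\<lambda>c. coord (jet_chart E \<pi> d) (F c)) c"
proof (rule C.smooth_map_msmooth(1))
  show "smooth_map C (jet_bundle E \<pi>) F" using problem by (simp add: optimal_control_problem_def)
  show "jet_chart E \<pi> d \<in> jet_bundle E \<pi>" using bundle_chartsD(3)[OF b] by (simp add: jet_bundle_def)
  show cC: "c \<in> carrier C" by (rule bundle_chartsD(9)[OF b c])
  have "jet_target (F c) = \<pi>C c" using problem cC by (simp add: optimal_control_problem_def)
  then show "F c \<in> cdom (jet_chart E \<pi> d)"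
    using F_jet(1)[OF cC] bundle_chartsD(6)[OF b c] by (simp add: jet_chart_def)
qed

lemma smooth_at_on_base:
  assumes b: "bc d k" and y: "y \<in> wdom k"
    and f: "\<And>c. c \<in> cdom k \<Longrightarrow> msmooth C f c"
  shows "smooth_at (\<lambda>y. f (param k (base y))) y"
proof -
  obtain c where c: "c \<in> cdom k" "base y = coord k c" using y by (auto simp: wdom_def)
  show ?thesis
    by (rule smooth_at_compose[of "\<lambda>x. f (param k x)", OF _ smooth_at_base], unfold c(2))
      (use f[OF c(1)] in \<open>simp add: C.msmooth_chart[OF bundle_chartsD(2)[OF b] c(1)]\<close>)
qed

lemma smooth_at_vel:
  assumes b: "bc d k" and y: "y \<in> wdom k" shows "smooth_at (vel d k) y"
  unfolding vel_def
  by (rule smooth_at_on_base[OF b y]) (rule C.msmooth_compose[OF msmooth_F[OF b]], assumption, intro smooth_at_intros)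

lemma smooth_at_p_coord:
  assumes b: "bc d k" and y: "y \<in> wdom k" shows "smooth_at (p_coord d k) y"
  unfolding p_coord_def
  by (intro smooth_at_diff smooth_at_inner smooth_at_mom smooth_at_vel[OF b y]
      smooth_at_on_base[OF b y, of L] msmooth_L bundle_chartsD(9)[OF b])

lemma wchart_transition:
  assumes b: "bc d k" and b': "bc d' k'"
  shows "smooth_transition (wchart d k) (wchart d' k')"
proof (rule smooth_transitionI)
  fix w assume w: "w \<in> cdom (wchart d k)" "w \<in> cdom (wchart d' k')"
  let ?y = "coord (wchart d k) w" and ?\<kappa> = "coord k' \<circ> param k" and ?\<sigma> = "coord d \<circ> param d'"
  note y = wparam_coord(1)[OF b w(1)]
  have yb: "base ?y = coord k (fst w)" by (rule wchart_coord[OF b wchart_D(1,2)[OF w(1)]])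
  note t = smooth_transitionD[OF C.charts_transition[OF bundle_chartsD(2)[OF b] bundle_chartsD(2)[OF b']] bundle_chartsD(5)[OF b] wchart_D(2)[OF w(1)] wchart_D(2)[OF w(2)]]
  have "\<forall>\<^sub>F x in nhds (base ?y). param k x \<in> cdom k'"
    unfolding yb by (rule eventually_mono[OF t(2)]) simp
  from smooth_at_eventually_image[OF smooth_at_base this]
  have ev: "\<forall>\<^sub>F y in nhds ?y. y \<in> wdom k \<and> param k (base y) \<in> cdom k'"
    using eventually_nhds_in_open[OF open_wdom[OF b] y] by eventually_elim simp
  have win: "wparam d k y \<in> cdom (wchart d' k')" if "y \<in> wdom k" "param k (base y) \<in> cdom k'" for y
    using wchart_D[OF coord_wparam(1)[OF b that(1)]] that(2) by (intro wchart_I) (simp_all add: wparam_def Let_def)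
  from ev show "\<forall>\<^sub>F y in nhds ?y. y \<in> coord (wchart d k) ` (cdom (wchart d k) \<inter> cdom (wchart d' k'))"
  proof (rule eventually_mono)
    fix y assume "y \<in> wdom k \<and> param k (base y) \<in> cdom k'"
    then show "y \<in> coord (wchart d k) ` (cdom (wchart d k) \<inter> cdom (wchart d' k'))"
      using coord_wparam[OF b] win by (intro rev_image_eqI[of "wparam d k y"]) simp_all
  qed
  let ?e = "\<lambda>y. (fst (?\<kappa> (base y)), fst (snd (?\<kappa> (base y))))"
  \<comment> \<open>The momenta transform as covector components. The component p also enters, but
    on the hypersurface it is the smooth function \<open>p_coord\<close> of the remaining
    coordinates.\<close>
  let ?T = "\<lambda>y. (fst (?\<kappa> (base y)), fst (snd (?\<kappa> (base y))), snd (snd (?\<kappa> (base y))),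
      \<chi> i. (p_coord d k y, mom y) \<bullet> fderiv ?\<sigma> (?e y) (0, axis i 1))"
  have \<kappa>: "smooth_at (\<lambda>y. ?\<kappa> (base y)) ?y"
    by (rule smooth_at_compose[of ?\<kappa>, OF _ smooth_at_base], unfold yb) (rule t(1))
  have e: "?e ?y = coord d' (\<pi>C (fst w))"
    using bundle_chartsD(7)[OF b' wchart_D(2)[OF w(2)]] by (simp add: yb param_coord[OF bundle_chartsD(5)[OF b] wchart_D(2)[OF w(1)]])
  have \<sigma>: "smooth_at ?\<sigma> (?e ?y)" unfolding e
    by (intro E.transition_smooth_at bundle_chartsD(1)[OF b] bundle_chartsD(1)[OF b'] bundle_chartsD(6)[OF b] bundle_chartsD(6)[OF b'] wchart_D(2)[OF w(1)] wchart_D(2)[OF w(2)])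
  have e': "smooth_at ?e ?y"
    by (intro smooth_at_Pair smooth_at_fst[OF \<kappa>] smooth_at_fst[OF smooth_at_snd[OF \<kappa>]])
  have "smooth_at (\<lambda>y. \<chi> i. (p_coord d k y, mom y) \<bullet> fderiv ?\<sigma> (?e y) (0, axis i 1)) ?y"
  proof (rule smooth_at_vec, unfold vec_lambda_beta)
    fix i
    have "smooth_at (\<lambda>y. fderiv ?\<sigma> (?e y) (0, axis i 1)) ?y"
      by (rule smooth_at_frechet[of ?\<sigma> ?e ?y "\<lambda>_. (0, axis i 1)", OF \<sigma> e' smooth_at_const])
    then show "smooth_at (\<lambda>y. (p_coord d k y, mom y) \<bullet> fderiv ?\<sigma> (?e y) (0, axis i 1)) ?y"
      by (intro smooth_at_inner smooth_at_Pair smooth_at_p_coord[OF b y] smooth_at_mom)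
  qed
  then have "smooth_at ?T ?y"
    by (intro smooth_at_Pair smooth_at_fst[OF \<kappa>] smooth_at_fst[OF smooth_at_snd[OF \<kappa>]] smooth_at_snd[OF smooth_at_snd[OF \<kappa>]])
  then show "smooth_at (coord (wchart d' k') \<circ> param (wchart d k)) ?y"
  proof (rule smooth_at_cong)
    from ev show "\<forall>\<^sub>F y in nhds ?y. ?T y = (coord (wchart d' k') \<circ> param (wchart d k)) y"
    proof eventually_elim
      case (elim y)
      let ?w = "wparam d k y"
      have c: "fst ?w \<in> cdom k" "fst ?w \<in> cdom k'" and fw: "fst ?w = param k (base y)"
        using wchart_D(2)[OF coord_wparam(1)[OF b]] elim by (simp_all add: wparam_def Let_def)
      have W: "?w \<in> W E C \<pi>C" using wchart_D(1)[OF coord_wparam(1)[OF b]] elim by blast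
      have "E.cot_components d' (\<pi>C (fst ?w)) (snd (snd ?w)) \<bullet> (0, axis i 1) =
          (p_coord d k y, mom y) \<bullet> fderiv ?\<sigma> (coord d' (\<pi>C (fst ?w))) (0, axis i 1)" for i
        using E.cot_components_change[OF bundle_chartsD(1)[OF b'] bundle_chartsD(6)[OF b' c(2)] bundle_chartsD(1)[OF b] bundle_chartsD(6)[OF b c(1)] W_D(2)[OF W]]
        by (simp add: wparam_def Let_def E.cot_components_cot_of[OF bundle_chartsD(1)[OF b] bundle_chartsD(6)[OF b c(1)[unfolded fw]]])
      then have "snd (E.cot_components d' (\<pi>C (fst ?w)) (snd (snd ?w))) = mom (?T y)"
        using bundle_chartsD(7)[OF b' c(2)] by (simp add: mom_def vec_eq_iff inner_prod_def inner_axis fw)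
      then show ?case
        using wchart_coord[OF b' W c(2)] param_wchart[OF b] elim
        by (intro base_mom_eqI) (simp_all add: fw base_def)
    qed
  qed
qed

sublocale M: smooth_atlas M
  by unfold_locales (auto simp: M_eq compatible_def intro: wchart_is_chart wchart_transition)

lemma wchart_in: "bc d k \<Longrightarrow> wchart d k \<in> charts M"
  by (rule M.in_charts) (unfold M_eq, blast)

lemma carrier_M: "w \<in> carrier M \<Longrightarrow> \<exists>d k. bc d k \<and> w \<in> cdom (wchart d k)"
  unfolding carrier_def M_eq by blast


end

context control_problem
begin

text \<open>Reads smoothness and derivatives off the explicit inverse \<open>wparam\<close> instead
  of \<open>param\<close>, which is defined by choice.\<close>

lemma wchart_msmooth:
  assumes b: "bc d k" and w: "w \<in> cdom (wchart d k)" and eq: "\<And>y. y \<in> wdom k \<Longrightarrow> f (wparam d k y) = g y"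
    and g: "smooth_at g (coord (wchart d k) w)"
  shows "msmooth M f w"
    "fderiv (\<lambda>x. f (param (wchart d k) x)) (coord (wchart d k) w) = fderiv g (coord (wchart d k) w)"
proof -
  have ev: "\<forall>\<^sub>F y in nhds (coord (wchart d k) w). g y = f (param (wchart d k) y)"
    using eventually_nhds_in_open[OF open_wdom[OF b] wparam_coord(1)[OF b w]]
    by eventually_elim (simp add: eq param_wchart[OF b])
  show "msmooth M f w"
    unfolding M.msmooth_chart[OF wchart_in[OF b] w] by (rule smooth_at_cong[OF g ev])
  show "fderiv (\<lambda>x. f (param (wchart d k) x)) (coord (wchart d k) w) = fderiv g (coord (wchart d k) w)"
    by (rule frechet_derivativeI[OF has_derivative_cong_nhds[OF smooth_at_has_derivative[OF g] ev]])
qed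

section \<open>The differential of p as a function on the hypersurface\<close>

definition d_p_coord where "d_p_coord d k y = fderiv (p_coord d k) y"

definition force where
  "force d k y = (\<chi> i. d_p_coord d k y (0, axis i 1, 0, 0))"

text \<open>The sign comes from $\mathcal{H} = p - P$ with $P$ the value of $p$ on $\mathcal{H} = 0$.\<close>

definition dH_du where
  "dH_du d k y = (\<chi> a. - d_p_coord d k y (0, 0, axis a 1, 0))"

lemma linear_d_p_coord: "bc d k \<Longrightarrow> y \<in> wdom k \<Longrightarrow> linear (d_p_coord d k y)"
  unfolding d_p_coord_def by (intro smooth_at_linear smooth_at_p_coord)

text \<open>Over a fixed point of \<open>C\<close> the function P is affine in the momenta with
  slope -F.\<close>

lemma d_p_coord_mom:
  assumes b: "bc d k" and y: "y \<in> wdom k"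
  shows "d_p_coord d k y (0, 0, 0, p) = - (vel d k y \<bullet> p)"
proof -
  let ?i = "\<lambda>p :: real^'n. y + (0, 0, 0, p)"
  have bi: "base (?i p) = base y" "mom (?i p) = mom y + p" for p by (simp_all add: base_def mom_def)
  then have eq: "p_coord d k (?i p) = p_coord d k y - vel d k y \<bullet> p" for p
    by (simp add: p_coord_def vel_def inner_add_left inner_commute)
  have "(?i has_derivative (\<lambda>p. (0, 0, 0, p))) (at 0)"
    by (auto intro!: derivative_eq_intros has_derivative_Pair)
  moreover have "(p_coord d k has_derivative d_p_coord d k y) (at (?i 0))"
    using smooth_at_has_derivative[OF smooth_at_p_coord[OF b y]] by (simp add: d_p_coord_def zero_prod_def[symmetric])
  ultimately have "(p_coord d k \<circ> ?i has_derivative d_p_coord d k y \<circ> (\<lambda>p. (0, 0, 0, p))) (at 0)"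
    by (rule diff_chain_at)
  moreover have "((\<lambda>p. p_coord d k y - vel d k y \<bullet> p) has_derivative (\<lambda>p. - (vel d k y \<bullet> p))) (at 0)"
    by (auto intro!: derivative_eq_intros)
  then have "(p_coord d k \<circ> ?i has_derivative (\<lambda>p. - (vel d k y \<bullet> p))) (at 0)"
    by (simp add: comp_def eq)
  ultimately have "d_p_coord d k y \<circ> (\<lambda>p. (0, 0, 0, p)) = (\<lambda>p. - (vel d k y \<bullet> p))"
    by (rule has_derivative_unique)
  from fun_cong[OF this, of p] show ?thesis by simp
qed

lemma d_p_coord_eq:
  assumes b: "bc d k" and y: "y \<in> wdom k"
  shows "d_p_coord d k y (t, q, u, p) = t * d_p_coord d k y (1, 0, 0, 0) + force d k y \<bullet> q - dH_du d k y \<bullet> u - vel d k y \<bullet> p"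
proof -
  note lin = linear_d_p_coord[OF b y]
  have "(t, q, u, p) = t *\<^sub>R (1, 0, 0, 0) + (0, q, 0, 0) + (0, 0, u, 0) + (0, 0, 0, p)" by simp
  then have "d_p_coord d k y (t, q, u, p) = t * d_p_coord d k y (1, 0, 0, 0) + d_p_coord d k y (0, q, 0, 0)
      + d_p_coord d k y (0, 0, u, 0) + d_p_coord d k y (0, 0, 0, p)"
    using linear_add[OF lin] linear_cmul[OF lin, of t "(1, 0, 0, 0)"] by (metis real_scaleR_def)
  moreover have "linear (\<lambda>q. d_p_coord d k y (0, q, 0, 0))" "linear (\<lambda>u. d_p_coord d k y (0, 0, u, 0))"
    using linear_add[OF lin] linear_cmul[OF lin]
    by (auto intro!: linearI simp: linear_add[OF lin, symmetric] linear_cmul[OF lin, symmetric] simp del: real_scaleR_def)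
  then have "d_p_coord d k y (0, q, 0, 0) = force d k y \<bullet> q" "d_p_coord d k y (0, 0, u, 0) = - (dH_du d k y \<bullet> u)"
    using linear_vec_inner[of "\<lambda>q. d_p_coord d k y (0, q, 0, 0)" q] linear_vec_inner[of "\<lambda>u. d_p_coord d k y (0, 0, u, 0)" u]
    by (simp_all add: force_def dH_du_def inner_vec_def sum_negf)
  ultimately show ?thesis using d_p_coord_mom[OF b y] by simp
qed

lemma smooth_at_d_p_coord: "bc d k \<Longrightarrow> y \<in> wdom k \<Longrightarrow> smooth_at (\<lambda>y. d_p_coord d k y v) y"
  unfolding d_p_coord_def by (intro smooth_at_frechet_dir smooth_at_p_coord)

lemma smooth_at_force: "bc d k \<Longrightarrow> y \<in> wdom k \<Longrightarrow> smooth_at (force d k) y"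
  by (rule smooth_at_vec) (simp add: force_def smooth_at_d_p_coord)

lemma smooth_at_dH_du: "bc d k \<Longrightarrow> y \<in> wdom k \<Longrightarrow> smooth_at (dH_du d k) y"
  by (rule smooth_at_vec) (simp add: dH_du_def smooth_at_minus smooth_at_d_p_coord)

subsection \<open>The presymplectic equation in coordinates\<close>

lemma snd_coord:
  assumes b: "bc d k" and y: "y \<in> wdom k"
  shows "coord (cotangent_chart E d) (snd (wparam d k y)) = ((fst y, fst (snd y)), (p_coord d k y, mom y))"
proof -
  let ?c = "param k (base y)"
  have c: "?c \<in> cdom k" "coord k ?c = base y"
    using y coord_param[of "base y" k "cdom k"] param_in[of "base y" k "cdom k"] by (auto simp: wdom_def)
  show ?thesis
    using bundle_chartsD(7)[OF b c(1)] c(2) E.cot_components_cot_of[OF bundle_chartsD(1)[OF b] bundle_chartsD(6)[OF b c(1)]]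
    by (simp add: E.cotangent_chart_simps wparam_def Let_def base_def)
qed

text \<open>The projection to the cotangent bundle sends (t, q, u, p_i) to (t, q, P, p_i), so its
  tangent map fills the p-slot with dP. Membership of the image in the tangent space is what permits
  evaluating the canonical form in the adapted chart \<open>d\<close>.\<close>

lemma snd_tangent:
  assumes b: "bc d k" and w: "w \<in> cdom (wchart d k)" and X: "X \<in> tangent_space M w"
  defines "T \<equiv> tangent_map M (cotangent_bundle E) snd w" and "x \<equiv> X (wchart d k)"
  shows "T X \<in> tangent_space (cotangent_bundle E) (snd w)"
    "T X (cotangent_chart E d) = ((fst x, fst (snd x)), (d_p_coord d k (coord (wchart d k) w) x, mom x))"
proof -
  let ?y = "coord (wchart d k) w" and ?c = "cotangent_chart E d"
  let ?emb = "\<lambda>y. ((fst y, fst (snd y)), (p_coord d k y, mom y))"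
  note y = wparam_coord(1)[OF b w]
  have ch: "?c \<in> charts (cotangent_bundle E)" by (rule E.cotangent_chart_in[OF bundle_chartsD(1)[OF b]])
  have inc: "snd w \<in> cdom ?c" if "w \<in> cdom (wchart d k)" for w
    using wchart_D[OF that] bundle_chartsD(6)[OF b] by (simp add: E.cotangent_chart_simps)
  have emb: "smooth_at ?emb ?y"
    by (intro smooth_at_Pair smooth_at_mom smooth_at_p_coord[OF b y] smooth_at_fst smooth_at_snd smooth_at_ident)
  have ms: "msmooth M (\<lambda>w. coord ?c (snd w)) w"
    "fderiv (\<lambda>x. coord ?c (snd (param (wchart d k) x))) ?y = fderiv ?emb ?y"
    by (rule wchart_msmooth(1)[OF b w _ emb], erule snd_coord[OF b],
        rule wchart_msmooth(2)[OF b w _ emb], erule snd_coord[OF b])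
  have ev: "\<forall>\<^sub>F w in mnhds M w. snd w \<in> cdom ?c"
    using M.eventually_in_chart[OF wchart_in[OF b] w] by (rule eventually_mono) (rule inc)
  show "T X \<in> tangent_space (cotangent_bundle E) (snd w)"
    unfolding T_def
  proof (rule M.tangent_map_tangent[OF E.cotangent_atlas])
    fix c assume c: "c \<in> charts (cotangent_bundle E)" "snd w \<in> cdom c"
    show "msmooth M (\<lambda>q. coord c (snd q)) w" "\<forall>\<^sub>F q in mnhds M w. snd q \<in> cdom c"
      using M.msmooth_target_change[OF E.cotangent_atlas ch inc[OF w] c ms(1) ev] by auto
  qed (use X M.charts_carrier[OF wchart_in[OF b] w] in auto)
  have "T X ?c = fderiv ?emb ?y x"
    using M.tangent_map_chart[where f = snd, OF wchart_in[OF b] w ch inc[OF w] ms(1) X]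
    unfolding ms(2) T_def x_def .
  moreover have "(?emb has_derivative (\<lambda>v. ((fst v, fst (snd v)), (d_p_coord d k ?y v, mom v)))) (at ?y)"
    unfolding mom_def d_p_coord_def
    by (intro has_derivative_Pair has_derivative_fst has_derivative_snd has_derivative_ident
        smooth_at_has_derivative smooth_at_p_coord b y)
  ultimately show "T X ?c = ((fst x, fst (snd x)), (d_p_coord d k ?y x, mom x))"
    by (simp add: frechet_derivativeI)
qed

lemma Omega_eq:
  assumes b: "bc d k" and w: "w \<in> cdom (wchart d k)"
    and X: "X \<in> tangent_space M w" and Y: "Y \<in> tangent_space M w"
  defines "x \<equiv> X (wchart d k)" and "y \<equiv> Y (wchart d k)" and "P \<equiv> d_p_coord d k (coord (wchart d k) w)"
  shows "Omega w X Y =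
    fst x * P y + fst (snd x) \<bullet> mom y - (P x * fst y + mom x \<bullet> fst (snd y))"
proof -
  have "fst (snd w) \<in> cdom d" "snd (snd w) \<in> cotangent_space E (fst (snd w))"
    using wchart_D[OF w] bundle_chartsD(6)[OF b] by simp_all
  from E.canonical_form_chart[OF bundle_chartsD(1)[OF b] this snd_tangent(1)[OF b w X] snd_tangent(1)[OF b w Y]]
  show ?thesis
    unfolding Omega_W0_def Let_def snd_tangent(2)[OF b w X] snd_tangent(2)[OF b w Y]
    by (simp add: x_def y_def P_def inner_prod_def)
qed

lemma dt_eq:
  assumes b: "bc d k" and w: "w \<in> cdom (wchart d k)" and X: "X \<in> tangent_space M w"
  shows "dt_W0 E \<pi> C \<pi>C L F w X = fst (X (wchart d k))"
proof -
  have eq: "\<pi> (\<pi>C (fst (wparam d k y))) = fst y" if y: "y \<in> wdom k" for y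
  proof -
    have c: "param k (base y) \<in> cdom k" "coord k (param k (base y)) = base y"
      using y coord_param[of "base y" k "cdom k"] param_in[of "base y" k "cdom k"] by (auto simp: wdom_def)
    show ?thesis using bundle_chartsD(8)[OF b c(1)] c(2) by (simp add: wparam_def Let_def base_def)
  qed
  have ms: "msmooth M (\<lambda>w. \<pi> (\<pi>C (fst w))) w"
    "fderiv (\<lambda>x. \<pi> (\<pi>C (fst (param (wchart d k) x)))) (coord (wchart d k) w) =
      fderiv fst (coord (wchart d k) w)"
    by (rule wchart_msmooth(1)[OF b w _ smooth_at_fst[OF smooth_at_ident]], erule eq,
        rule wchart_msmooth(2)[OF b w _ smooth_at_fst[OF smooth_at_ident]], erule eq)
  have "fderiv fst (coord (wchart d k) w) = fst"
    by (rule frechet_derivativeI[OF has_derivative_fst[OF has_derivative_ident]])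
  then show ?thesis
    using M.differential_chart[where f = "\<lambda>w. \<pi> (\<pi>C (fst w))", OF wchart_in[OF b] w ms(1) X]
    unfolding ms(2) dt_W0_def by simp
qed

lemma solves_iff:
  assumes b: "bc d k" and w: "w \<in> cdom (wchart d k)" and X: "X \<in> tangent_space M w"
  defines "y \<equiv> coord (wchart d k) w" and "x \<equiv> X (wchart d k)"
  shows "solves w X \<longleftrightarrow>
    fst x = 1 \<and> fst (snd x) = vel d k y \<and> mom x = force d k y \<and> dH_du d k y = 0"
proof -
  have y: "y \<in> wdom k" unfolding y_def by (rule wparam_coord(1)[OF b w])
  have Om: "(\<forall>Y\<in>tangent_space M w. Omega w X Y = 0) \<longleftrightarrow>
    (\<forall>v. fst x * d_p_coord d k y v + fst (snd x) \<bullet> mom v - (d_p_coord d k y x * fst v + mom x \<bullet> fst (snd v)) = 0)"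
  proof safe
    fix t q u p assume *: "\<forall>Y\<in>tangent_space M w. Omega w X Y = 0"
    let ?Y = "coord_vector M (wchart d k) w (t, q, u, p)"
    have Y: "?Y \<in> tangent_space M w" "?Y (wchart d k) = (t, q, u, p)"
      by (rule M.coord_vector_tangent[OF wchart_in[OF b] w], rule M.coord_vector_self[OF wchart_in[OF b] w])
    show "fst x * d_p_coord d k y (t, q, u, p) + fst (snd x) \<bullet> mom (t, q, u, p) -
        (d_p_coord d k y x * fst (t, q, u, p) + mom x \<bullet> fst (snd (t, q, u, p))) = 0"
      using *[rule_format, OF Y(1)] unfolding Omega_eq[OF b w X Y(1)] Y(2) x_def y_def .
  next
    fix Y assume *: "\<forall>v. fst x * d_p_coord d k y v + fst (snd x) \<bullet> mom v - (d_p_coord d k y x * fst v + mom x \<bullet> fst (snd v)) = 0"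
      and Y: "Y \<in> tangent_space M w"
    show "Omega w X Y = 0"
      using *[rule_format, of "Y (wchart d k)"] unfolding Omega_eq[OF b w X Y] x_def y_def .
  qed
  obtain t0 q0 u0 p0 where xx: "x = (t0, q0, u0, p0)" by (cases x) auto
  show ?thesis
    unfolding solves_at_def dt_eq[OF b w X] Om x_def[symmetric]
  proof (intro iffI conjI; (elim conjE)?)
    assume *: "\<forall>v. fst x * d_p_coord d k y v + fst (snd x) \<bullet> mom v - (d_p_coord d k y x * fst v + mom x \<bullet> fst (snd v)) = 0"
      and 1: "fst x = 1"
    show "fst x = 1" by (rule 1)
    \<comment> \<open>Each coordinate direction in the second argument isolates one equation:
      variations of p_i give the velocity, those of q the force, those of u the constraint.\<close>
    have "p \<bullet> fst (snd x) = p \<bullet> vel d k y" for p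
      using *[rule_format, of "(0, 0, 0, p)"] 1 d_p_coord_mom[OF b y, of p] by (simp add: mom_def inner_commute)
    then show "fst (snd x) = vel d k y" by (metis vector_eq_ldot)
    have "q \<bullet> mom x = q \<bullet> force d k y" for q
      using *[rule_format, of "(0, q, 0, 0)"] 1 d_p_coord_eq[OF b y, of 0 q 0 0] by (simp add: mom_def inner_commute)
    then show "mom x = force d k y" by (metis vector_eq_ldot)
    have "d_p_coord d k y (0, 0, axis a 1, 0) = 0" for a
      using *[rule_format, of "(0, 0, axis a 1, 0)"] 1 by (simp add: mom_def)
    then show "dH_du d k y = 0" by (simp add: dH_du_def vec_eq_iff)
  next
    assume *: "fst x = 1" "fst (snd x) = vel d k y" "mom x = force d k y" "dH_du d k y = 0"
    \<comment> \<open>This is the equation in the t-direction. It follows from the others, because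
      the force and velocity terms of dP(x) cancel.\<close>
    have x: "d_p_coord d k y x = d_p_coord d k y (1, 0, 0, 0)"
      using * d_p_coord_eq[OF b y, of t0 q0 u0 p0] by (simp add: xx mom_def inner_commute)
    show "\<forall>v. fst x * d_p_coord d k y v + fst (snd x) \<bullet> mom v - (d_p_coord d k y x * fst v + mom x \<bullet> fst (snd v)) = 0"
    proof
      fix v :: "('n, 'm) W0_coords"
      obtain t q u p where v: "v = (t, q, u, p)" by (cases v) auto
      show "fst x * d_p_coord d k y v + fst (snd x) \<bullet> mom v - (d_p_coord d k y x * fst v + mom x \<bullet> fst (snd v)) = 0"
        unfolding x * v d_p_coord_eq[OF b y, of t q u p] by (simp add: mom_def)
    qed
  qed
qed

subsection \<open>The Hessian in the controls\<close>

text \<open>Rows are components of dH/du and columns are directions, so that multiplication by a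
  control vector is differentiation along it.\<close>

definition hess_u where
  "hess_u d k y = (\<chi> b a. fderiv (dH_du d k) y (0, 0, axis a 1, 0) $ b)"

lemma linear_d_dH_du: "bc d k \<Longrightarrow> y \<in> wdom k \<Longrightarrow> linear (fderiv (dH_du d k) y)"
  by (intro smooth_at_linear smooth_at_dH_du)

lemma d_dH_du_eq:
  assumes b: "bc d k" and y: "y \<in> wdom k"
  shows "fderiv (dH_du d k) y (t, q, u, p) =
    fderiv (dH_du d k) y (t, q, 0, p) + hess_u d k y *v u"
  unfolding hess_u_def by (rule linear_block[OF linear_d_dH_du[OF b y]])

lemma smooth_at_d_dH_du:
  assumes "bc d k" "y \<in> wdom k" "smooth_at v y"
  shows "smooth_at (\<lambda>y. fderiv (dH_du d k) y (v y)) y"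
  by (rule smooth_at_frechet[of "dH_du d k" "\<lambda>y. y"]) (intro smooth_at_dH_du smooth_at_ident assms)+

lemma smooth_at_hess_u: "bc d k \<Longrightarrow> y \<in> wdom k \<Longrightarrow> smooth_at (\<lambda>y. hess_u d k y $ i $ j) y"
  unfolding hess_u_def vec_lambda_beta by (intro smooth_at_vec_nth smooth_at_d_dH_du smooth_at_const)

definition drop_p :: "('n, 'm) W_coords \<Rightarrow> ('n, 'm) W0_coords" where
  "drop_p z = (fst z, fst (snd z), fst (snd (snd z)), snd (snd (snd (snd z))))"

lemma Ham_eq: "Ham E \<pi> L F d k = (\<lambda>z. fst (snd (snd (snd z))) - p_coord d k (drop_p z))"
  by (auto simp: fun_eq_iff Ham_def p_coord_def vel_def mom_def base_def drop_p_def inner_vec_def)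

lemma has_derivative_drop_p: "(drop_p has_derivative drop_p) (at z)"
  unfolding drop_p_def
  by (intro has_derivative_Pair has_derivative_fst has_derivative_snd has_derivative_ident)

lemma smooth_at_drop_p: "smooth_at drop_p z"
  unfolding drop_p_def by (intro smooth_at_intros)

lemma partial_Ham:
  assumes b: "bc d k" and z: "drop_p z \<in> wdom k"
  shows "partial v (Ham E \<pi> L F d k) z = fst (snd (snd (snd v))) - d_p_coord d k (drop_p z) (drop_p v)"
proof -
  have "((\<lambda>z. p_coord d k (drop_p z)) has_derivative (\<lambda>v. d_p_coord d k (drop_p z) (drop_p v))) (at z)"
    using diff_chain_at[OF has_derivative_drop_p smooth_at_has_derivative[OF smooth_at_p_coord[OF b z]]]
    by (simp add: comp_def d_p_coord_def)
  then have "(Ham E \<pi> L F d k has_derivative (\<lambda>v. fst (snd (snd (snd v))) - d_p_coord d k (drop_p z) (drop_p v))) (at z)"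
    unfolding Ham_eq
    by (intro has_derivative_diff has_derivative_fst has_derivative_snd has_derivative_ident)
  then show ?thesis by (simp add: partial_def frechet_derivativeI)
qed

lemma partials_Ham:
  assumes b: "bc d k" and z: "drop_p z \<in> wdom k"
  shows "partial_u a (Ham E \<pi> L F d k) z = dH_du d k (drop_p z) $ a"
    "partial_q i (Ham E \<pi> L F d k) z = - force d k (drop_p z) $ i"
    "partial_pi i (Ham E \<pi> L F d k) z = vel d k (drop_p z) $ i"
proof -
  have "drop_p (0, 0, axis a 1, 0, 0) = (0, 0, axis a 1, 0)" "drop_p (0, axis i 1, 0, 0, 0) = (0, axis i 1, 0, 0)"
    "drop_p (0, 0, 0, 0, axis i 1) = (0, 0, 0, axis i 1)" for a :: 'm and i :: 'n
    by (simp_all add: drop_p_def)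
  then show "partial_u a (Ham E \<pi> L F d k) z = dH_du d k (drop_p z) $ a"
    "partial_q i (Ham E \<pi> L F d k) z = - force d k (drop_p z) $ i"
    "partial_pi i (Ham E \<pi> L F d k) z = vel d k (drop_p z) $ i"
    by (simp_all add: partial_u_def partial_q_def partial_pi_def partial_Ham[OF b z] dH_du_def force_def
        d_p_coord_mom[OF b z] inner_axis)
qed

lemma partial_u_u_Ham:
  assumes b: "bc d k" and z: "drop_p z \<in> wdom k"
  shows "partial_u a (partial_u c (Ham E \<pi> L F d k)) z = hess_u d k (drop_p z) $ c $ a"
proof -
  have "\<forall>\<^sub>F z in nhds z. drop_p z \<in> wdom k"
    by (rule smooth_at_eventually_image[OF smooth_at_drop_p eventually_nhds_in_open[OF open_wdom[OF b] z]])
  then have ev: "\<forall>\<^sub>F z in nhds z. dH_du d k (drop_p z) $ c = partial_u c (Ham E \<pi> L F d k) z"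
    by eventually_elim (simp add: partials_Ham[OF b])
  have "((\<lambda>z. dH_du d k (drop_p z)) has_derivative
      (\<lambda>v. fderiv (dH_du d k) (drop_p z) (drop_p v))) (at z)"
    using diff_chain_at[OF has_derivative_drop_p smooth_at_has_derivative[OF smooth_at_dH_du[OF b z]]]
    by (simp add: comp_def)
  from bounded_linear.has_derivative[OF bounded_linear_vec_nth this, of c]
  have "(partial_u c (Ham E \<pi> L F d k) has_derivative
      (\<lambda>v. fderiv (dH_du d k) (drop_p z) (drop_p v) $ c)) (at z)"
    by (rule has_derivative_cong_nhds[OF _ ev])
  from frechet_derivativeI[OF this] show ?thesis
    unfolding partial_u_def[of a] partial_def by (simp add: hess_u_def drop_p_def)
qed

lemma drop_p_natural_coord:
  assumes b: "bc d k" and w: "w \<in> cdom (wchart d k)"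
  shows "drop_p (natural_coord E d k w) = coord (wchart d k) w"
  unfolding natural_coord_eq[OF b wchart_D(1,2)[OF w]]
  using wchart_coord[OF b wchart_D(1,2)[OF w]]
  by (intro base_mom_eqI) (simp_all add: base_def mom_def drop_p_def)

end

section \<open>Regularity and the field in natural coordinates\<close>

locale regular_control_problem = control_problem E FE \<pi> C FC \<pi>C L F
  for E :: "('e, 'n::finite E_coords) atlas" and FE :: "('fe, real^'n) atlas"
    and \<pi> :: "'e \<Rightarrow> real" and C :: "('c, ('n, 'm::finite) C_coords) atlas"
    and FC :: "('fc, real^'m) atlas" and \<pi>C :: "'c \<Rightarrow> 'e" and L :: "'c \<Rightarrow> real" and F :: "'c \<Rightarrow> 'e jet" +
  assumes regular: "regular_problem E \<pi> C \<pi>C L F"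
begin

lemma det_hess_u:
  assumes b: "bc d k" and y: "y \<in> wdom k" and c: "dH_du d k y = 0"
  shows "det (hess_u d k y) \<noteq> 0"
proof -
  let ?w = "wparam d k y" and ?H = "Ham E \<pi> L F d k"
  note w = coord_wparam[OF b y]
  have dr: "drop_p (natural_coord E d k ?w) = y" using drop_p_natural_coord[OF b w(1)] w(2) by simp
  have yy: "drop_p (natural_coord E d k ?w) \<in> wdom k" using y dr by simp
  have "\<forall>a. partial_u a ?H (natural_coord E d k ?w) = 0"
    using partials_Ham(1)[OF b yy] c dr by simp
  then have "rank ((\<chi> a c. partial_u a (partial_u c ?H) (natural_coord E d k ?w)) :: real^'m^'m) = CARD('m)"
    using regular b wchart_D(1,2)[OF w(1)] unfolding regular_problem_def by blast
  \<comment> \<open>The outer derivative carries the row index in the regularity condition but the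
    column index in \<open>hess_u\<close>. Comparing them up to transposition is enough for the
    determinant.\<close>
  moreover have "(\<chi> a c. partial_u a (partial_u c ?H) (natural_coord E d k ?w)) = transpose (hess_u d k y)"
    using partial_u_u_Ham[OF b yy] dr by (simp add: transpose_def vec_eq_iff)
  ultimately have "rank (transpose (hess_u d k y)) = CARD('m)" by simp
  then have "det (transpose (hess_u d k y)) \<noteq> 0" unfolding det_eq_0_rank by simp
  then show ?thesis unfolding det_transpose .
qed

text \<open>Minus the derivative of dH/du along the components that the equations prescribe.
  Tangency thus reads: Hessian times the control velocity equals \<open>rhs\<close>.\<close>

definition rhs where
  "rhs d k y = - fderiv (dH_du d k) y (1, vel d k y, 0, force d k y)"

text \<open>On the critical set the factor is $1/\det$, so that Cramer's rule yields the solution of the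
  tangency equation; the denominator vanishes nowhere, so that the formula is smooth on the
  whole chart.\<close>

definition u_dot where
  "u_dot d k y = (det (hess_u d k y) / ((det (hess_u d k y))\<^sup>2 + dH_du d k y \<bullet> dH_du d k y)) *\<^sub>R
     cramer_solve (hess_u d k y) (rhs d k y)"

definition field_coords where
  "field_coords d k y = (1, vel d k y, u_dot d k y, force d k y)"

lemma smooth_at_rhs: "bc d k \<Longrightarrow> y \<in> wdom k \<Longrightarrow> smooth_at (rhs d k) y"
  unfolding rhs_def
  by (intro smooth_at_minus smooth_at_d_dH_du smooth_at_Pair smooth_at_const smooth_at_vel smooth_at_force)

lemma smooth_at_field_coords:
  assumes b: "bc d k" and y: "y \<in> wdom k" shows "smooth_at (field_coords d k) y"
proof -
  \<comment> \<open>Both summands are nonnegative. If the sum were 0, the point would be critical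
    and regularity would make the determinant nonzero.\<close>
  have "(det (hess_u d k y))\<^sup>2 + dH_du d k y \<bullet> dH_du d k y \<noteq> 0"
    using det_hess_u[OF b y] by (metis add.right_neutral add_nonneg_eq_0_iff inner_eq_zero_iff inner_ge_zero
        power_eq_0_iff zero_le_power2)
  then have "smooth_at (u_dot d k) y"
    unfolding u_dot_def power2_eq_square
    by (intro smooth_at_scaleR smooth_at_divide smooth_at_add smooth_at_mult smooth_at_inner smooth_at_det
        smooth_at_hess_u smooth_at_dH_du smooth_at_cramer_solve smooth_at_rhs b y)
  then show ?thesis
    unfolding field_coords_def by (intro smooth_at_Pair smooth_at_const smooth_at_vel smooth_at_force b y)
qed

lemma field_coords_unique:
  assumes b: "bc d k" and y: "y \<in> wdom k" and c: "dH_du d k y = 0"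
    and x: "fst x = 1" "fst (snd x) = vel d k y" "mom x = force d k y"
  shows "fderiv (dH_du d k) y x = 0 \<longleftrightarrow> x = field_coords d k y"
proof -
  obtain u where u: "x = (1, vel d k y, u, force d k y)"
    using x by (cases x) (auto simp: mom_def)
  have "fderiv (dH_du d k) y x = 0 \<longleftrightarrow> hess_u d k y *v u = rhs d k y"
    unfolding u d_dH_du_eq[OF b y, of _ _ u] rhs_def by (auto simp: add_eq_0_iff)
  also have "\<dots> \<longleftrightarrow> u = u_dot d k y"
    using det_hess_u[OF b y c] by (simp add: cramer_solve u_dot_def c power2_eq_square)
  finally show ?thesis by (auto simp: u field_coords_def)
qed

end

section \<open>The final constraint submanifold and its vector field\<close>

context regular_control_problem
begin

text \<open>Solvability is a condition free of charts, so the set is the same in all natural charts;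
  dH/du = 0 is its local equation.\<close>

definition critical_set where
  "critical_set = {w \<in> carrier M. \<exists>X\<in>tangent_space M w. solves w X}"

lemma critical_set_iff:
  assumes b: "bc d k" and w: "w \<in> cdom (wchart d k)"
  shows "w \<in> critical_set \<longleftrightarrow> dH_du d k (coord (wchart d k) w) = 0"
proof
  assume "dH_du d k (coord (wchart d k) w) = 0"
  moreover have "coord_vector M (wchart d k) w (field_coords d k (coord (wchart d k) w)) \<in> tangent_space M w"
    by (rule M.coord_vector_tangent[OF wchart_in[OF b] w])
  ultimately show "w \<in> critical_set"
    using M.charts_carrier[OF wchart_in[OF b] w] solves_iff[OF b w] M.coord_vector_self[OF wchart_in[OF b] w]
    unfolding critical_set_def by (auto simp: field_coords_def mom_def intro!: bexI)
qed (use solves_iff[OF b w] in \<open>auto simp: critical_set_def\<close>)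

text \<open>One fixed subspace serves every point, which supplies the constant dimension demanded of
  a submanifold.\<close>

definition critical_slice :: "('n, 'm) W0_coords set" where
  "critical_slice = {x. fst (snd (snd x)) = 0}"

lemma subspace_critical_slice: "subspace critical_slice"
  by (auto simp: critical_slice_def subspace_def)

text \<open>The straightened chart has dH/du as its u-coordinates. The last conclusion translates
  tangency to the slice into the linear equation that determines the control velocity.\<close>

lemma critical_slice_chart:
  assumes b: "bc d k" and w: "w \<in> cdom (wchart d k)" and N: "w \<in> critical_set"
  obtains c where "w \<in> cdom c" "slice_chart M critical_set c critical_slice"
    "\<And>v. v \<in> tangent_space M w \<Longrightarrow>
      v c \<in> critical_slice \<longleftrightarrow> fderiv (dH_du d k) (coord (wchart d k) w) (v (wchart d k)) = 0"
proof -
  let ?y = "coord (wchart d k) w" and ?\<Phi> = "\<lambda>y. (fst y, fst (snd y), dH_du d k y, snd (snd (snd y)))"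
  note y = wparam_coord(1)[OF b w] and ch = wchart_in[OF b]
  have "dH_du d k ?y = 0" using critical_set_iff[OF b w] N by simp
  then have det: "det (\<chi> b a. fderiv (dH_du d k) ?y (0, 0, axis a 1, 0) $ b) \<noteq> 0"
    by (rule det_hess_u[OF b y, unfolded hess_u_def])
  obtain V \<Psi> where V: "open V" "?y \<in> V" "V \<subseteq> wdom k" "smooth_on V ?\<Phi>" "open (?\<Phi> ` V)"
    "smooth_on (?\<Phi> ` V) \<Psi>" "\<And>x. x \<in> V \<Longrightarrow> \<Psi> (?\<Phi> x) = x"
    by (rule straighten[OF open_wdom[OF b] y _ det], erule smooth_at_dH_du[OF b]) blast
  let ?c = "({p \<in> cdom (wchart d k). coord (wchart d k) p \<in> V}, \<lambda>p. ?\<Phi> (coord (wchart d k) p))"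
  have c: "?c \<in> charts M"
    by (rule M.charts_transform[OF ch V(1) _ V(4,5,6,7)]) (use V(3) wchart_image[OF b] in simp_all)
  have wc: "w \<in> cdom ?c" using w V(2) by simp
  have dH_du_c: "p \<in> critical_set \<longleftrightarrow> coord ?c p \<in> critical_slice" if "p \<in> cdom ?c" for p
    using critical_set_iff[OF b, of p] that by (simp add: critical_slice_def)
  have "slice_chart M critical_set ?c critical_slice"
    unfolding slice_chart_def
  proof (intro conjI c subspace_critical_slice equalityI subsetI)
    fix x assume "x \<in> coord ?c ` (cdom ?c \<inter> critical_set)"
    then obtain p where "p \<in> cdom ?c" "p \<in> critical_set" "x = coord ?c p" by blast
    then show "x \<in> coord ?c ` cdom ?c \<inter> critical_slice" using dH_du_c[of p] by blast
  next
    fix x assume "x \<in> coord ?c ` cdom ?c \<inter> critical_slice"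
    then obtain p where "p \<in> cdom ?c" "coord ?c p \<in> critical_slice" "x = coord ?c p" by blast
    then show "x \<in> coord ?c ` (cdom ?c \<inter> critical_set)" using dH_du_c[of p] by blast
  qed
  moreover have "v ?c \<in> critical_slice \<longleftrightarrow> fderiv (dH_du d k) ?y (v (wchart d k)) = 0"
    if v: "v \<in> tangent_space M w" for v
  proof -
    have der: "(?\<Phi> has_derivative (\<lambda>v. (fst v, fst (snd v), fderiv (dH_du d k) ?y v, snd (snd (snd v))))) (at ?y)"
      by (intro has_derivative_Pair has_derivative_fst has_derivative_snd has_derivative_ident
          smooth_at_has_derivative smooth_at_dH_du b y)
    \<comment> \<open>Near \<open>?y\<close> the transition from the natural chart to the new one is
      \<open>?\<Phi>\<close>; hence the u-slot of \<open>v ?c\<close> is the derivative of dH/du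
      along \<open>v\<close>.\<close>
    have "\<forall>\<^sub>F x in nhds ?y. ?\<Phi> x = (coord ?c \<circ> param (wchart d k)) x"
      using eventually_nhds_in_open[OF open_wdom[OF b] y]
      by eventually_elim (simp add: param_wchart[OF b] coord_wparam[OF b])
    from M.tangent_change[OF v ch w c wc] frechet_derivativeI[OF has_derivative_cong_nhds[OF der this]]
    show ?thesis by (simp add: critical_slice_def comp_def)
  qed
  ultimately show thesis using that[of ?c] wc by blast
qed

lemma submanifold_critical_set: "submanifold M critical_set"
  unfolding submanifold_def
proof (intro conjI exI[of _ "dim critical_slice"] ballI)
  show "critical_set \<subseteq> carrier M" by (auto simp: critical_set_def)
  fix w assume w: "w \<in> critical_set"
  then obtain d k where "bc d k" "w \<in> cdom (wchart d k)" using carrier_M[of w] by (auto simp: critical_set_def)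
  from critical_slice_chart[OF this w] obtain c where "w \<in> cdom c" "slice_chart M critical_set c critical_slice" by metis
  then show "\<exists>c S. w \<in> cdom c \<and> slice_chart M critical_set c S \<and> dim S = dim critical_slice" by blast
qed

text \<open>Everything demanded of the field at one point, without reference to natural coordinates;
  values built in different natural charts can therefore be compared.\<close>

definition is_sol where
  "is_sol w X \<longleftrightarrow> X \<in> tangent_space M w \<and> solves w X \<and>
     (\<forall>c S. w \<in> cdom c \<and> slice_chart M critical_set c S \<longrightarrow> X c \<in> S)"

text \<open>Existence and uniqueness in one equivalence. Tangency is checked in the straightened
  chart only, and \<open>slice_tangent\<close> carries it to every other slice chart.\<close>

lemma is_sol_iff:
  assumes b: "bc d k" and w: "w \<in> cdom (wchart d k)" and N: "w \<in> critical_set"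
    and X: "X \<in> tangent_space M w"
  shows "is_sol w X \<longleftrightarrow> X (wchart d k) = field_coords d k (coord (wchart d k) w)"
proof -
  let ?y = "coord (wchart d k) w"
  note y = wparam_coord(1)[OF b w]
  have c0: "dH_du d k ?y = 0" using critical_set_iff[OF b w] N by simp
  obtain c where c: "w \<in> cdom c" "slice_chart M critical_set c critical_slice"
    "\<And>v. v \<in> tangent_space M w \<Longrightarrow>
      v c \<in> critical_slice \<longleftrightarrow> fderiv (dH_du d k) ?y (v (wchart d k)) = 0"
    by (rule critical_slice_chart[OF b w N]) blast
  show ?thesis
  proof
    assume s: "is_sol w X"
    then have "X c \<in> critical_slice" using c(1,2) unfolding is_sol_def by blast
    then have "fderiv (dH_du d k) ?y (X (wchart d k)) = 0" using c(3)[OF X] by simp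
    moreover have "solves w X" using s by (simp add: is_sol_def)
    ultimately show "X (wchart d k) = field_coords d k ?y"
      using solves_iff[OF b w X] field_coords_unique[OF b y c0, of "X (wchart d k)"] by simp
  next
    assume z: "X (wchart d k) = field_coords d k ?y"
    then have "solves w X"
      using solves_iff[OF b w X] c0 by (simp add: field_coords_def mom_def)
    moreover have "fderiv (dH_du d k) ?y (X (wchart d k)) = 0"
      using field_coords_unique[OF b y c0, of "X (wchart d k)"] z by (simp add: field_coords_def mom_def)
    then have "X c \<in> critical_slice" using c(3)[OF X] by simp
    then have "X c' \<in> S'" if "w \<in> cdom c'" "slice_chart M critical_set c' S'" for c' S'
      by (rule M.slice_tangent[OF c(2,1) that(2,1) N X])
    ultimately show "is_sol w X" using X by (simp add: is_sol_def)
  qed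
qed

lemma is_sol_coord_vector:
  assumes b: "bc d k" and w: "w \<in> cdom (wchart d k)" and N: "w \<in> critical_set"
  shows "is_sol w (coord_vector M (wchart d k) w (field_coords d k (coord (wchart d k) w)))"
  using is_sol_iff[OF b w N M.coord_vector_tangent[OF wchart_in[OF b] w]] M.coord_vector_self[OF wchart_in[OF b] w]
  by simp

lemma is_sol_unique:
  assumes "w \<in> critical_set" "is_sol w X" "is_sol w Y" shows "X = Y"
proof -
  obtain d k where bw: "bc d k" "w \<in> cdom (wchart d k)" using assms(1) carrier_M[of w] by (auto simp: critical_set_def)
  have XY: "X \<in> tangent_space M w" "Y \<in> tangent_space M w" using assms by (auto simp: is_sol_def)
  show ?thesis
    by (rule M.tangent_eqI[OF XY wchart_in[OF bw(1)] bw(2)])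
      (use is_sol_iff[OF bw assms(1) XY(1)] is_sol_iff[OF bw assms(1) XY(2)] assms in simp)
qed

text \<open>Natural chart domains are full preimages under the projection to \<open>C\<close>. This
  is why functions of the control alone can localize fields.\<close>

lemma wchartI: "w \<in> carrier M \<Longrightarrow> fst w \<in> cdom k \<Longrightarrow> w \<in> cdom (wchart d k)"
  using carrier_M[of w] by (auto simp: wchart_def)

lemma fst_carrier: "w \<in> carrier M \<Longrightarrow> fst w \<in> carrier C"
  using carrier_M[of w] wchart_D(2) bundle_chartsD(9) by blast

lemma eventually_fst:
  assumes w: "w \<in> carrier M" and P: "eventually P (mnhds C (fst w))"
  shows "\<forall>\<^sub>F q in mnhds M w. P (fst q)"
proof -
  obtain d k where b: "bc d k" and wk: "w \<in> cdom (wchart d k)" using carrier_M[OF w] by blast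
  have "\<forall>\<^sub>F x in nhds (base (coord (wchart d k) w)). P (param k x)"
    using P unfolding C.eventually_mnhds[OF bundle_chartsD(2)[OF b] wchart_D(2)[OF wk]] wchart_coord(1)[OF b wchart_D(1,2)[OF wk]] .
  from smooth_at_eventually_image[OF smooth_at_base this] eventually_nhds_in_open[OF open_wdom[OF b] wparam_coord(1)[OF b wk]]
  show ?thesis unfolding M.eventually_mnhds[OF wchart_in[OF b] wk]
    by eventually_elim (simp add: param_wchart[OF b] wparam_def Let_def)
qed

lemma msmooth_fst:
  fixes f :: "'c \<Rightarrow> 'z::euclidean_space"
  assumes w: "w \<in> carrier M" and f: "\<And>c. c \<in> carrier C \<Longrightarrow> msmooth C f c"
  shows "msmooth M (\<lambda>w. f (fst w)) w"
proof -
  obtain d k where b: "bc d k" and wk: "w \<in> cdom (wchart d k)" using carrier_M[OF w] by blast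
  show ?thesis
  proof (rule wchart_msmooth(1)[OF b wk])
    show "smooth_at (\<lambda>y. f (param k (base y))) (coord (wchart d k) w)"
      by (rule smooth_at_on_base[OF b wparam_coord(1)[OF b wk]]) (rule f[OF bundle_chartsD(9)[OF b]])
  qed (simp add: wparam_def Let_def)
qed

text \<open>The coordinate solution is multiplied by a bump function and extended by 0. The last
  conclusion names an arbitrary solution X instead of a chart, so that fields from different charts
  can be added; away from the chart both sides are 0.\<close>

lemma local_field:
  assumes b: "bc d k" and c: "c \<in> cdom k"
  obtains V and \<psi> :: "'c \<Rightarrow> real" and Y where "open_in C V" "c \<in> V" "\<And>x. x \<in> V \<Longrightarrow> \<psi> x = 1"
    "\<And>x. x \<in> carrier C \<Longrightarrow> msmooth C \<psi> x" "vector_field M Y"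
    "\<And>w X. w \<in> critical_set \<Longrightarrow> is_sol w X \<Longrightarrow> Y w = (\<lambda>a. \<psi> (fst w) *\<^sub>R X a)"
proof -
  obtain \<psi> V where \<psi>: "open_in C V" "c \<in> V" "\<And>x. x \<in> V \<Longrightarrow> \<psi> x = (1::real)"
    "\<And>x. x \<in> carrier C \<Longrightarrow> msmooth C \<psi> x"
    "\<And>x. x \<in> carrier C \<Longrightarrow> x \<notin> cdom k \<Longrightarrow> \<forall>\<^sub>F r in mnhds C x. \<psi> r = 0"
    by (rule manifold_bump[OF manifold_C bundle_chartsD(2)[OF b] c]) blast
  define Y where "Y w = (if w \<in> cdom (wchart d k)
      then (\<lambda>a. \<psi> (fst w) *\<^sub>R coord_vector M (wchart d k) w (field_coords d k (coord (wchart d k) w)) a) else (\<lambda>a. 0))" for w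
  note ch = wchart_in[OF b]
  have vf: "vector_field M Y"
  proof (rule M.vector_fieldI)
    fix w assume w: "w \<in> carrier M"
    show "Y w \<in> tangent_space M w"
      unfolding Y_def using M.zero_tangent M.tangent_scale[OF M.coord_vector_tangent[OF ch]] by simp
    show "\<exists>c\<in>charts M. w \<in> cdom c \<and> msmooth M (\<lambda>q. Y q c) w"
    proof (cases "w \<in> cdom (wchart d k)")
      case True
      have "msmooth M (\<lambda>q. \<psi> (fst q) *\<^sub>R field_coords d k (coord (wchart d k) q)) w"
        by (intro M.msmooth_scaleR msmooth_fst w \<psi>(4) M.msmooth_compose[OF M.msmooth_coord[OF ch True]]
            smooth_at_field_coords[OF b wparam_coord(1)[OF b True]])
      then have "msmooth M (\<lambda>q. Y q (wchart d k)) w"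
        by (rule M.msmooth_cong)
          (rule eventually_mono[OF M.eventually_in_chart[OF ch True]], simp add: Y_def M.coord_vector_self[OF ch])
      with ch True show ?thesis by blast
    next
      case False
      obtain d' k' where b': "bc d' k'" and wk': "w \<in> cdom (wchart d' k')" using carrier_M[OF w] by blast
      \<comment> \<open>\<open>manifold_bump\<close> provides vanishing on a whole neighbourhood of
        each point off the domain of \<open>k\<close>, so the extension is smooth at
        \<open>w\<close>.\<close>
      have "\<forall>\<^sub>F q in mnhds M w. \<psi> (fst q) = 0"
        using False wchartI[OF w, of k d] by (intro eventually_fst[OF w] \<psi>(5) fst_carrier[OF w]) blast
      then have "\<forall>\<^sub>F q in mnhds M w. 0 = Y q (wchart d' k')"
        by (rule eventually_mono) (simp add: Y_def)
      from M.msmooth_cong[OF M.msmooth_const[OF w] this]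
      show ?thesis using wchart_in[OF b'] wk' by blast
    qed
  qed
  have "Y w = (\<lambda>a. \<psi> (fst w) *\<^sub>R X a)" if w: "w \<in> critical_set" and X: "is_sol w X" for w X
  proof (cases "w \<in> cdom (wchart d k)")
    case True
    then show ?thesis using is_sol_unique[OF w X is_sol_coord_vector[OF b True w]] by (simp add: Y_def)
  next
    case False
    have wM: "w \<in> carrier M" using w by (simp add: critical_set_def)
    have "fst w \<notin> cdom k" using False wchartI[OF wM] by blast
    then have "\<psi> (fst w) = 0"
      using C.carrier_chart[OF fst_carrier[OF wM]] C.in_charts C.eventually_mnhds_self \<psi>(5)[OF fst_carrier[OF wM]] by blast
    then show ?thesis using False by (simp add: Y_def)
  qed
  with \<psi> vf show thesis using that by blast
qed

text \<open>The weights $\psi_n \prod_{j<n} (1 - \psi_j)$ have the telescoping sums $1 - \prod_{j<n} (1 - \psi_j)$, and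
  on the open set where $\psi_m = 1$ they vanish for all $n > m$; this replaces a locally finite
  partition of unity.\<close>

lemma telescoping_weights:
  fixes f :: "nat \<Rightarrow> real"
  shows "(\<Sum>n<N. (\<Prod>j<n. 1 - f j) * f n) = 1 - (\<Prod>j<N. 1 - f j)"
  by (induction N) (simp_all add: algebra_simps)

text \<open>On the critical set every local field is its bump function times the same solution, so
  weights with sum 1 reproduce that solution; off the critical set only smoothness is asked.\<close>

lemma global_field:
  obtains Z where "vector_field M Z" "\<And>w. w \<in> critical_set \<Longrightarrow> is_sol w (Z w)"
proof -
  \<comment> \<open>By the definition of its atlas, the restricted space lies over this part of
    \<open>C\<close>.\<close>
  define U where "U = {c. \<exists>d k. bc d k \<and> c \<in> cdom k}"
  have "\<forall>c\<in>U. \<exists>V \<psi> Y. open_in C V \<and> c \<in> V \<and> (\<forall>x\<in>V. \<psi> x = (1::real)) \<and>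
    (\<forall>x\<in>carrier C. msmooth C \<psi> x) \<and> vector_field M Y \<and>
    (\<forall>w X. w \<in> critical_set \<longrightarrow> is_sol w X \<longrightarrow> Y w = (\<lambda>a. \<psi> (fst w) *\<^sub>R X a))"
  proof
    fix c assume "c \<in> U"
    then obtain d k where "bc d k" "c \<in> cdom k" by (auto simp: U_def)
    from local_field[OF this] obtain V and \<psi> :: "'c \<Rightarrow> real" and Y where "open_in C V" "c \<in> V" "\<And>x. x \<in> V \<Longrightarrow> \<psi> x = 1"
      "\<And>x. x \<in> carrier C \<Longrightarrow> msmooth C \<psi> x" "vector_field M Y"
      "\<And>w X. w \<in> critical_set \<Longrightarrow> is_sol w X \<Longrightarrow> Y w = (\<lambda>a. \<psi> (fst w) *\<^sub>R X a)" by metis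
    then show "\<exists>V \<psi> Y. open_in C V \<and> c \<in> V \<and> (\<forall>x\<in>V. \<psi> x = (1::real)) \<and>
      (\<forall>x\<in>carrier C. msmooth C \<psi> x) \<and> vector_field M Y \<and>
      (\<forall>w X. w \<in> critical_set \<longrightarrow> is_sol w X \<longrightarrow> Y w = (\<lambda>a. \<psi> (fst w) *\<^sub>R X a))" by blast
  qed
  then obtain V \<psi> Y where "\<forall>c\<in>U. open_in C (V c) \<and> c \<in> V c \<and> (\<forall>x\<in>V c. \<psi> c x = (1::real)) \<and>
    (\<forall>x\<in>carrier C. msmooth C (\<psi> c) x) \<and> vector_field M (Y c) \<and>
    (\<forall>w X. w \<in> critical_set \<longrightarrow> is_sol w X \<longrightarrow> Y c w = (\<lambda>a. \<psi> c (fst w) *\<^sub>R X a))"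
    unfolding bchoice_iff by (elim exE) blast
  then have V: "\<And>c. c \<in> U \<Longrightarrow> open_in C (V c)" "\<And>c. c \<in> U \<Longrightarrow> c \<in> V c"
    and \<psi>: "\<And>c x. c \<in> U \<Longrightarrow> x \<in> V c \<Longrightarrow> \<psi> c x = 1" "\<And>c x. c \<in> U \<Longrightarrow> x \<in> carrier C \<Longrightarrow> msmooth C (\<psi> c) x"
    and Y: "\<And>c. c \<in> U \<Longrightarrow> vector_field M (Y c)"
      "\<And>c w X. c \<in> U \<Longrightarrow> w \<in> critical_set \<Longrightarrow> is_sol w X \<Longrightarrow> Y c w = (\<lambda>a. \<psi> c (fst w) *\<^sub>R X a)"
    by blast+
  obtain J where J: "countable J" "J \<subseteq> U" "(\<Union>c\<in>U. V c) = (\<Union>c\<in>J. V c)"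
    by (rule manifold_countable_subcover[OF manifold_C, of U V]) (use V(1) in blast)+
  have cover: "\<exists>c\<in>J. fst w \<in> V c" if w: "w \<in> carrier M" for w
  proof -
    obtain d k where "bc d k" "w \<in> cdom (wchart d k)" using carrier_M[OF w] by blast
    then have "fst w \<in> U" unfolding U_def using wchart_D(2) by blast
    then show ?thesis using V(2) J(3) by blast
  qed
  show thesis
  proof (cases "J = {}")
    case True
    \<comment> \<open>There is nothing to enumerate; the space is empty and the zero field
      serves.\<close>
    then have "carrier M = {}" using cover by blast
    then show thesis using that[of "\<lambda>w a. 0"] M.vector_fieldI[of "\<lambda>w a. 0"] by (simp add: critical_set_def)
  next
    case False
    \<comment> \<open>Elements may be repeated, which is harmless: the telescoping identity holds
      for any sequence.\<close>
    define e where "e = from_nat_into J"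
    have e: "e n \<in> U" for n using from_nat_into[OF False, of n] J(2) by (auto simp: e_def)
    have cover': "\<exists>m. fst w \<in> V (e m)" if "w \<in> carrier M" for w
      using cover[OF that] from_nat_into_surj[OF J(1)] unfolding e_def by metis
    define \<rho> where "\<rho> n x = (\<Prod>j<n. 1 - \<psi> (e j) x)" for n x
    \<comment> \<open>A canonical number of terms. \<open>cover'\<close> makes the
      \<open>LEAST\<close> meaningful at every point below the restricted space.\<close>
    define m where "m x = (LEAST n. x \<in> V (e n))" for x
    define Z where "Z w = (\<lambda>a. \<Sum>n<Suc (m (fst w)). \<rho> n (fst w) *\<^sub>R Y (e n) w a)" for w
    have zero: "\<rho> n x = 0" if "x \<in> V (e l)" "l < n" for l n x
      using that \<psi>(1)[OF e that(1)] by (auto simp: \<rho>_def intro!: prod_zero)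
    \<comment> \<open>The sum may be cut at any index l with \<open>fst w\<close> in
      \<open>V (e l)\<close>, since later weights vanish. Above this open set the number of terms is
      thus constant, and smoothness is that of a finite sum.\<close>
    have Z_eq: "Z w = (\<lambda>a. \<Sum>n<Suc l. \<rho> n (fst w) *\<^sub>R Y (e n) w a)" if l: "fst w \<in> V (e l)" for w l
    proof -
      have m: "fst w \<in> V (e (m (fst w)))" "m (fst w) \<le> l" unfolding m_def by (rule LeastI[of "\<lambda>n. fst w \<in> V (e n)", OF l], rule Least_le[of "\<lambda>n. fst w \<in> V (e n)", OF l])
      have "(\<Sum>n<Suc (m (fst w)). \<rho> n (fst w) *\<^sub>R Y (e n) w a) = (\<Sum>n<Suc l. \<rho> n (fst w) *\<^sub>R Y (e n) w a)" for a
        by (rule sum.mono_neutral_left) (use m zero[OF m(1)] in auto)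
      then show ?thesis by (simp add: Z_def)
    qed
    have "vector_field M Z"
    proof (rule M.vector_fieldI)
      fix w assume w: "w \<in> carrier M"
      obtain l where l: "fst w \<in> V (e l)" using cover'[OF w] by blast
      obtain d k where b: "bc d k" and wk: "w \<in> cdom (wchart d k)" using carrier_M[OF w] by blast
      show "Z w \<in> tangent_space M w"
        unfolding Z_eq[OF l] using Y(1)[OF e] w by (intro M.tangent_sum) (simp add: vector_field_def)
      have "msmooth M (\<lambda>q. \<Sum>n<Suc l. \<rho> n (fst q) *\<^sub>R Y (e n) q (wchart d k)) w"
      proof (intro M.msmooth_sum w M.msmooth_scaleR M.vector_field_msmooth[OF Y(1)[OF e] wchart_in[OF b] wk] msmooth_fst)
        fix n c assume "c \<in> carrier C"
        then show "msmooth C (\<rho> n) c"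
          unfolding \<rho>_def by (intro C.msmooth_prod C.msmooth_diff C.msmooth_const \<psi>(2) e)
      qed
      moreover have "\<forall>\<^sub>F q in mnhds M w. (\<Sum>n<Suc l. \<rho> n (fst q) *\<^sub>R Y (e n) q (wchart d k)) = Z q (wchart d k)"
        by (rule eventually_mono[OF eventually_fst[OF w C.eventually_open_in[OF V(1)[OF e] l]]])
          (simp add: Z_eq)
      ultimately have "msmooth M (\<lambda>q. Z q (wchart d k)) w" by (rule M.msmooth_cong)
      then show "\<exists>c\<in>charts M. w \<in> cdom c \<and> msmooth M (\<lambda>q. Z q c) w" using wchart_in[OF b] wk by blast
    qed
    moreover have "is_sol w (Z w)" if w: "w \<in> critical_set" for w
    proof -
      have wM: "w \<in> carrier M" using w by (simp add: critical_set_def)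
      obtain d k where b: "bc d k" and wk: "w \<in> cdom (wchart d k)" using carrier_M[OF wM] by blast
      obtain l where l: "fst w \<in> V (e l)" using cover'[OF wM] by blast
      obtain X where X: "is_sol w X" using is_sol_coord_vector[OF b wk w] by blast
      have "Z w a = X a" for a
      proof -
        \<comment> \<open>The factor \<psi> of each weight is already contained in
          \<open>Y (e n)\<close>. The coefficients telescope to 1 because the product up to
          \<open>Suc l\<close> contains the factor 1 - 1.\<close>
        have "Z w a = (\<Sum>n<Suc l. (\<rho> n (fst w) * \<psi> (e n) (fst w)) *\<^sub>R X a)"
          by (simp only: Z_eq[OF l] Y(2)[OF e w X] scaleR_scaleR)
        also have "\<dots> = (1 - \<rho> (Suc l) (fst w)) *\<^sub>R X a"
          unfolding scaleR_sum_left[symmetric] \<rho>_def telescoping_weights ..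
        finally show ?thesis using zero[OF l, of "Suc l"] by simp
      qed
      then have "Z w = X" by blast
      then show ?thesis using X by simp
    qed
    ultimately show thesis using that by blast
  qed
qed

text \<open>At critical points the velocity of the curve has the components
  \<open>field_coords\<close>, whose entries are partial derivatives of H up to sign. H = 0
  expresses membership in the restricted space, and dH/du = 0 membership in the critical
  set.\<close>

lemma Pontryagin_conditions:
  assumes Z: "\<And>w. w \<in> critical_set \<Longrightarrow> is_sol w (Z w)" and \<Gamma>: "integral_curve M Z I \<Gamma>" and N: "\<Gamma> ` I \<subseteq> critical_set"
    and b: "bc d k" and s: "s \<in> I" and k: "fst (\<Gamma> s) \<in> cdom k"
  defines "x \<equiv> \<lambda>r. natural_coord E d k (\<Gamma> r)" and "H \<equiv> Ham E \<pi> L F d k"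
  shows "((\<lambda>r. t_of (x r)) has_real_derivative 1) (at s)"
    "((\<lambda>r. q_of (x r) $ i) has_real_derivative partial_pi i H (x s)) (at s)"
    "((\<lambda>r. pi_of (x r) $ i) has_real_derivative - partial_q i H (x s)) (at s)"
    "H (x s) = 0" "partial_u a H (x s) = 0"
proof -
  let ?w = "\<Gamma> s"
  have wN: "?w \<in> critical_set" using N s by blast
  then have wM: "?w \<in> carrier M" by (simp add: critical_set_def)
  have w: "?w \<in> cdom (wchart d k)" by (rule wchartI[OF wM k])
  note y = wparam_coord(1)[OF b w]
  have I: "open I" "smooth_map (restrict_atlas euclidean_atlas I) M \<Gamma>" "velocity M \<Gamma> s = Z ?w"
    using \<Gamma> s by (auto simp: integral_curve_def)
  have "Z ?w \<in> tangent_space M ?w" using Z[OF wN] by (simp add: is_sol_def)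
  from is_sol_iff[OF b w wN this] have "velocity M \<Gamma> s (wchart d k) = field_coords d k (coord (wchart d k) ?w)"
    using Z[OF wN] I(3) by simp
  then have der: "((\<lambda>r. coord (wchart d k) (\<Gamma> r)) has_vector_derivative field_coords d k (coord (wchart d k) ?w)) (at s)"
    using M.velocity_coord[OF M.smooth_map_curve_at[OF I(2,1) s] wchart_in[OF b] w] by simp
  have co: "coord (wchart d k) (\<Gamma> r) = drop_p (x r)" for r
    by (simp add: wchart_def x_def drop_p_def case_prod_unfold)
  have of: "t_of z = fst (drop_p z)" "q_of z = fst (snd (drop_p z))" "pi_of z = snd (snd (snd (drop_p z)))"
    for z :: "('n, 'm) W_coords"
    by (simp_all add: t_of_def q_of_def pi_of_def drop_p_def case_prod_unfold)
  have ys: "drop_p (x s) \<in> wdom k" using y unfolding co .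
  \<comment> \<open>Each scalar component is a bounded linear function of the coordinates, so its
    derivative is that function of the velocity.\<close>
  have lin: "((\<lambda>r. h (drop_p (x r))) has_real_derivative h (field_coords d k (drop_p (x s)))) (at s)"
    if "bounded_linear h" for h :: "('n, 'm) W0_coords \<Rightarrow> real"
    using bounded_linear.has_vector_derivative[OF that der]
    unfolding co has_real_derivative_iff_has_vector_derivative .
  show "((\<lambda>r. t_of (x r)) has_real_derivative 1) (at s)"
    using lin[OF bounded_linear_fst] by (simp add: of field_coords_def)
  have "bounded_linear (\<lambda>z :: ('n, 'm) W0_coords. fst (snd z) $ i)"
    by (intro bounded_linear_compose[OF bounded_linear_vec_nth]
        bounded_linear_compose[OF bounded_linear_fst bounded_linear_snd])
  from lin[OF this] show "((\<lambda>r. q_of (x r) $ i) has_real_derivative partial_pi i H (x s)) (at s)"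
    by (simp add: of field_coords_def H_def partials_Ham[OF b ys])
  have "bounded_linear (\<lambda>z :: ('n, 'm) W0_coords. snd (snd (snd z)) $ i)"
    by (intro bounded_linear_compose[OF bounded_linear_vec_nth] bounded_linear_compose[OF bounded_linear_snd]
        bounded_linear_snd)
  from lin[OF this] show "((\<lambda>r. pi_of (x r) $ i) has_real_derivative - partial_q i H (x s)) (at s)"
    by (simp add: of field_coords_def H_def partials_Ham[OF b ys])
  show "H (x s) = 0"
    unfolding H_def Ham_eq co[symmetric]
    by (simp add: x_def natural_coord_eq[OF b wchart_D(1,2)[OF w]] p_coord_eq[OF b w])
  show "partial_u a H (x s) = 0"
    using critical_set_iff[OF b w] wN by (simp add: H_def partials_Ham[OF b ys] co)
qed

end

text \<open>The equations and the tangency constrain the field only at points of \<open>W1\<close>,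
  so uniqueness is asserted there; \<open>W1\<close> itself is pinned down as the full set of points
  where the equations have a solution.\<close>

theorem proposition3:
  fixes E :: "('e, 'n::finite E_coords) atlas"
    and FE :: "('fe, real^'n) atlas"
    and \<pi> :: "'e \<Rightarrow> real"
    and C :: "('c, ('n, 'm::finite) C_coords) atlas"
    and FC :: "('fc, real^'m) atlas"
    and \<pi>C :: "'c \<Rightarrow> 'e"
    and L :: "'c \<Rightarrow> real"
    and F :: "'c \<Rightarrow> 'e jet"
  assumes "optimal_control_problem E FE \<pi> C FC \<pi>C L F"
    and "regular_problem E \<pi> C \<pi>C L F"
  shows "\<exists>W1 Z.
     submanifold (W0 E \<pi> C \<pi>C L F) W1 \<and>
     W1 = {w \<in> carrier (W0 E \<pi> C \<pi>C L F).
             \<exists>X \<in> tangent_space (W0 E \<pi> C \<pi>C L F) w. solves_at E \<pi> C \<pi>C L F w X} \<and>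
     vector_field (W0 E \<pi> C \<pi>C L F) Z \<and>
     tangent_to (W0 E \<pi> C \<pi>C L F) W1 Z \<and>
     (\<forall>w\<in>W1. solves_at E \<pi> C \<pi>C L F w (Z w)) \<and>
     (\<forall>Z'. vector_field (W0 E \<pi> C \<pi>C L F) Z' \<and>
           tangent_to (W0 E \<pi> C \<pi>C L F) W1 Z' \<and>
           (\<forall>w\<in>W1. solves_at E \<pi> C \<pi>C L F w (Z' w))
        \<longrightarrow> (\<forall>w\<in>W1. Z' w = Z w)) \<and>
     (\<forall>I \<Gamma> d k s.
        integral_curve (W0 E \<pi> C \<pi>C L F) Z I \<Gamma> \<and> \<Gamma> ` I \<subseteq> W1 \<and>
        bundle_charts E \<pi> C \<pi>C d k \<and> s \<in> I \<and> fst (\<Gamma> s) \<in> cdom k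
        \<longrightarrow>
        (let x = (\<lambda>r. natural_coord E d k (\<Gamma> r)); H = Ham E \<pi> L F d k in
           ((\<lambda>r. t_of (x r)) has_real_derivative 1) (at s) \<and>
           (\<forall>i. ((\<lambda>r. q_of (x r) $ i) has_real_derivative partial_pi i H (x s)) (at s)) \<and>
           (\<forall>i. ((\<lambda>r. pi_of (x r) $ i) has_real_derivative - partial_q i H (x s)) (at s)) \<and>
           H (x s) = 0 \<and>
           (\<forall>a. partial_u a H (x s) = 0)))"
proof -
  interpret regular_control_problem E FE \<pi> C FC \<pi>C L F
    by unfold_locales (fact assms)+
  obtain Z where Z: "vector_field M Z" "\<And>w. w \<in> critical_set \<Longrightarrow> is_sol w (Z w)"
    by (rule global_field) blast
  show ?thesis
  proof (intro exI[of _ critical_set] exI[of _ Z] conjI allI impI ballI; (elim conjE)?)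
    show "submanifold M critical_set" by (rule submanifold_critical_set)
    show "critical_set = {w \<in> carrier M. \<exists>X\<in>tangent_space M w. solves w X}"
      by (rule critical_set_def)
    show "vector_field M Z" by (rule Z(1))
    show "tangent_to M critical_set Z"
      using Z(2) unfolding tangent_to_def is_sol_def by blast
    show "solves w (Z w)" if "w \<in> critical_set" for w
      using Z(2)[OF that] by (simp add: is_sol_def)
  next
    fix Z' w
    assume Z': "vector_field M Z'" "tangent_to M critical_set Z'" "\<forall>w\<in>critical_set. solves w (Z' w)"
      and w: "w \<in> critical_set"
    have "w \<in> carrier M" using w by (simp add: critical_set_def)
    then have "Z' w \<in> tangent_space M w" using Z'(1) by (simp add: vector_field_def)
    then have "is_sol w (Z' w)" using Z'(2,3) w unfolding is_sol_def tangent_to_def by blast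
    then show "Z' w = Z w" by (rule is_sol_unique[OF w _ Z(2)[OF w]])
  next
    fix I \<Gamma> d k s
    assume "integral_curve M Z I \<Gamma>" "\<Gamma> ` I \<subseteq> critical_set" "bc d k" "s \<in> I" "fst (\<Gamma> s) \<in> cdom k"
    from Pontryagin_conditions[OF Z(2) this]
    show "let x = (\<lambda>r. natural_coord E d k (\<Gamma> r)); H = Ham E \<pi> L F d k in
           ((\<lambda>r. t_of (x r)) has_real_derivative 1) (at s) \<and>
           (\<forall>i. ((\<lambda>r. q_of (x r) $ i) has_real_derivative partial_pi i H (x s)) (at s)) \<and>
           (\<forall>i. ((\<lambda>r. pi_of (x r) $ i) has_real_derivative - partial_q i H (x s)) (at s)) \<and>
           H (x s) = 0 \<and>
           (\<forall>a. partial_u a H (x s) = 0)"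
      unfolding Let_def by blast
  qed
qed

end
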